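(* Let $\Omega\subset\mathbb{R}^3$ be a bounded domain with Lipschitz boundary, let $2<q<3$, $\gamma>0$, let $Z\colon\mathbb{R}^{3\times3}\to[0,+\infty)$ be convex and $C^1$, and let $h\colon\mathbb{R}\to[0,+\infty]$ be such that: $h$ is convex and $C^1$ on $(0,+\infty)$; $\lim_{t\to0+}h(t)=+\infty$ and $\liminf_{t\to\infty}h(t)/t>0$; and $h(t)=+\infty$ for $t\le0$. Let $W\colon\mathbb{R}^{3\times3}\to[0,+\infty]$ be given by $$W(A):=|A|^q+\gamma|A|^2+Z(\operatorname{cof}A)+h(\det A),$$ and $I(u):=\int_\Omega W(\nabla u(x))\,dx$. Let $\kappa=\kappa(q)$ be the constant described in the context. Let $\lambda>0$ be such that $$\frac{\kappa}{h'(\lambda^3)\,\lambda^{3-q}}\ \ge\ (q-2)^{(q-2)/2}q^{-q/2}\qquad\text{and}\qquad\frac{\gamma}{\lambda\,h'(\lambda^3)}\ \ge\ \frac12 .$$ Then any $u\in\mathcal{A}_\lambda$ satisfies $I(u)\ge I(u_\lambda)$.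
   Context: $|A|=(\operatorname{tr}(A^TA))^{1/2}$, $A\cdot B=\operatorname{tr}(A^TB)$, $\operatorname{cof}A$ is the cofactor matrix; $u_\lambda(x):=\lambda x$. The admissible class is $\mathcal{A}_\lambda:=\{u\in W^{1,q}(\Omega,\mathbb{R}^3): u=u_\lambda \text{ on }\partial\Omega \text{ (in the sense of traces)},\ \det\nabla u>0\text{ a.e. in }\Omega\}$. The constant $\kappa=\kappa(q)$ is a fixed constant with $2^{2-q}\le\kappa\le q2^{1-q}$ for which $|F|^q\ge|A|^q+q|A|^{q-2}A\cdot(F-A)+\kappa|F-A|^q$ holds for all $A,F\in\mathbb{R}^{3\times3}$. The displayed conditions on $\lambda$ are understood to concern the case $h'(\lambda^3)>0$. $I(u)$ may equal $+\infty$. *)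

theory Defs
  imports "HOL-Analysis.Analysis"
begin

text \<open>
  The norm and inner product of \<^typ>\<open>real^3^3\<close> are the Frobenius ones, so \<open>norm A\<close> is used
  for \<open>|A|\<close> and \<open>A \<bullet> B\<close> for \<open>tr (A\<^sup>T B)\<close>.
\<close>

lemma inner_matrix_eq_trace:
  fixes A B :: "real^'n^'n"
  shows "A \<bullet> B = trace (transpose A ** B)"
proof -
  have "A \<bullet> B = (\<Sum>i\<in>UNIV. \<Sum>j\<in>UNIV. A $ i $ j * B $ i $ j)"
    by (simp add: inner_vec_def)
  also have "\<dots> = (\<Sum>j\<in>UNIV. \<Sum>i\<in>UNIV. A $ i $ j * B $ i $ j)"
    by (rule sum.swap)
  finally show ?thesis
    by (simp add: trace_def transpose_def matrix_matrix_mult_def)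
qed

lemma norm_matrix_eq_sqrt_trace:
  fixes A :: "real^'n^'n"
  shows "norm A = sqrt (trace (transpose A ** A))"
  by (simp add: norm_eq_sqrt_inner inner_matrix_eq_trace)

text \<open>
  Replacing row \<open>i\<close> and column \<open>j\<close> by unit vectors meeting in a \<open>1\<close> yields the signed
  \<open>(i, j)\<close> minor as a determinant.
\<close>

definition cof :: "real^'n^'n \<Rightarrow> real^'n^'n" where
  "cof A = (\<chi> i j. det (\<chi> k l. if k = i \<and> l = j then 1
                                 else if k = i \<or> l = j then 0 else A $ k $ l))"

lemma cof_3:
  fixes A :: "real^3^3"
  shows "cof A = vector
    [vector [A$2$2 * A$3$3 - A$2$3 * A$3$2, A$2$3 * A$3$1 - A$2$1 * A$3$3, A$2$1 * A$3$2 - A$2$2 * A$3$1],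
     vector [A$1$3 * A$3$2 - A$1$2 * A$3$3, A$1$1 * A$3$3 - A$1$3 * A$3$1, A$1$2 * A$3$1 - A$1$1 * A$3$2],
     vector [A$1$2 * A$2$3 - A$1$3 * A$2$2, A$1$3 * A$2$1 - A$1$1 * A$2$3, A$1$1 * A$2$2 - A$1$2 * A$2$1]]"
  by (simp add: vec_eq_iff forall_3 cof_def det_3 vector_3)

primrec Ck :: "nat \<Rightarrow> ('a::euclidean_space \<Rightarrow> 'b::real_normed_vector) \<Rightarrow> bool" where
  "Ck 0 = (\<lambda>f. continuous_on UNIV f)"
| "Ck (Suc k) = (\<lambda>f. (\<forall>x. f differentiable (at x)) \<and>
                     (\<forall>v. Ck k (\<lambda>x. frechet_derivative f (at x) v)))"

definition smooth :: "('a::euclidean_space \<Rightarrow> 'b::real_normed_vector) \<Rightarrow> bool" where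
  "smooth f \<longleftrightarrow> (\<forall>k. Ck k f)"

text \<open>
  Near each boundary point, after an orthogonal change of coordinates \<open>T\<close>, the set is the
  part above the graph of a Lipschitz function of the first two coordinates.
\<close>

definition lipschitz_boundary :: "(real^3) set \<Rightarrow> bool" where
  "lipschitz_boundary \<Omega> \<longleftrightarrow>
    (\<forall>x0 \<in> frontier \<Omega>. \<exists>r>0. \<exists>T :: real^3 \<Rightarrow> real^3. \<exists>g :: real^2 \<Rightarrow> real. \<exists>L.
       orthogonal_transformation T \<and> L-lipschitz_on UNIV g \<and>
       \<Omega> \<inter> ball x0 r = {x \<in> ball x0 r. T x $ 3 > g (vector [T x $ 1, T x $ 2])})"

definition bounded_lipschitz_domain :: "(real^3) set \<Rightarrow> bool" where
  "bounded_lipschitz_domain \<Omega> \<longleftrightarrow>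
    open \<Omega> \<and> connected \<Omega> \<and> \<Omega> \<noteq> {} \<and> bounded \<Omega> \<and> lipschitz_boundary \<Omega>"

text \<open>
  Hausdorff measure, normalised to agree with Lebesgue measure in integer dimensions. The
  boundedness condition is needed because \<^const>\<open>diameter\<close> is unspecified on unbounded sets.
\<close>

definition hausdorff_pre :: "real \<Rightarrow> real \<Rightarrow> 'a::metric_space set \<Rightarrow> ennreal" where
  "hausdorff_pre s \<delta> A =
    (INF C \<in> {C :: nat \<Rightarrow> 'a set. A \<subseteq> (\<Union>j. C j) \<and> (\<forall>j. bounded (C j) \<and> diameter (C j) \<le> \<delta>)}.
       \<Sum>j. ennreal (unit_ball_vol s * (diameter (C j) / 2) powr s))"

definition hausdorff_outer :: "real \<Rightarrow> 'a::metric_space set \<Rightarrow> ennreal" where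
  "hausdorff_outer s A = (SUP \<delta> \<in> {0<..}. hausdorff_pre s \<delta> A)"

definition hausdorff_measure :: "real \<Rightarrow> 'a::metric_space measure" where
  "hausdorff_measure s = measure_of UNIV (sets borel) (hausdorff_outer s)"

definition Lq :: "real \<Rightarrow> (real^3) set \<Rightarrow> (real^3 \<Rightarrow> 'b::euclidean_space) set" where
  "Lq q \<Omega> = {f \<in> borel_measurable (lebesgue_on \<Omega>).
              integrable (lebesgue_on \<Omega>) (\<lambda>x. norm (f x) powr q)}"

definition locally_integrable :: "(real^3) set \<Rightarrow> (real^3 \<Rightarrow> 'b::euclidean_space) \<Rightarrow> bool" where
  "locally_integrable \<Omega> f \<longleftrightarrow> (\<forall>K. compact K \<and> K \<subseteq> \<Omega> \<longrightarrow> integrable (lebesgue_on K) f)"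

definition test_functions :: "(real^3) set \<Rightarrow> (real^3 \<Rightarrow> real) set" where
  "test_functions \<Omega> =
    {\<phi>. smooth \<phi> \<and> compact (closure {x. \<phi> x \<noteq> 0}) \<and> closure {x. \<phi> x \<noteq> 0} \<subseteq> \<Omega>}"

text \<open>\<open>G x $ i $ j\<close> is the weak derivative of the \<open>i\<close>-th component in direction \<open>j\<close>.\<close>

definition has_weak_gradient ::
  "(real^3) set \<Rightarrow> (real^3 \<Rightarrow> real^3) \<Rightarrow> (real^3 \<Rightarrow> real^3^3) \<Rightarrow> bool" where
  "has_weak_gradient \<Omega> u G \<longleftrightarrow>
    locally_integrable \<Omega> u \<and> locally_integrable \<Omega> G \<and>
    (\<forall>\<phi> \<in> test_functions \<Omega>. \<forall>i j.
       (LINT x|lebesgue_on \<Omega>. u x $ i * frechet_derivative \<phi> (at x) (axis j 1)) =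
       - (LINT x|lebesgue_on \<Omega>. G x $ i $ j * \<phi> x))"

text \<open>The weak gradient is unique only up to null sets; a representative is chosen.\<close>

definition weak_gradient :: "(real^3) set \<Rightarrow> (real^3 \<Rightarrow> real^3) \<Rightarrow> real^3 \<Rightarrow> real^3^3" where
  "weak_gradient \<Omega> u = (SOME G. has_weak_gradient \<Omega> u G)"

definition W1q :: "real \<Rightarrow> (real^3) set \<Rightarrow> (real^3 \<Rightarrow> real^3) set" where
  "W1q q \<Omega> = {u. u \<in> Lq q \<Omega> \<and> (\<exists>G. has_weak_gradient \<Omega> u G) \<and> weak_gradient \<Omega> u \<in> Lq q \<Omega>}"

text \<open>
  The trace operator on \<open>W\<^sup>1\<^sup>,\<^sup>q\<close> is the continuous extension of restriction to the boundary from
  functions smooth up to the boundary: \<open>g\<close> is the trace of \<open>u\<close> iff some smooth \<open>v\<^sub>k\<close> converge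
  to \<open>u\<close> in \<open>W\<^sup>1\<^sup>,\<^sup>q\<close> while their boundary values converge to \<open>g\<close> in \<open>L\<^sup>q\<close> of the boundary
  with respect to surface measure.
\<close>

definition has_trace ::
  "real \<Rightarrow> (real^3) set \<Rightarrow> (real^3 \<Rightarrow> real^3) \<Rightarrow> (real^3 \<Rightarrow> real^3) \<Rightarrow> bool" where
  "has_trace q \<Omega> u g \<longleftrightarrow>
    (\<exists>v :: nat \<Rightarrow> real^3 \<Rightarrow> real^3.
       (\<forall>k. smooth (v k)) \<and>
       (\<lambda>k. \<integral>\<^sup>+x. ennreal (norm (v k x - u x) powr q) \<partial>lebesgue_on \<Omega>) \<longlonglongrightarrow> 0 \<and>
       (\<lambda>k. \<integral>\<^sup>+x. ennreal (norm (matrix (frechet_derivative (v k) (at x)) - weak_gradient \<Omega> u x) powr q)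
               \<partial>lebesgue_on \<Omega>) \<longlonglongrightarrow> 0 \<and>
       (\<lambda>k. \<integral>\<^sup>+x\<in>frontier \<Omega>. ennreal (norm (v k x - g x) powr q) \<partial>hausdorff_measure 2) \<longlonglongrightarrow> 0)"

definition admissible :: "real \<Rightarrow> (real^3) set \<Rightarrow> real \<Rightarrow> (real^3 \<Rightarrow> real^3) set" where
  "admissible q \<Omega> lam =
    {u \<in> W1q q \<Omega>. has_trace q \<Omega> u (\<lambda>x. lam *\<^sub>R x) \<and>
                    (AE x in lebesgue_on \<Omega>. det (weak_gradient \<Omega> u x) > 0)}"

definition stored_energy ::
  "real \<Rightarrow> real \<Rightarrow> (real^3^3 \<Rightarrow> real) \<Rightarrow> (real \<Rightarrow> ennreal) \<Rightarrow> real^3^3 \<Rightarrow> ennreal" where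
  "stored_energy q \<gamma> Z h A =
    ennreal (norm A powr q + \<gamma> * (norm A)\<^sup>2 + Z (cof A)) + h (det A)"

definition energy :: "(real^3) set \<Rightarrow> (real^3^3 \<Rightarrow> ennreal) \<Rightarrow> (real^3 \<Rightarrow> real^3) \<Rightarrow> ennreal" where
  "energy \<Omega> W u = (\<integral>\<^sup>+x. W (weak_gradient \<Omega> u x) \<partial>lebesgue_on \<Omega>)"

end

theory Submission
  imports Defs
begin

text \<open>
  Write \<open>A = lam I\<close> and \<open>\<Phi> = \<nabla>u - A\<close>. Convexity of \<open>|\<cdot>|^q\<close>, \<open>Z\<close> and \<open>h\<close> bounds \<open>W (\<nabla>u) - W A\<close> from below
  by an expression linear in \<open>\<Phi>\<close> and in the \<open>2 \<times> 2\<close> minors of \<open>\<Phi>\<close>, plus \<open>\<gamma> |\<Phi>|^2 + h' det \<Phi>\<close>. The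
  last term is nonnegative: if \<open>det \<Phi> < 0 < det (A + \<Phi>)\<close>, then \<open>det (s I + \<Phi>)\<close> vanishes for some
  \<open>0 \<le> s \<le> lam\<close>, so \<open>|\<Phi> x| \<le> lam\<close> for a unit vector \<open>x\<close>, and Hadamard's inequality gives
  \<open>|det \<Phi>| \<le> (lam / 2) |\<Phi>|^2\<close>.

  The entries and minors of \<open>\<Phi>\<close> have integral zero. With \<open>w\<^sub>k\<close> smooth, \<open>w\<^sub>k \<rightarrow> u - lam x\<close> in \<open>W\<^sup>1\<^sup>,\<^sup>q\<close>
  and \<open>w\<^sub>k \<rightarrow> 0\<close> on the boundary, the integrals of \<open>\<partial>\<^sub>j (w\<^sub>k g)\<close> tend to \<open>0\<close> for every smooth \<open>g\<close>;
  for the minors take \<open>g = \<partial>\<^sub>l w\<^sub>m\<close>, let \<open>k \<rightarrow> \<infinity>\<close> and then \<open>m \<rightarrow> \<infinity>\<close>.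

  The divergence theorem is replaced by a one-sided estimate of \<open>\<partial>\<^sub>d f\<close> integrated over \<open>\<Omega>\<close>. For \<open>f\<close>
  supported near a boundary point and \<open>d\<close> pointing into \<open>\<Omega>\<close>, the difference quotient of \<open>f\<close> along \<open>d\<close>
  integrates to \<open>-1/t\<close> times the integral of \<open>f\<close> over the layer of points of \<open>\<Omega>\<close> that leave \<open>\<Omega>\<close> when
  moved by \<open>-t d\<close>. This layer lies in a tube over the boundary, and tubes over a set \<open>E\<close> have volume at
  most a constant times \<open>t\<close> times the Hausdorff measure of \<open>E\<close>, by covering them with balls. Inward
  directions span the space, and a partition of unity localises.
\<close>

section \<open>Hausdorff measure on Borel sets\<close>


text \<open>The determinant cannot be treated like the smaller minors: for \<open>q < 3\<close> it
  need not be integrable, and even an integrable determinant need not have an integral fixed by the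
  boundary values (cavitation). It is therefore estimated pointwise, and the exact quadratic
  remainder of \<open>\<gamma> |A|^2\<close> pays for it. Entries and 2 x 2 minors have degree at
  most 2, which is below \<open>q\<close>, so they survive the passage to the limit. For the minors
  two indices are needed: a single sequence would put \<open>w_k \<partial> w_k\<close> on the
  boundary, where only \<open>w_k\<close> is controlled. With \<open>m\<close> fixed, the second
  factor is smooth and bounded there. Because the boundary values tend to zero, an upper bound for
  the flux suffices, without normals or an area formula. The bound must not contain derivatives of
  \<open>f\<close>: its Lipschitz constant enters only multiplied by the displacement
  \<open>t\<close> and disappears as \<open>t\<close> tends to 0. Truncation at a small level
  replaces Hoelder's inequality on the boundary, so no finiteness of surface measure has to be
  shown. The measure theory comes first because \<open>measure_of\<close> yields the zero measure
  unless the given set function is a measure.\<close>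

lemma metric_outer_measure_closed_lambda_system:
  fixes \<mu> :: "'a::metric_space set \<Rightarrow> ennreal"
  assumes oms: "outer_measure_space (Pow UNIV) \<mu>"
    and sep: "\<And>A B e. e > 0 \<Longrightarrow> (\<forall>x\<in>A. \<forall>y\<in>B. e \<le> dist x y) \<Longrightarrow> \<mu> A + \<mu> B \<le> \<mu> (A \<union> B)"
    and F: "closed F"
  shows "F \<in> lambda_system UNIV (Pow UNIV) \<mu>"
proof -
  have mono: "\<mu> A \<le> \<mu> B" if "A \<subseteq> B" for A B
    using oms that by (auto simp: outer_measure_space_def increasing_def)
  have emp: "\<mu> {} = 0"
    using oms by (auto simp: outer_measure_space_def positive_def)
  have csub: "countably_subadditive (Pow UNIV) \<mu>"
    using oms by (auto simp: outer_measure_space_def)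
  have sub2: "\<mu> (A \<union> B) \<le> \<mu> A + \<mu> B" for A B
  proof -
    have "subadditive (Pow UNIV) \<mu>"
      using oms by (intro ring_of_sets.countably_subadditive_subadditive[OF ring_of_sets_Pow])
        (auto simp: outer_measure_space_def)
    moreover have "A \<union> B = A \<union> (B - A)" by auto
    ultimately have "\<mu> (A \<union> B) \<le> \<mu> A + \<mu> (B - A)"
      unfolding subadditive_def by (metis Diff_disjoint Pow_UNIV UNIV_I)
    also have "\<dots> \<le> \<mu> A + \<mu> B" by (intro add_left_mono mono) auto
    finally show ?thesis .
  qed
  have subU: "\<mu> (\<Union>i. A i) \<le> (\<Sum>i. \<mu> (A i))" for A :: "nat \<Rightarrow> 'a set"
  proof -
    have "\<mu> (\<Union>i. A i) = \<mu> (\<Union>i. disjointed A i)" by (simp add: UN_disjointed_eq)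
    also have "\<dots> \<le> (\<Sum>i. \<mu> (disjointed A i))"
      using csub disjoint_family_disjointed[of A] by (auto simp: countably_subadditive_def)
    also have "\<dots> \<le> (\<Sum>i. \<mu> (A i))"
      by (intro suminf_le mono disjointed_subset) auto
    finally show ?thesis .
  qed
  have main: "\<mu> (X \<inter> F) + \<mu> (X - F) \<le> \<mu> X" for X
  \<comment> \<open>\<open>infdist\<close> to the empty set is 0 by convention, so the shells below
    would not cover \<open>X\<close>. Finiteness of \<open>\<mu> X\<close> is what lets the tails of
    the shell sums vanish.\<close>
  proof (cases "F = {} \<or> \<mu> X = \<infinity>")
    case True
    then show ?thesis using emp by (auto simp: top_greatest)
  next
    case False
    then have Fne: "F \<noteq> {}" and fin: "\<mu> X < \<infinity>" by (auto simp: less_top)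
    define D where "D x = infdist x F" for x
    have Dlip: "D x - D y \<le> dist x y" for x y
      using infdist_triangle[of x F y] by (simp add: D_def)
    have D0: "D y = 0" if "y \<in> F" for y using that by (simp add: D_def)
    define S where "S n = {x\<in>X - F. 1/(real n+2) \<le> D x \<and> D x < 1/(real n+1)}" for n
    define A where "A n = {x\<in>X - F. 1/(real n+1) \<le> D x}" for n

    \<comment> \<open>Shells of equal parity are pairwise separated, hence the masses of all shells have a finite sum.\<close>
    have half: "(\<Sum>j<k. \<mu> (S (2*j+p))) \<le> \<mu> (\<Union>j<k. S (2*j+p))" for k p
    proof (induction k)
      case 0 then show ?case by (simp add: emp)
    next
      case (Suc k)
      have "(\<Sum>j<Suc k. \<mu> (S (2*j+p))) \<le> \<mu> (\<Union>j<k. S (2*j+p)) + \<mu> (S (2*k+p))"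
        using Suc by (simp add: add_right_mono)
      also have "\<dots> \<le> \<mu> ((\<Union>j<k. S (2*j+p)) \<union> S (2*k+p))"
      proof (cases "k = 0")
        case True then show ?thesis by (simp add: emp)
      next
        case False
        \<comment> \<open>For \<open>j < k\<close> the shell \<open>S (2*j+p)\<close> lies where
          \<open>D\<close> is at least \<open>1/(2*k+p)\<close>, and \<open>S (2*k+p)\<close> lies
          where \<open>D\<close> is below \<open>1/(2*k+p+1)\<close>. The skipped shell of the other
          parity provides this gap. For \<open>k = 0\<close> the first bound could be a division by
          zero, hence the case split.\<close>
        have "1/(real(2*k+p)) - 1/(real (2*k+p)+1) > 0" using False by (simp add: divide_strict_left_mono)
        moreover have "1/(real(2*k+p)) - 1/(real (2*k+p)+1) \<le> dist x y"
          if "x \<in> (\<Union>j<k. S (2*j+p))" "y \<in> S (2*k+p)" for x y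
        proof -
          obtain j where j: "j<k" "x \<in> S (2*j+p)" using \<open>x \<in> _\<close> by auto
          have "1/(real(2*k+p)) \<le> 1/(real (2*j+p) + 2)"
            using j(1) by (intro divide_left_mono) auto
          then have "1/(real(2*k+p)) \<le> D x" using j(2) by (simp add: S_def)
          moreover have "D y < 1/(real (2*k+p)+1)" using \<open>y \<in> _\<close> by (simp add: S_def)
          ultimately show ?thesis using Dlip[of x y] by linarith
        qed
        ultimately show ?thesis by (intro sep) auto
      qed
      also have "(\<Union>j<k. S (2*j+p)) \<union> S (2*k+p) = (\<Union>j<Suc k. S (2*j+p))"
        by (auto simp: less_Suc_eq)
      finally show ?case .
    qed
    have halfX: "(\<Sum>j<k. \<mu> (S (2*j+p))) \<le> \<mu> X" for k p
      by (rule order_trans[OF half mono]) (auto simp: S_def)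
    have "(\<Sum>j<n. \<mu> (S j)) \<le> \<mu> X + \<mu> X" for n
    proof -
      have "(\<Sum>j<n. \<mu> (S j)) \<le> (\<Sum>j<2*n. \<mu> (S j))" by (intro sum_mono2) auto
      also have "\<dots> = (\<Sum>j<n. \<mu> (S (2*j+0))) + (\<Sum>j<n. \<mu> (S (2*j+1)))"
        by (induction n) (auto simp: algebra_simps)
      also have "\<dots> \<le> \<mu> X + \<mu> X" by (intro add_mono halfX)
      finally show ?thesis .
    qed
    then have "(\<Sum>j. \<mu> (S j)) \<le> \<mu> X + \<mu> X"
      by (intro suminf_le_const) auto
    then have sfin: "(\<Sum>j. \<mu> (S j)) < \<infinity>" using fin
      by (metis ennreal_add_less_top infinity_ennreal_def order_le_less_trans)
    define T where "T n = (\<Sum>j. \<mu> (S (j+n)))" for n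
    have T_lim: "T \<longlonglongrightarrow> 0"
    proof -
      have *: "(\<Sum>j. \<mu> (S j)) = T n + (\<Sum>j<n. \<mu> (S j))" for n
        unfolding T_def by (rule suminf_offset) auto
      have fs: "(\<Sum>j<n. \<mu> (S j)) \<noteq> \<infinity>" for n
        using order_le_less_trans[OF sum_le_suminf sfin, of "{..<n}"] by (auto simp: less_top)
      have "T = (\<lambda>n. (\<Sum>j. \<mu> (S j)) - (\<Sum>j<n. \<mu> (S j)))"
      proof
        fix n
        show "T n = (\<Sum>j. \<mu> (S j)) - (\<Sum>j<n. \<mu> (S j))"
          unfolding *[of n] using fs[of n] by (subst ennreal_add_diff_cancel_right) auto
      qed
      moreover have "(\<lambda>n. (\<Sum>j. \<mu> (S j)) - (\<Sum>j<n. \<mu> (S j))) \<longlonglongrightarrow> (\<Sum>j. \<mu> (S j)) - (\<Sum>j. \<mu> (S j))"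
        using sfin by (intro tendsto_diff_ennreal tendsto_const summable_LIMSEQ summableI) auto
      moreover have "(\<Sum>j. \<mu> (S j)) - (\<Sum>j. \<mu> (S j)) = 0" by (intro diff_eq_0_ennreal) (use sfin in auto)
      ultimately show ?thesis by metis
    qed
    have cover: "X - F \<subseteq> A n \<union> (\<Union>j. S (j+n))" for n
    proof
      fix x assume x: "x \<in> X - F"
      then have "D x > 0" using F Fne
        by (metis D_def DiffD2 in_closed_iff_infdist_zero infdist_nonneg order_le_less)
      show "x \<in> A n \<union> (\<Union>j. S (j+n))"
      proof (cases "1/(real n+1) \<le> D x")
        case False
        define P where "P m \<longleftrightarrow> 1/(real m+1) \<le> D x" for m
        obtain m where "inverse (of_nat (Suc m)) < D x" using reals_Archimedean[OF \<open>D x > 0\<close>] by blast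
        then have "P m" by (auto simp: P_def field_simps)
        define k where "k = (LEAST m. P m)"
        have "P k" unfolding k_def by (rule LeastI) fact
        have nk: "n < k"
        proof (rule ccontr)
          assume "\<not> n < k"
          then have "1/(real n+1) \<le> 1/(real k+1)" by (intro divide_left_mono) auto
          then show False using \<open>P k\<close> False by (simp add: P_def)
        qed
        then obtain l where l: "k = Suc l" by (cases k) auto
        have "\<not> P l" using not_less_Least[of l P] l k_def by auto
        then have "x \<in> S l" using \<open>P k\<close> x by (auto simp: S_def P_def l add.commute)
        then show ?thesis using nk l by (intro UnI2 UN_I[of "l-n"]) auto
      qed (use x in \<open>auto simp: A_def\<close>)
    qed
    have "\<mu> (X \<inter> F) + \<mu> (X - F) \<le> \<mu> X + T n" for n
    proof -
      have "\<mu> (X - F) \<le> \<mu> (A n \<union> (\<Union>j. S (j+n)))" by (rule mono[OF cover])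
      also have "\<dots> \<le> \<mu> (A n) + T n"
        unfolding T_def by (rule order_trans[OF sub2]) (intro add_left_mono subU)
      finally have "\<mu> (X \<inter> F) + \<mu> (X - F) \<le> (\<mu> (X \<inter> F) + \<mu> (A n)) + T n"
        by (simp add: add.assoc add_left_mono)
      also have "\<mu> (X \<inter> F) + \<mu> (A n) \<le> \<mu> (X \<inter> F \<union> A n)"
      proof (rule sep)
        show "1/(real n+1) > 0" by simp
        show "\<forall>x\<in>X \<inter> F. \<forall>y\<in>A n. 1 / (real n + 1) \<le> dist x y"
        proof (intro ballI)
          fix x y assume "x \<in> X \<inter> F" "y \<in> A n"
          then show "1 / (real n + 1) \<le> dist x y"
            using Dlip[of y x] D0[of x] by (auto simp: A_def dist_commute)
        qed
      qed
      also have "\<dots> \<le> \<mu> X" by (rule mono) (auto simp: A_def)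
      finally show ?thesis by (simp add: add_right_mono)
    qed
    moreover have "(\<lambda>n. \<mu> X + T n) \<longlonglongrightarrow> \<mu> X + 0" by (intro tendsto_add tendsto_const T_lim)
    ultimately show ?thesis using LIMSEQ_le_const by fastforce
  qed
  have "\<mu> (X \<inter> F) + \<mu> (X - F) = \<mu> X" for X
  proof (rule antisym[OF main])
    have "X = (X \<inter> F) \<union> (X - F)" by auto
    then show "\<mu> X \<le> \<mu> (X \<inter> F) + \<mu> (X - F)" using sub2[of "X \<inter> F" "X - F"] by simp
  qed
  then show ?thesis
    by (simp add: lambda_system_def Int_commute Diff_eq)
qed

text \<open>Caratheodory's construction makes \<open>\<mu>\<close> a measure on its lambda system.
  That is a sigma-algebra containing the closed sets, hence all Borel sets.\<close>

lemma metric_outer_measure_borel: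
  fixes \<mu> :: "'a::metric_space set \<Rightarrow> ennreal"
  assumes oms: "outer_measure_space (Pow UNIV) \<mu>"
    and sep: "\<And>A B e. e > 0 \<Longrightarrow> (\<forall>x\<in>A. \<forall>y\<in>B. e \<le> dist x y) \<Longrightarrow> \<mu> A + \<mu> B \<le> \<mu> (A \<union> B)"
  shows "measure_space UNIV (sets borel) \<mu>"
proof -
  let ?L = "lambda_system UNIV (Pow UNIV) \<mu>"
  have ms: "measure_space UNIV ?L \<mu>"
    using sigma_algebra.caratheodory_lemma[OF sigma_algebra_Pow oms] .
  then have sa: "sigma_algebra UNIV ?L" by (simp add: measure_space_def)
  have "sets (borel :: 'a measure) = sigma_sets UNIV (Collect closed)"
    by (simp add: borel_eq_closed)
  also have "\<dots> \<subseteq> ?L"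
    using metric_outer_measure_closed_lambda_system[OF assms]
    by (intro sigma_algebra.sigma_sets_subset[OF sa]) auto
  finally show ?thesis
    using measure_down[OF ms] sets.sigma_algebra_axioms[of "borel :: 'a measure"] by simp
qed

section \<open>The Hausdorff outer measure is a metric outer measure\<close>

abbreviation hausdorff_cost :: "real \<Rightarrow> 'a::metric_space set \<Rightarrow> ennreal" where
  "hausdorff_cost s C \<equiv> ennreal (unit_ball_vol s * (diameter C / 2) powr s)"

lemma hausdorff_cost_mono:
  assumes "s \<ge> 0" "A \<subseteq> B" "bounded B"
  shows "hausdorff_cost s A \<le> hausdorff_cost s B"
proof -
  have "(diameter A / 2) powr s \<le> (diameter B / 2) powr s"
    using assms diameter_subset[OF assms(2,3)] diameter_ge_0[OF bounded_subset[OF assms(3,2)]]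
    by (intro powr_mono2) auto
  then show ?thesis using assms by (intro ennreal_leI mult_left_mono unit_ball_vol_nonneg)
qed

lemma hausdorff_pre_le:
  assumes "A \<subseteq> (\<Union>j. C j)" "\<And>j. bounded (C j)" "\<And>j. diameter (C j) \<le> \<delta>"
  shows "hausdorff_pre s \<delta> A \<le> (\<Sum>j. hausdorff_cost s (C j))"
  unfolding hausdorff_pre_def using assms by (intro INF_lower) auto

lemma hausdorff_pre_mono: "A \<subseteq> B \<Longrightarrow> hausdorff_pre s \<delta> A \<le> hausdorff_pre s \<delta> B"
  unfolding hausdorff_pre_def by (intro INF_superset_mono) auto

lemma hausdorff_pre_antimono: "\<delta> \<le> \<delta>' \<Longrightarrow> hausdorff_pre s \<delta>' A \<le> hausdorff_pre s \<delta> A"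
  unfolding hausdorff_pre_def by (intro INF_superset_mono) (auto intro: order_trans)

lemma hausdorff_pre_empty: "\<delta> \<ge> 0 \<Longrightarrow> hausdorff_pre s \<delta> {} = 0"
  using hausdorff_pre_le[of "{}" "\<lambda>_. {}" \<delta> s] by simp

text \<open>Covers of the \<open>A i\<close> that are optimal up to \<open>e / 2^(i+1)\<close> are
  merged into a single sequence by \<open>prod_decode\<close>; the errors add up to
  \<open>e\<close>.\<close>

lemma hausdorff_pre_countably_subadditive:
  fixes A :: "nat \<Rightarrow> 'a::metric_space set"
  shows "hausdorff_pre s \<delta> (\<Union>i. A i) \<le> (\<Sum>i. hausdorff_pre s \<delta> (A i))"
proof (cases "(\<Sum>i. hausdorff_pre s \<delta> (A i)) = \<infinity>")
  case False
  have fin: "hausdorff_pre s \<delta> (A i) < \<infinity>" for i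
  proof -
    have "hausdorff_pre s \<delta> (A i) = (\<Sum>j\<in>{i}. hausdorff_pre s \<delta> (A j))" by simp
    also have "\<dots> \<le> (\<Sum>i. hausdorff_pre s \<delta> (A i))" by (intro sum_le_suminf) auto
    finally show ?thesis using False by (simp add: less_top order_le_less_trans)
  qed
  show ?thesis
  proof (rule ennreal_le_epsilon)
    fix e :: real assume e: "e > 0"
    have "\<exists>C. A i \<subseteq> (\<Union>j. C j) \<and> (\<forall>j. bounded (C j) \<and> diameter (C j) \<le> \<delta>) \<and>
        (\<Sum>j. hausdorff_cost s (C j)) \<le> hausdorff_pre s \<delta> (A i) + ennreal (e * (1/2)^Suc i)" for i
    proof -
      have "hausdorff_pre s \<delta> (A i) < hausdorff_pre s \<delta> (A i) + ennreal (e * (1/2)^Suc i)"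
        using fin[of i] e
        by (cases "hausdorff_pre s \<delta> (A i)") (auto simp: ennreal_plus[symmetric] simp del: ennreal_plus intro!: ennreal_lessI add_nonneg_pos)
      then show ?thesis
        by (subst (asm) (1) hausdorff_pre_def) (auto simp: INF_less_iff intro: less_imp_le)
    qed
    then obtain C where C: "\<And>i. A i \<subseteq> (\<Union>j. C i j)" "\<And>i j. bounded (C i j)"
      "\<And>i j. diameter (C i j) \<le> \<delta>"
      "\<And>i. (\<Sum>j. hausdorff_cost s (C i j)) \<le> hausdorff_pre s \<delta> (A i) + ennreal (e * (1/2)^Suc i)"
      by metis
    define K where "K n = (case prod_decode n of (i,j) \<Rightarrow> C i j)" for n
    have "(\<Union>i. A i) \<subseteq> (\<Union>n. K n)"
    proof safe
      fix x i assume "x \<in> A i"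
      then obtain j where "x \<in> C i j" using C(1) by blast
      then have "x \<in> K (prod_encode (i,j))" by (simp add: K_def)
      then show "x \<in> (\<Union>n. K n)" by blast
    qed
    then have "hausdorff_pre s \<delta> (\<Union>i. A i) \<le> (\<Sum>n. hausdorff_cost s (K n))"
      using C by (intro hausdorff_pre_le) (auto simp: K_def split: prod.split)
    also have "\<dots> = (\<Sum>i. \<Sum>j. hausdorff_cost s (C i j))"
    proof -
      have eq: "(\<lambda>n. hausdorff_cost s (K n)) = (\<lambda>(i,j). hausdorff_cost s (C i j)) \<circ> prod_decode"
        by (auto simp: K_def split: prod.split)
      show ?thesis unfolding eq comp_def by (rule suminf_ennreal_2dimen) simp
    qed
    also have "\<dots> \<le> (\<Sum>i. hausdorff_pre s \<delta> (A i) + ennreal (e * (1/2)^Suc i))"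
      by (rule suminf_le[OF C(4)]) auto
    also have "\<dots> = (\<Sum>i. hausdorff_pre s \<delta> (A i)) + (\<Sum>i. ennreal (e * (1/2)^Suc i))"
      by (intro suminf_add[symmetric]) auto
    also have "(\<Sum>i. ennreal (e * (1/2)^Suc i)) = ennreal e"
      using e sums_mult[OF power_half_series, of e] by (intro suminf_ennreal_eq) auto
    finally show "hausdorff_pre s \<delta> (\<Union>i. A i) \<le> (\<Sum>i. hausdorff_pre s \<delta> (A i)) + ennreal e" .
  qed
qed simp

lemma hausdorff_pre_le_outer: "\<delta> > 0 \<Longrightarrow> hausdorff_pre s \<delta> A \<le> hausdorff_outer s A"
  unfolding hausdorff_outer_def by (intro SUP_upper) auto

lemma outer_measure_space_hausdorff_outer:
  "outer_measure_space (Pow UNIV) (hausdorff_outer s :: 'a::metric_space set \<Rightarrow> ennreal)"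
  unfolding outer_measure_space_def
proof (intro conjI)
  show "positive (Pow UNIV) (hausdorff_outer s :: 'a set \<Rightarrow> ennreal)"
    by (auto simp: positive_def hausdorff_outer_def hausdorff_pre_empty)
  show "increasing (Pow UNIV) (hausdorff_outer s :: 'a set \<Rightarrow> ennreal)"
    by (auto simp: increasing_def hausdorff_outer_def intro!: SUP_mono' hausdorff_pre_mono)
  show "countably_subadditive (Pow UNIV) (hausdorff_outer s :: 'a set \<Rightarrow> ennreal)"
    unfolding countably_subadditive_def
  proof safe
    fix A :: "nat \<Rightarrow> 'a set"
    show "hausdorff_outer s (\<Union>i. A i) \<le> (\<Sum>i. hausdorff_outer s (A i))"
      unfolding hausdorff_outer_def[of s "\<Union>i. A i"]
      by (intro SUP_least order_trans[OF hausdorff_pre_countably_subadditive] suminf_le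
          hausdorff_pre_le_outer) auto
  qed
qed

text \<open>Once the covering sets have diameter below \<open>e\<close>, none of them meets both
  \<open>A\<close> and \<open>B\<close>. Every cover of the union then splits into a cover of
  \<open>A\<close> and a cover of \<open>B\<close> at no extra cost, since the empty set costs
  0.\<close>

lemma hausdorff_outer_separated:
  fixes A B :: "'a::metric_space set"
  assumes s: "s > 0" and e: "e > 0" and sep: "\<forall>x\<in>A. \<forall>y\<in>B. e \<le> dist x y"
  shows "hausdorff_outer s A + hausdorff_outer s B \<le> hausdorff_outer s (A \<union> B)"
proof -
  have pre: "hausdorff_pre s \<delta> A + hausdorff_pre s \<delta> B \<le> hausdorff_pre s \<delta> (A \<union> B)"
    if \<delta>: "\<delta> < e" for \<delta>
    unfolding hausdorff_pre_def[of s \<delta> "A \<union> B"]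
  proof (rule INF_greatest, clarify)
    fix C :: "nat \<Rightarrow> 'a set"
    assume cov: "A \<union> B \<subseteq> (\<Union>j. C j)" and C: "\<forall>j. bounded (C j) \<and> diameter (C j) \<le> \<delta>"
    have bd: "bounded (C j \<inter> X)" "diameter (C j \<inter> X) \<le> \<delta>" for j X
      using C by (meson Int_lower1 bounded_subset diameter_subset order_trans)+
    have "hausdorff_pre s \<delta> A + hausdorff_pre s \<delta> B
        \<le> (\<Sum>j. hausdorff_cost s (C j \<inter> A)) + (\<Sum>j. hausdorff_cost s (C j \<inter> B))"
      using cov bd by (intro add_mono hausdorff_pre_le) auto
    also have "\<dots> = (\<Sum>j. hausdorff_cost s (C j \<inter> A) + hausdorff_cost s (C j \<inter> B))"
      by (intro suminf_add) auto
    also have "\<dots> \<le> (\<Sum>j. hausdorff_cost s (C j))"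
    proof (intro suminf_le)
      fix j
      have "C j \<inter> A = {} \<or> C j \<inter> B = {}"
      proof (rule ccontr)
        assume "\<not> ?thesis"
        then obtain x y where "x \<in> C j" "x \<in> A" "y \<in> C j" "y \<in> B" by auto
        then have "e \<le> dist x y" "dist x y \<le> diameter (C j)" "diameter (C j) \<le> \<delta>"
          using diameter_bounded_bound[of "C j" x y] C sep by auto
        then show False using \<delta> by linarith
      qed
      then show "hausdorff_cost s (C j \<inter> A) + hausdorff_cost s (C j \<inter> B) \<le> hausdorff_cost s (C j)"
        using hausdorff_cost_mono[of s _ "C j"] C s by auto
    qed auto
    finally show "hausdorff_pre s \<delta> A + hausdorff_pre s \<delta> B \<le> (\<Sum>j. hausdorff_cost s (C j))" .
  qed
  \<comment> \<open>The two suprema run over independent scales; both are reduced to one scale below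
    \<open>e\<close> by antimonotonicity.\<close>
  have *: "hausdorff_pre s \<delta>1 A + hausdorff_pre s \<delta>2 B \<le> hausdorff_outer s (A \<union> B)"
    if "\<delta>1 > 0" "\<delta>2 > 0" for \<delta>1 \<delta>2
  proof -
    define \<delta> where "\<delta> = min (min \<delta>1 \<delta>2) (e/2)"
    have \<delta>: "\<delta> > 0" "\<delta> \<le> \<delta>1" "\<delta> \<le> \<delta>2" "\<delta> < e" using that e by (auto simp: \<delta>_def)
    have "hausdorff_pre s \<delta>1 A + hausdorff_pre s \<delta>2 B \<le> hausdorff_pre s \<delta> A + hausdorff_pre s \<delta> B"
      using \<delta> by (intro add_mono hausdorff_pre_antimono)
    also have "\<dots> \<le> hausdorff_outer s (A \<union> B)"
      using pre[OF \<delta>(4)] hausdorff_pre_le_outer[OF \<delta>(1)] order_trans by blast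
    finally show ?thesis .
  qed
  have ne: "{0::real<..} \<noteq> {}" by auto
  show ?thesis
    unfolding hausdorff_outer_def[of s A] hausdorff_outer_def[of s B]
    unfolding ennreal_SUP_add_left[OF ne, symmetric] ennreal_SUP_add_right[OF ne]
    by (intro SUP_least) (use * in auto)
qed

lemma sets_hausdorff_measure [simp, measurable_cong]: "sets (hausdorff_measure s) = sets borel"
  unfolding hausdorff_measure_def using sets.sigma_algebra_axioms[of borel]
  by (subst sigma_algebra.sets_measure_of_eq) auto

text \<open>This is where the additivity pays off: \<open>measure_of\<close> keeps the values of
  \<open>hausdorff_outer\<close> only because that function is a measure on the Borel sets.\<close>

lemma emeasure_hausdorff_measure:
  assumes "s > 0" "E \<in> sets borel"
  shows "emeasure (hausdorff_measure s) E = hausdorff_outer s E"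
proof -
  have ms: "measure_space UNIV (sets borel) (hausdorff_outer s :: 'a set \<Rightarrow> ennreal)"
    using assms by (intro metric_outer_measure_borel outer_measure_space_hausdorff_outer
        hausdorff_outer_separated)
  show ?thesis
    unfolding hausdorff_measure_def
    using ms assms by (intro emeasure_measure_of_sigma) (auto simp: measure_space_def)
qed


section \<open>Volume of tubes\<close>

definition tube :: "'a::real_normed_vector \<Rightarrow> real \<Rightarrow> 'a set \<Rightarrow> 'a set" where
  "tube d t E = (\<lambda>(x,s). x + s *\<^sub>R d) ` (E \<times> {0..t})"

lemma tube_mono: "E \<subseteq> F \<Longrightarrow> tube d t E \<subseteq> tube d t F"
  by (auto simp: tube_def)

lemma tubeI: "x \<in> E \<Longrightarrow> 0 \<le> s \<Longrightarrow> s \<le> t \<Longrightarrow> x + s *\<^sub>R d \<in> tube d t E"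
  by (force simp: tube_def)

lemma compact_tube: "compact E \<Longrightarrow> compact (tube d t E)"
  unfolding tube_def
  by (intro compact_continuous_image compact_Times) (auto simp: case_prod_unfold intro!: continuous_intros)

lemma tube_cball_sets [measurable]: "tube d t (cball (z::'a::euclidean_space) r) \<in> sets borel"
  by (intro borel_compact compact_tube) simp

text \<open>The tube is covered by balls of radius \<open>2*D\<close> centred at steps of length
  \<open>D\<close> along the axis. Since \<open>D \<le> t\<close>, at most \<open>2*t/D\<close>
  balls occur, each of volume \<open>8 * unit_ball_vol 3 * D^3\<close>; the product gives the factor
  16.\<close>

lemma emeasure_tube_cball_pos:
  fixes d z :: "real^3"
  assumes d: "norm d \<le> 1" and D: "0 < D" "D \<le> t"
  shows "emeasure lborel (tube d t (cball z D)) \<le> ennreal (16 * unit_ball_vol 3 * t * D\<^sup>2)"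
proof -
  define N where "N = nat \<lfloor>t / D\<rfloor>"
  have "tube d t (cball z D) \<subseteq> (\<Union>i\<in>{..N}. cball (z + (real i * D) *\<^sub>R d) (2*D))"
  proof
    fix y assume "y \<in> tube d t (cball z D)"
    then obtain x s where y: "y = x + s *\<^sub>R d" and x: "x \<in> cball z D" and s: "0 \<le> s" "s \<le> t"
      by (auto simp: tube_def)
    define i where "i = nat \<lfloor>s / D\<rfloor>"
    have i: "real i \<le> s / D" "s / D < real i + 1"
      using s D by (auto simp: i_def)
    then have "real i * D \<le> s" "s < real i * D + D" using D by (auto simp: field_simps)
    then have "norm ((s - real i * D) *\<^sub>R d) \<le> D * 1"
      using d D unfolding norm_scaleR by (intro mult_mono) auto
    moreover have "dist (z + (real i * D) *\<^sub>R d) y = norm ((z - x) - (s - real i * D) *\<^sub>R d)"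
      by (simp add: y dist_norm algebra_simps)
    moreover have "norm (z - x) \<le> D" using x by (simp add: dist_norm)
    ultimately have "dist (z + (real i * D) *\<^sub>R d) y \<le> 2 * D"
      using norm_triangle_ineq4[of "z - x" "(s - real i * D) *\<^sub>R d"] by linarith
    moreover have "i \<le> N" unfolding i_def N_def using s D
      by (intro nat_mono floor_mono divide_right_mono) auto
    ultimately show "y \<in> (\<Union>i\<in>{..N}. cball (z + (real i * D) *\<^sub>R d) (2*D))" by auto
  qed
  then have "emeasure lborel (tube d t (cball z D)) \<le> emeasure lborel (\<Union>i\<in>{..N}. cball (z + (real i * D) *\<^sub>R d) (2*D))"
    by (intro emeasure_mono) auto
  also have "\<dots> \<le> (\<Sum>i\<in>{..N}. emeasure lborel (cball (z + (real i * D) *\<^sub>R d) (2*D)))"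
    by (intro emeasure_subadditive_finite) auto
  also have "\<dots> = (\<Sum>i\<in>{..N}. ennreal (unit_ball_vol 3 * (2*D)^3))"
    using D by (simp add: emeasure_cball)
  also have "\<dots> = ennreal (\<Sum>i\<in>{..N}. unit_ball_vol 3 * (2*D)^3)"
    using D by (intro sum_ennreal) auto
  also have "\<dots> = ennreal ((real N + 1) * (unit_ball_vol 3 * (2*D)^3))" by (simp add: algebra_simps)
  also have "\<dots> \<le> ennreal (16 * unit_ball_vol 3 * t * D\<^sup>2)"
  proof (rule ennreal_leI)
    have "real N \<le> t / D" using D by (simp add: N_def)
    moreover have "1 \<le> t / D" using D by simp
    ultimately have "real N + 1 \<le> 2 * t / D" by simp
    then have "(real N + 1) * (unit_ball_vol 3 * (2*D)^3) \<le> (2 * t / D) * (unit_ball_vol 3 * (2*D)^3)"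
      using D by (intro mult_right_mono) auto
    also have "\<dots> = 16 * unit_ball_vol 3 * t * D\<^sup>2"
      using D by (simp add: field_simps power2_eq_square power3_eq_cube)
    finally show "(real N + 1) * (unit_ball_vol 3 * (2*D)^3) \<le> 16 * unit_ball_vol 3 * t * D\<^sup>2" .
  qed
  finally show ?thesis .
qed

lemma emeasure_tube_cball:
  fixes d z :: "real^3"
  assumes d: "norm d \<le> 1" and t: "0 < t" and D: "0 \<le> D" "D \<le> t"
  shows "emeasure lborel (tube d t (cball z D)) \<le> ennreal (16 * unit_ball_vol 3 * t * D\<^sup>2)"
proof (cases "D = 0")
  case True
  have "eventually (\<lambda>e. emeasure lborel (tube d t (cball z 0)) \<le> ennreal (16 * unit_ball_vol 3 * t * e\<^sup>2)) (at_right 0)"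
    unfolding eventually_at_right_field
  proof (intro exI conjI allI impI)
    show "0 < t" by fact
    fix e assume "0 < e" "e < t"
    then show "emeasure lborel (tube d t (cball z 0)) \<le> ennreal (16 * unit_ball_vol 3 * t * e\<^sup>2)"
      by (intro order_trans[OF emeasure_mono emeasure_tube_cball_pos[OF d, of e t z]] tube_mono subset_cball) auto
  qed
  moreover have "((\<lambda>e. ennreal (16 * unit_ball_vol 3 * t * e\<^sup>2)) \<longlongrightarrow> ennreal (16 * unit_ball_vol 3 * t * 0\<^sup>2)) (at_right 0)"
    by (intro tendsto_ennrealI tendsto_intros)
  ultimately have "emeasure lborel (tube d t (cball z 0)) \<le> ennreal (16 * unit_ball_vol 3 * t * 0\<^sup>2)"
    by (intro tendsto_lowerbound[where F="at_right (0::real)"]) auto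
  then show ?thesis using True by simp
next
  case False
  then show ?thesis using assms by (intro emeasure_tube_cball_pos) auto
qed

text \<open>Covers are taken at scale \<open>t\<close>, so that each covering set lies in a ball of
  radius \<open>D = diameter (C j) \<le> t\<close> and its tube has volume at most
  \<open>16 * (4*pi/3) * t * D^2\<close>. The cost of the set is \<open>pi * D^2 / 4\<close>; the
  quotient of the two is \<open>256/3 * t\<close>.\<close>

lemma emeasure_tube_le_hausdorff:
  fixes d :: "real^3" and E :: "(real^3) set"
  assumes d: "norm d \<le> 1" and t: "0 < t" and E: "compact E"
  shows "emeasure lborel (tube d t E) \<le> ennreal (256 / 3 * t) * emeasure (hausdorff_measure 2) E"
proof -
  define c where "c = ennreal (256 / 3 * t)"
  have c: "c > 0" "c \<noteq> \<infinity>" using t by (auto simp: c_def)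
  have "emeasure lborel (tube d t E) / c \<le> hausdorff_pre 2 t E"
    unfolding hausdorff_pre_def
  proof (rule INF_greatest, clarify)
    fix C :: "nat \<Rightarrow> (real^3) set"
    assume cov: "E \<subseteq> (\<Union>j. C j)" and C: "\<forall>j. bounded (C j) \<and> diameter (C j) \<le> t"
    define z where "z j = (SOME z. z \<in> C j)" for j
    have D0: "diameter (C j) \<ge> 0" for j using C by (simp add: diameter_ge_0)
    have sub: "C j \<subseteq> cball (z j) (diameter (C j))" for j
    proof
      fix x assume x: "x \<in> C j"
      then have "z j \<in> C j" unfolding z_def by (metis someI)
      then show "x \<in> cball (z j) (diameter (C j))"
        using diameter_bounded_bound[of "C j" "z j" x] C x by simp
    qed
    have "tube d t E \<subseteq> (\<Union>j. tube d t (cball (z j) (diameter (C j))))"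
    proof
      fix y assume "y \<in> tube d t E"
      then obtain x s where y: "y = x + s *\<^sub>R d" "x \<in> E" "0 \<le> s" "s \<le> t"
        by (auto simp: tube_def)
      then obtain j where "x \<in> C j" using cov by auto
      then have "y \<in> tube d t (cball (z j) (diameter (C j)))"
        unfolding y(1) using sub y by (intro tubeI) blast+
      then show "y \<in> (\<Union>j. tube d t (cball (z j) (diameter (C j))))" by blast
    qed
    then have "emeasure lborel (tube d t E) \<le> emeasure lborel (\<Union>j. tube d t (cball (z j) (diameter (C j))))"
      by (intro emeasure_mono) auto
    also have "\<dots> \<le> (\<Sum>j. emeasure lborel (tube d t (cball (z j) (diameter (C j)))))"
      by (intro emeasure_subadditive_countably) auto
    also have "\<dots> \<le> (\<Sum>j. c * hausdorff_cost 2 (C j))"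
    proof (intro suminf_le)
      fix j
      have "emeasure lborel (tube d t (cball (z j) (diameter (C j)))) \<le> ennreal (16 * unit_ball_vol 3 * t * (diameter (C j))\<^sup>2)"
        using C D0 d t by (intro emeasure_tube_cball) auto
      also have "\<dots> = c * hausdorff_cost 2 (C j)"
        using D0[of j] t unfolding c_def
        by (subst ennreal_mult[symmetric]) (auto simp: unit_ball_vol_2 unit_ball_vol_3 power2_eq_square)
      finally show "emeasure lborel (tube d t (cball (z j) (diameter (C j)))) \<le> c * hausdorff_cost 2 (C j)" .
    qed auto
    also have "\<dots> = c * (\<Sum>j. hausdorff_cost 2 (C j))" by simp
    finally show "emeasure lborel (tube d t E) / c \<le> (\<Sum>j. hausdorff_cost 2 (C j))"
      using c by (intro divide_le_posI_ennreal) auto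
  qed
  also have "\<dots> \<le> hausdorff_outer 2 E" by (rule hausdorff_pre_le_outer[OF t])
  also have "\<dots> = emeasure (hausdorff_measure 2) E"
    using E by (intro emeasure_hausdorff_measure[symmetric]) (auto intro: borel_compact)
  finally have "c * (emeasure lborel (tube d t E) / c) \<le> c * emeasure (hausdorff_measure 2) E"
    by (rule mult_left_mono) simp
  moreover have "c * (emeasure lborel (tube d t E) / c) = emeasure lborel (tube d t E)"
    unfolding ennreal_times_divide mult.commute[of c] using c by (intro mult_divide_eq_ennreal) auto
  ultimately show ?thesis by (simp add: c_def)
qed


section \<open>Smooth functions\<close>

text \<open>Any known derivative may serve as witness, so the calculus rules apply directly and
  \<open>frechet_derivative\<close> never has to be computed.\<close>

lemma Ck_SucI:
  assumes "\<And>x. (f has_derivative D x) (at x)" "\<And>v. Ck k (\<lambda>x. D x v)"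
  shows "Ck (Suc k) f"
proof -
  have "D x = frechet_derivative f (at x)" for x using frechet_derivative_at[OF assms(1)] .
  then show ?thesis using assms by (auto simp: differentiable_def)
qed

lemma Ck_Suc_has_derivative:
  "Ck (Suc k) f \<Longrightarrow> (f has_derivative frechet_derivative f (at x)) (at x)"
  by (simp add: frechet_derivative_works[symmetric])

lemma Ck_Suc_frechet: "Ck (Suc k) f \<Longrightarrow> Ck k (\<lambda>x. frechet_derivative f (at x) v)"
  by simp

lemma Ck_SucD: "Ck (Suc k) f \<Longrightarrow> Ck k f"
proof (induction k arbitrary: f)
  case 0
  then show ?case
    by (auto simp: continuous_on_eq_continuous_at intro: differentiable_imp_continuous_within)
next
  case (Suc k)
  show ?case
    by (rule Ck_SucI[OF Ck_Suc_has_derivative[OF Suc.prems]]) (rule Suc.IH[OF Ck_Suc_frechet[OF Suc.prems]])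
qed

lemma Ck_const: "Ck k (\<lambda>x. c)"
proof (induction k arbitrary: c)
  case (Suc k)
  show ?case by (rule Ck_SucI[where D="\<lambda>x v. 0"]) (auto simp: Suc)
qed simp

lemma Ck_bounded_linear: "bounded_linear f \<Longrightarrow> Ck k f"
proof (cases k)
  case 0
  then show "bounded_linear f \<Longrightarrow> ?thesis" by (simp add: linear_continuous_on)
next
  case (Suc j)
  assume "bounded_linear f"
  then show ?thesis unfolding Suc
    by (intro Ck_SucI[where D="\<lambda>x. f"] bounded_linear_imp_has_derivative Ck_const)
qed

lemma Ck_bounded_linear_comp:
  assumes L: "bounded_linear L"
  shows "Ck k f \<Longrightarrow> Ck k (\<lambda>x. L (f x))"
proof (induction k arbitrary: f)
  case 0
  then show ?case using bounded_linear.continuous_on[OF L] by simp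
next
  case (Suc k)
  show ?case
    by (rule Ck_SucI[OF bounded_linear.has_derivative[OF L Ck_Suc_has_derivative[OF Suc.prems]]])
      (rule Suc.IH[OF Ck_Suc_frechet[OF Suc.prems]])
qed

lemma Ck_add: "Ck k f \<Longrightarrow> Ck k g \<Longrightarrow> Ck k (\<lambda>x. f x + g x)"
proof (induction k arbitrary: f g)
  case 0
  then show ?case by (auto intro: continuous_intros)
next
  case (Suc k)
  show ?case
    by (rule Ck_SucI[OF has_derivative_add[OF Ck_Suc_has_derivative[OF Suc.prems(1)] Ck_Suc_has_derivative[OF Suc.prems(2)]]])
      (rule Suc.IH[OF Ck_Suc_frechet[OF Suc.prems(1)] Ck_Suc_frechet[OF Suc.prems(2)]])
qed

lemma Ck_mult:
  fixes f g :: "'a::euclidean_space \<Rightarrow> real"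
  shows "Ck k f \<Longrightarrow> Ck k g \<Longrightarrow> Ck k (\<lambda>x. f x * g x)"
proof (induction k arbitrary: f g)
  case 0
  then show ?case by (auto intro: continuous_intros)
next
  case (Suc k)
  show ?case
    by (rule Ck_SucI[OF has_derivative_mult[OF Ck_Suc_has_derivative[OF Suc.prems(1)] Ck_Suc_has_derivative[OF Suc.prems(2)]]])
      (intro Ck_add Suc.IH Ck_Suc_frechet Suc.prems Ck_SucD[OF Suc.prems(1)] Ck_SucD[OF Suc.prems(2)])
qed

lemma Ck_inverse:
  fixes f :: "'a::euclidean_space \<Rightarrow> real"
  assumes nz: "\<And>x. f x \<noteq> 0"
  shows "Ck k f \<Longrightarrow> Ck k (\<lambda>x. inverse (f x))"
proof (induction k)
  case 0
  then show ?case using nz by (auto intro: continuous_intros)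
next
  case (Suc k)
  have i: "Ck k (\<lambda>x. inverse (f x))" by (rule Suc.IH[OF Ck_SucD[OF Suc.prems]])
  show ?case
  proof (rule Ck_SucI[OF Deriv.has_derivative_inverse[OF nz Ck_Suc_has_derivative[OF Suc.prems]]])
    fix v
    have "Ck k (\<lambda>x. - (inverse (f x) * frechet_derivative f (at x) v * inverse (f x)))"
      by (intro Ck_bounded_linear_comp[OF bounded_linear_minus[OF bounded_linear_ident]] Ck_mult i Ck_Suc_frechet[OF Suc.prems])
    then show "Ck k (\<lambda>x. - (inverse (f x) * frechet_derivative f (at x) v * inverse (f x)))" .
  qed
qed

lemma smooth_Ck: "smooth f \<Longrightarrow> Ck k f"
  by (simp add: smooth_def)

lemma smooth_has_derivative:
  "smooth f \<Longrightarrow> (f has_derivative frechet_derivative f (at x)) (at x)"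
  using Ck_Suc_has_derivative smooth_Ck by blast

lemma smooth_frechet: "smooth f \<Longrightarrow> smooth (\<lambda>x. frechet_derivative f (at x) v)"
  unfolding smooth_def using Ck_Suc_frechet by blast

lemma smooth_continuous: "smooth f \<Longrightarrow> continuous_on A f"
  using smooth_Ck[of f 0] continuous_on_subset by auto

lemma smooth_const: "smooth (\<lambda>x. c)"
  and smooth_bounded_linear: "bounded_linear f \<Longrightarrow> smooth f"
  and smooth_bounded_linear_comp: "bounded_linear L \<Longrightarrow> smooth g \<Longrightarrow> smooth (\<lambda>x. L (g x))"
  and smooth_add: "smooth g \<Longrightarrow> smooth h \<Longrightarrow> smooth (\<lambda>x. g x + h x)"
  by (simp_all add: smooth_def Ck_const Ck_bounded_linear Ck_bounded_linear_comp Ck_add)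

lemma smooth_mult: "smooth f \<Longrightarrow> smooth g \<Longrightarrow> smooth (\<lambda>x. f x * g x :: real)"
  and smooth_inverse: "(\<And>x. f x \<noteq> 0) \<Longrightarrow> smooth f \<Longrightarrow> smooth (\<lambda>x. inverse (f x :: real))"
  by (simp_all add: smooth_def Ck_mult Ck_inverse)

lemma smooth_diff: "smooth f \<Longrightarrow> smooth g \<Longrightarrow> smooth (\<lambda>x. f x - g x)"
  using smooth_add[of f "\<lambda>x. - g x"] smooth_bounded_linear_comp[OF bounded_linear_minus[OF bounded_linear_ident], of g]
  by simp

lemma smooth_sum: "(\<And>i. i \<in> I \<Longrightarrow> smooth (f i)) \<Longrightarrow> smooth (\<lambda>x. \<Sum>i\<in>I. f i x)"
  by (induction I rule: infinite_finite_induct) (simp_all add: smooth_const smooth_add)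

lemma smooth_prod: "(\<And>i. i \<in> I \<Longrightarrow> smooth (f i)) \<Longrightarrow> smooth (\<lambda>x. \<Prod>i\<in>I. f i x :: real)"
  by (induction I rule: infinite_finite_induct) (simp_all add: smooth_const smooth_mult)

lemma smooth_component: "smooth (\<lambda>x::real^'n. x $ i)"
  by (rule smooth_bounded_linear[OF bounded_linear_vec_nth])

section \<open>Smooth cutoff functions\<close>

definition bump :: "nat \<Rightarrow> real \<Rightarrow> real" where
  "bump n s = (if s > 0 then inverse s ^ n * exp (- inverse s) else 0)"

lemma bump_tendsto_0: "(bump n \<longlongrightarrow> 0) (at 0)"
proof -
  have "((\<lambda>s. inverse s ^ n / exp (inverse s)) \<longlongrightarrow> (0::real)) (at_right 0)"
    by (rule filterlim_compose[OF tendsto_power_div_exp_0 filterlim_inverse_at_top_right])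
  then have "(bump n \<longlongrightarrow> 0) (at_right 0)"
    by (rule Lim_transform_eventually)
      (auto simp: bump_def exp_minus field_simps eventually_at_right_field intro!: exI[of _ 1])
  moreover have "(bump n \<longlongrightarrow> 0) (at_left 0)"
    by (rule Lim_transform_eventually[OF tendsto_const])
      (auto simp: bump_def eventually_at_left_field intro!: exI[of _ "-1"])
  ultimately show ?thesis by (simp add: filterlim_split_at)
qed

text \<open>The powers of \<open>inverse s\<close> in \<open>bump\<close> exist for the sake of this
  formula: the family is closed under differentiation up to linear combinations, so smoothness
  follows by induction on the order for all \<open>n\<close> at once.\<close>

lemma bump_has_derivative:
  "(bump n has_real_derivative (bump (n+2) s - real n * bump (n+1) s)) (at s)"
proof -
  consider "s > 0" | "s < 0" | "s = 0" by linarith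
  then show ?thesis
  proof cases
    case 1
    have "((\<lambda>s. inverse s ^ n * exp (- inverse s)) has_real_derivative (bump (n+2) s - real n * bump (n+1) s)) (at s)"
    proof -
      have "((\<lambda>s. inverse s ^ n) has_real_derivative real n * (inverse s ^ (n - Suc 0) * - (inverse s)\<^sup>2)) (at s)"
        using 1 by (auto intro!: derivative_eq_intros simp: power2_eq_square)
      \<comment> \<open>For \<open>n = 0\<close> the truncated exponent is harmless because the
        factor \<open>real n\<close> vanishes.\<close>
      moreover have "real n * (inverse s ^ (n - Suc 0) * - (inverse s)\<^sup>2) = - real n * inverse s ^ Suc n"
        by (cases n) (auto simp: power2_eq_square algebra_simps)
      moreover have "((\<lambda>s. exp (- inverse s)) has_real_derivative exp (- inverse s) * (inverse s)\<^sup>2) (at s)"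
        using 1 by (auto intro!: derivative_eq_intros simp: power2_eq_square)
      ultimately show ?thesis using 1
        by (auto intro!: derivative_eq_intros simp: bump_def power2_eq_square algebra_simps)
    qed
    then show ?thesis
      by (rule has_field_derivative_transform_within_open[where S="{0<..}"]) (use 1 in \<open>auto simp: bump_def\<close>)
  next
    case 2
    have "((\<lambda>s. 0) has_real_derivative 0) (at s)" by simp
    then have "(bump n has_real_derivative 0) (at s)"
      by (rule has_field_derivative_transform_within_open[where S="{..<0}"]) (use 2 in \<open>auto simp: bump_def\<close>)
    then show ?thesis using 2 by (simp add: bump_def)
  next
    case 3
    \<comment> \<open>The difference quotient of \<open>bump n\<close> at 0 is
      \<open>bump (Suc n)\<close>.\<close>
    have "((\<lambda>h. (bump n (0 + h) - bump n 0) / h) \<longlongrightarrow> 0) (at 0)"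
      by (rule Lim_transform_eventually[OF bump_tendsto_0[of "Suc n"]])
        (auto simp: bump_def field_simps eventually_at intro!: exI[of _ 1])
    then show ?thesis using 3 by (simp add: DERIV_def bump_def)
  qed
qed

lemma smooth_bump:
  fixes r :: "'a::euclidean_space \<Rightarrow> real"
  assumes r: "smooth r"
  shows "smooth (\<lambda>x. bump n (r x))"
proof -
  have "Ck k (\<lambda>x. bump n (r x))" for k
  proof (induction k arbitrary: n)
    case 0
    have "continuous_on UNIV (bump n)"
      using bump_has_derivative by (meson DERIV_isCont continuous_at_imp_continuous_on)
    then show ?case using continuous_on_compose2[of UNIV "bump n" UNIV r] smooth_continuous[OF r] by simp
  next
    case (Suc k)
    have d: "((\<lambda>x. bump n (r x)) has_derivative
        (\<lambda>v. (bump (n+2) (r x) + (- real n) * bump (n+1) (r x)) * frechet_derivative r (at x) v)) (at x)" for x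
      using has_derivative_compose[OF smooth_has_derivative[OF r] bump_has_derivative[of n "r x", unfolded has_field_derivative_def]]
      by simp
    show ?case
      by (rule Ck_SucI[OF d]) (intro Ck_mult Ck_add Suc Ck_const smooth_Ck[OF smooth_frechet[OF r]])
  qed
  then show ?thesis by (simp add: smooth_def)
qed

lemma bump_nonneg: "bump n s \<ge> 0"
  and bump_pos_iff: "bump n s > 0 \<longleftrightarrow> s > 0"
  and bump_eq_0: "s \<le> 0 \<Longrightarrow> bump n s = 0"
  and bump_0_le_1: "bump 0 s \<le> 1"
  by (auto simp: bump_def)

lemma bump_0_scale_tendsto:
  "(\<lambda>m. bump 0 (real m * s)) \<longlonglongrightarrow> (if s > 0 then 1 else 0)"
proof (cases "s > 0")
  case True
  have "(\<lambda>m. exp (- (inverse (real m) * inverse s))) \<longlonglongrightarrow> exp (- (0 * inverse s))"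
    by (intro tendsto_intros lim_inverse_n)
  then have "(\<lambda>m. exp (- inverse (real m * s))) \<longlonglongrightarrow> 1" by (simp add: mult.commute)
  then have "(\<lambda>m. bump 0 (real m * s)) \<longlonglongrightarrow> 1"
    by (rule Lim_transform_eventually) (use True in \<open>auto simp: bump_def eventually_sequentially intro!: exI[of _ 1]\<close>)
  then show ?thesis using True by simp
next
  case False
  then show ?thesis by (simp add: bump_def zero_less_mult_iff not_less)
qed

text \<open>Two uses shape this definition: with \<open>m = 1\<close> it is a building block for
  partitions of unity, and as \<open>m\<close> grows it converges pointwise to the indicator of the
  open box, so that test functions approximate box integrals.\<close>

definition box_bump :: "nat \<Rightarrow> real^'n \<Rightarrow> real^'n \<Rightarrow> real^'n \<Rightarrow> real" where
  "box_bump m a b x = (\<Prod>i\<in>UNIV. bump 0 (real m * (x $ i - a $ i)) * bump 0 (real m * (b $ i - x $ i)))"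

lemma smooth_box_bump: "smooth (box_bump m a b)"
  unfolding box_bump_def
  by (intro smooth_prod smooth_mult smooth_bump smooth_const smooth_diff smooth_component)

lemma box_bump_nonneg: "box_bump m a b x \<ge> 0"
  by (auto simp: box_bump_def bump_nonneg intro!: prod_nonneg)

lemma box_bump_le_1: "box_bump m a b x \<le> 1"
  unfolding box_bump_def
  by (intro prod_le_1 conjI mult_nonneg_nonneg bump_nonneg mult_le_one bump_0_le_1)

lemma box_bump_pos: "m > 0 \<Longrightarrow> x \<in> box a b \<Longrightarrow> box_bump m a b x > 0"
  unfolding box_bump_def
  by (intro prod_pos ballI mult_pos_pos) (auto simp: bump_pos_iff mem_box_cart)

lemma box_bump_eq_0: "x \<notin> box a b \<Longrightarrow> box_bump m a b x = 0"
  unfolding box_bump_def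
  by (intro prod_zero) (auto simp: mem_box_cart not_less intro!: bump_eq_0 mult_nonneg_nonpos)

lemma box_bump_tendsto: "(\<lambda>m. box_bump m a b x) \<longlonglongrightarrow> indicator (box a b) x"
proof -
  have "(\<lambda>m. box_bump m a b x) \<longlonglongrightarrow>
      (\<Prod>i\<in>UNIV. (if x $ i - a $ i > 0 then 1 else 0) * (if b $ i - x $ i > 0 then 1 else 0))"
    unfolding box_bump_def by (intro tendsto_prod tendsto_mult bump_0_scale_tendsto)
  also have "(\<Prod>i\<in>UNIV. (if x $ i - a $ i > 0 then 1 else 0) * (if b $ i - x $ i > 0 then 1 else (0::real))) = indicator (box a b) x"
    by (auto simp: indicator_def mem_box_cart intro!: prod.neutral prod_zero)
  finally show ?thesis .
qed


section \<open>Flux through the boundary\<close>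

lemma integrable_lborel_compact_support:
  fixes g :: "'a::euclidean_space \<Rightarrow> real"
  assumes g: "continuous_on UNIV g" and supp: "\<And>x. x \<notin> cball x0 r \<Longrightarrow> g x = 0"
  shows "integrable lborel g"
proof -
  have "integrable lborel (\<lambda>x. indicator (cball x0 r) x *\<^sub>R g x)"
    using g by (intro borel_integrable_compact) (auto intro: continuous_on_subset)
  moreover have "(\<lambda>x. indicator (cball x0 r) x *\<^sub>R g x) = g"
    using supp by (auto simp: indicator_def fun_eq_iff)
  ultimately show ?thesis by simp
qed

lemma integral_lborel_translate:
  fixes g :: "'a::euclidean_space \<Rightarrow> real"
  assumes [measurable]: "g \<in> borel_measurable borel"
  shows "(\<integral>x. g (x + c) \<partial>lborel) = (\<integral>x. g x \<partial>lborel)"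
proof -
  have "(\<integral>x. g x \<partial>lborel) = (\<integral>x. g x \<partial>distr lborel borel ((+) c))" by (simp add: lborel_distr_plus)
  also have "\<dots> = (\<integral>x. g (x + c) \<partial>lborel)" by (subst integral_distr) (auto simp: add.commute)
  finally show ?thesis ..
qed

lemma integrable_lborel_translate:
  fixes g :: "'a::euclidean_space \<Rightarrow> real"
  assumes "integrable lborel g"
  shows "integrable lborel (\<lambda>x. g (x + c))"
proof -
  have "integrable (distr lborel borel ((+) c)) g" using assms by (simp add: lborel_distr_plus)
  then show ?thesis by (subst (asm) integrable_distr_eq) (use assms in \<open>auto simp: add.commute\<close>)
qed

text \<open>Captures that \<open>d\<close> points into \<open>S\<close> uniformly on a ball, without
  a normal or a graph. This is all that the flux estimate uses of the geometry.\<close>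

definition transversal :: "'a::real_normed_vector set \<Rightarrow> 'a \<Rightarrow> real \<Rightarrow> 'a \<Rightarrow> bool" where
  "transversal S x0 r d \<longleftrightarrow>
     (\<forall>x t. x \<in> S \<inter> ball x0 r \<longrightarrow> 0 \<le> t \<longrightarrow> x + t *\<^sub>R d \<in> ball x0 r \<longrightarrow> x + t *\<^sub>R d \<in> S)"

definition layer :: "'a::real_normed_vector set \<Rightarrow> 'a \<Rightarrow> 'a set" where
  "layer S d = {x\<in>S. x - d \<notin> S}"

lemma layer_sets [measurable]:
  fixes S :: "'a::euclidean_space set"
  assumes [measurable]: "S \<in> sets borel"
  shows "layer S d \<in> sets borel"
proof -
  have "layer S d = {x\<in>space borel. x \<in> S \<and> x - d \<notin> S}" by (simp add: layer_def)
  also have "\<dots> \<in> sets borel" by measurable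
  finally show ?thesis .
qed

text \<open>Translation invariance moves the shift from \<open>g\<close> to the indicator, which
  becomes that of \<open>S\<close> translated by \<open>t *\<^sub>R d\<close>. On the support of
  \<open>g\<close> transversality puts this translate inside \<open>S\<close>, so the two indicators
  differ exactly on the layer. The margin \<open>\<rho> + t < r\<close> keeps the shifted points in
  the ball where transversality is known.\<close>

lemma integral_difference_eq_layer:
  fixes S :: "'a::euclidean_space set" and g :: "'a \<Rightarrow> real"
  assumes S: "open S" and tr: "transversal S x0 r d" and d: "norm d \<le> 1"
    and t: "0 < t" "\<rho> + t < r" and g: "continuous_on UNIV g"
    and supp: "\<And>x. x \<notin> ball x0 \<rho> \<Longrightarrow> g x = 0"
  shows "(\<integral>x. indicator S x * (g (x + t *\<^sub>R d) - g x) \<partial>lborel) = - (\<integral>x. indicator (layer S (t *\<^sub>R d)) x * g x \<partial>lborel)"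
proof -
  have [measurable]: "S \<in> sets borel" using S by simp
  have [measurable]: "g \<in> borel_measurable borel" by (rule borel_measurable_continuous_onI[OF g])
  have gi: "integrable lborel g"
    using g supp by (intro integrable_lborel_compact_support[of g x0 \<rho>]) auto
  have gi': "integrable lborel (\<lambda>x. indicator A x * g x)" if "A \<in> sets borel" for A
    using integrable_mult_indicator[OF _ gi, of A] that by simp
  have gt: "integrable lborel (\<lambda>x. indicator S x * g (x + t *\<^sub>R d))"
    using integrable_mult_indicator[OF _ integrable_lborel_translate[OF gi], of S] by simp
  have meas: "(\<lambda>x. indicator S (x - t *\<^sub>R d) :: real) \<in> borel_measurable borel" by measurable
  have gs: "integrable lborel (\<lambda>x. indicator S (x - t *\<^sub>R d) * g x)"
    using integrable_lborel_translate[OF gt, of "- (t *\<^sub>R d)"] by simp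
  have "(\<integral>x. indicator S x * (g (x + t *\<^sub>R d) - g x) \<partial>lborel)
      = (\<integral>x. indicator S x * g (x + t *\<^sub>R d) \<partial>lborel) - (\<integral>x. indicator S x * g x \<partial>lborel)"
    by (subst Bochner_Integration.integral_diff[symmetric]) (use gt gi' in \<open>auto simp: algebra_simps\<close>)
  also have "(\<integral>x. indicator S x * g (x + t *\<^sub>R d) \<partial>lborel) = (\<integral>x. indicator S (x - t *\<^sub>R d) * g x \<partial>lborel)"
    using integral_lborel_translate[of "\<lambda>x. indicator S (x - t *\<^sub>R d) * g x" "t *\<^sub>R d"] meas by simp
  also have "\<dots> - (\<integral>x. indicator S x * g x \<partial>lborel) = (\<integral>x. indicator S (x - t *\<^sub>R d) * g x - indicator S x * g x \<partial>lborel)"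
    using gs gi' by (subst Bochner_Integration.integral_diff) auto
  also have "\<dots> = (\<integral>x. - (indicator (layer S (t *\<^sub>R d)) x * g x) \<partial>lborel)"
  proof (rule Bochner_Integration.integral_cong)
    fix x
    have "x \<in> S" if "g x \<noteq> 0" "x - t *\<^sub>R d \<in> S"
    proof -
      have x: "x \<in> ball x0 \<rho>" using supp that by blast
      have "norm (t *\<^sub>R d) \<le> t * 1" unfolding norm_scaleR using t d by (intro mult_mono) auto
      then have "dist x (x - t *\<^sub>R d) \<le> t" by (simp add: dist_norm)
      then have "dist x0 (x - t *\<^sub>R d) \<le> dist x0 x + t"
        using dist_triangle[of x0 "x - t *\<^sub>R d" x] by linarith
      then have "x - t *\<^sub>R d \<in> ball x0 r" "x \<in> ball x0 r"
        using x t by auto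
      then show ?thesis using tr that t unfolding transversal_def
        by (metis IntI diff_add_cancel less_imp_le)
    qed
    then show "indicator S (x - t *\<^sub>R d) * g x - indicator S x * g x = - (indicator (layer S (t *\<^sub>R d)) x * g x)"
      by (auto simp: indicator_def layer_def)
  qed simp
  finally show ?thesis by simp
qed

lemma measure_layer_le:
  fixes S :: "'a::euclidean_space set"
  assumes S: "open S" and tr: "transversal S x0 r d" and d: "norm d \<le> 1" and r: "r > 0"
    and t: "0 < t" "t < r/4"
  shows "emeasure lborel (layer S (t *\<^sub>R d) \<inter> ball x0 (r/2)) \<le> ennreal (4 / r * measure lborel (ball x0 r) * t)"
proof -
  \<comment> \<open>The translation identity applied to a Lipschitz cutoff: its difference quotient is at most \<open>1\<close>.\<close>
  define \<eta> where "\<eta> x = max 0 (3*r/4 - dist x0 x)" for x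
  have [measurable]: "S \<in> sets borel" using S by simp
  have cont: "continuous_on UNIV \<eta>" unfolding \<eta>_def by (intro continuous_intros)
  then have [measurable]: "\<eta> \<in> borel_measurable borel" by (rule borel_measurable_continuous_onI)
  have supp: "\<eta> x = 0" if "x \<notin> ball x0 (3*r/4)" for x using that by (auto simp: \<eta>_def)
  have \<eta>i: "integrable lborel \<eta>"
    using cont supp by (intro integrable_lborel_compact_support[of \<eta> x0 "3*r/4"]) auto
  have li: "integrable lborel (\<lambda>x. indicator (layer S (t *\<^sub>R d)) x * \<eta> x)"
    using integrable_mult_indicator[OF _ \<eta>i, of "layer S (t *\<^sub>R d)"] by simp
  let ?A = "layer S (t *\<^sub>R d) \<inter> ball x0 (r/2)"
  have fin: "emeasure lborel ?A < \<infinity>"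
    by (rule order_le_less_trans[OF emeasure_mono[of _ "ball x0 (r/2)"]]) (auto simp: emeasure_bounded_finite[OF bounded_ball, simplified])
  have dt: "norm (t *\<^sub>R d) \<le> t"
    using d t mult_left_mono[of "norm d" 1 t] by (simp)
  \<comment> \<open>The cutoff is at least \<open>r/4\<close> on the ball of radius
    \<open>r/2\<close>. Its support radius \<open>3*r/4\<close> leaves exactly room for a shift
    \<open>t < r/4\<close> inside radius \<open>r\<close>.\<close>
  have "(r/4) * measure lborel ?A = (\<integral>x. (r/4) * indicator ?A x \<partial>lborel)" by simp
  also have "\<dots> \<le> (\<integral>x. indicator (layer S (t *\<^sub>R d)) x * \<eta> x \<partial>lborel)"
    using fin by (intro integral_mono li integrable_mult_right integrable_real_indicator)
      (auto simp: indicator_def \<eta>_def max_def)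
  also have "\<dots> = - (\<integral>x. indicator S x * (\<eta> (x + t *\<^sub>R d) - \<eta> x) \<partial>lborel)"
    by (subst integral_difference_eq_layer[OF S tr d t(1) _ cont supp, where \<rho>="3*r/4"]) (use t in auto)
  also have "\<dots> = (\<integral>x. indicator S x * (\<eta> x - \<eta> (x + t *\<^sub>R d)) \<partial>lborel)"
    by (subst integral_minus[symmetric]) (simp add: algebra_simps)
  also have "\<dots> \<le> (\<integral>x. t * indicator (ball x0 r) x \<partial>lborel)"
  proof (rule integral_mono)
    have "integrable lborel (\<lambda>x. \<eta> x - \<eta> (x + t *\<^sub>R d))"
      using \<eta>i integrable_lborel_translate[OF \<eta>i] by auto
    then show "integrable lborel (\<lambda>x. indicator S x * (\<eta> x - \<eta> (x + t *\<^sub>R d)))"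
      using integrable_mult_indicator[of S lborel "\<lambda>x. \<eta> x - \<eta> (x + t *\<^sub>R d)"] by simp
    show "integrable lborel (\<lambda>x. t * indicator (ball x0 r) x)"
      by (intro integrable_mult_right integrable_real_indicator) (auto simp: emeasure_bounded_finite[OF bounded_ball, simplified])
    fix x
    have "dist x0 (x + t *\<^sub>R d) \<le> dist x0 x + t"
      using dist_triangle[of x0 "x + t *\<^sub>R d" x] dt by (simp add: dist_norm)
    then have "\<eta> x - \<eta> (x + t *\<^sub>R d) \<le> t" using t by (auto simp: \<eta>_def)
    moreover have "\<eta> x - \<eta> (x + t *\<^sub>R d) \<le> 0" if "x \<notin> ball x0 r"
      using that r by (auto simp: \<eta>_def)
    ultimately show "indicator S x * (\<eta> x - \<eta> (x + t *\<^sub>R d)) \<le> t * indicator (ball x0 r) x"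
      using t by (auto simp: indicator_def)
  qed
  also have "\<dots> = t * measure lborel (ball x0 r)" by simp
  finally have "measure lborel ?A \<le> 4 / r * measure lborel (ball x0 r) * t"
    using r by (simp add: field_simps)
  then show ?thesis using fin by (simp add: emeasure_eq_ennreal_measure less_top ennreal_leI)
qed

lemma layer_crosses_frontier:
  fixes S :: "'a::real_normed_vector set"
  assumes "x \<in> layer S (t *\<^sub>R d)" "t \<ge> 0"
  obtains s where "0 \<le> s" "s \<le> t" "x - s *\<^sub>R d \<in> frontier S"
proof -
  let ?I = "(\<lambda>s. x - s *\<^sub>R d) ` {0..t}"
  have "connected ?I" by (intro connected_continuous_image continuous_intros connected_Icc)
  moreover have "x \<in> ?I \<inter> S" using assms by (auto simp: layer_def intro!: image_eqI[of _ _ 0])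
  moreover have "x - t *\<^sub>R d \<in> ?I - S" using assms by (auto simp: layer_def)
  ultimately have "?I \<inter> frontier S \<noteq> {}" using connected_Int_frontier[of ?I S] by blast
  then show ?thesis using that by auto
qed


text \<open>A discrete layer-cake formula: counting the levels \<open>n * \<epsilon>\<close> below
  \<open>a\<close> recovers \<open>a\<close> up to one step. Finitely many levels suffice because
  the function it is applied to is bounded.\<close>

lemma floor_layer_sum:
  fixes a \<epsilon> :: real
  assumes "\<epsilon> > 0" "0 \<le> a" "a \<le> real N * \<epsilon>"
  shows "a \<le> \<epsilon> + \<epsilon> * real (card {n\<in>{1..N}. real n * \<epsilon> \<le> a})"
    and "\<epsilon> * real (card {n\<in>{1..N}. real n * \<epsilon> \<le> a}) \<le> a"
proof -
  define m where "m = nat \<lfloor>a / \<epsilon>\<rfloor>"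
  have m: "real m \<le> a / \<epsilon>" "a / \<epsilon> < real m + 1" using assms by (auto simp: m_def)
  have "m \<le> N"
  proof -
    have "a / \<epsilon> \<le> real N" using assms by (simp add: field_simps)
    then show ?thesis using m by linarith
  qed
  have "{n\<in>{1..N}. real n * \<epsilon> \<le> a} = {1..m}"
  proof -
    have "real n * \<epsilon> \<le> a \<longleftrightarrow> n \<le> m" for n
    proof -
      have "real n * \<epsilon> \<le> a \<longleftrightarrow> real n \<le> a / \<epsilon>" using assms by (simp add: field_simps)
      also have "\<dots> \<longleftrightarrow> n \<le> m" using m by linarith
      finally show ?thesis .
    qed
    then have "{n\<in>{1..N}. real n * \<epsilon> \<le> a} = {n\<in>{1..N}. n \<le> m}" by simp
    also have "\<dots> = {1..m}" using \<open>m \<le> N\<close> by auto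
    finally show ?thesis .
  qed
  then have c: "card {n\<in>{1..N}. real n * \<epsilon> \<le> a} = m" by simp
  show "a \<le> \<epsilon> + \<epsilon> * real (card {n\<in>{1..N}. real n * \<epsilon> \<le> a})"
    "\<epsilon> * real (card {n\<in>{1..N}. real n * \<epsilon> \<le> a}) \<le> a"
    unfolding c using m assms by (auto simp: field_simps)
qed

lemma card_eq_sum_indicator:
  "finite I \<Longrightarrow> real (card {n\<in>I. x \<in> E n}) = (\<Sum>n\<in>I. indicator (E n) x)"
  by (simp add: indicator_def sum.If_cases Int_def of_bool_def)

lemma sum_ennreal_indicator:
  "c \<ge> 0 \<Longrightarrow> ennreal (\<Sum>n\<in>I. c * indicator (E n) x) = (\<Sum>n\<in>I. ennreal c * indicator (E n) x)"
  by (subst sum_ennreal[symmetric]) (auto simp: ennreal_mult ennreal_indicator)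

text \<open>The \<open>q\<close>-th power of the boundary norm, without the root.\<close>

abbreviation boundary_Lq :: "real \<Rightarrow> (real^3) set \<Rightarrow> (real^3 \<Rightarrow> real) \<Rightarrow> ennreal" where
  "boundary_Lq q \<Omega> f \<equiv> \<integral>\<^sup>+x\<in>frontier \<Omega>. ennreal (\<bar>f x\<bar> powr q) \<partial>hausdorff_measure 2"

text \<open>The part of \<open>|f|\<close> below level \<open>\<epsilon>\<close> and the Lipschitz
  error \<open>K * t\<close> are paid by the volume of the layer, which is of order
  \<open>t\<close>. The levels from \<open>\<epsilon>\<close> upwards are paid by tubes over the
  superlevel sets \<open>E n\<close> on the boundary. Summing their areas gives the boundary term,
  and cutting at \<open>\<epsilon>\<close> allows the power \<open>q\<close> there even if the
  surface measure were infinite.\<close>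

lemma layer_integral_bound:
  fixes f :: "real^3 \<Rightarrow> real"
  assumes S: "open S" and tr: "transversal S x0 r d" and d: "norm d \<le> 1" and r: "r > 0"
    and t: "0 < t" "t < r/4" and f: "continuous_on UNIV f"
    and supp: "\<And>x. x \<notin> ball x0 (r/2) \<Longrightarrow> f x = 0"
    and lip: "\<And>x s. 0 \<le> s \<Longrightarrow> \<bar>f (x + s *\<^sub>R d) - f x\<bar> \<le> K * s" and K: "K \<ge> 0"
    and \<epsilon>: "\<epsilon> > 0" and q: "q \<ge> 1"
  shows "(\<integral>\<^sup>+x. ennreal (indicator (layer S (t *\<^sub>R d)) x * \<bar>f x\<bar>) \<partial>lborel)
    \<le> ennreal ((\<epsilon> + K * t) * (4 / r * measure lborel (ball x0 r) * t))
      + ennreal (256 / 3 * t) * (ennreal (\<epsilon> powr (1 - q)) * boundary_Lq q S f)"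
proof -
  have [measurable]: "S \<in> sets borel" using S by simp
  have [measurable]: "f \<in> borel_measurable borel" by (rule borel_measurable_continuous_onI[OF f])
  have [measurable]: "frontier S \<in> sets borel" by (intro borel_closed frontier_closed)
  obtain M where M: "\<And>x. \<bar>f x\<bar> \<le> M" "M \<ge> 0"
  proof -
    have "compact (f ` cball x0 (r/2))"
      by (intro compact_continuous_image continuous_on_subset[OF f]) auto
    then obtain B where B: "\<forall>y\<in>f ` cball x0 (r/2). norm y \<le> B" using compact_imp_bounded bounded_iff by metis
    have "\<bar>f x\<bar> \<le> max B 0" for x
      using B supp[of x] by (cases "x \<in> cball x0 (r/2)") force+
    then show ?thesis by (intro that[of "max B 0"]) auto
  qed
  define N where "N = nat \<lceil>M / \<epsilon>\<rceil>"
  have N: "M \<le> real N * \<epsilon>"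
  proof -
    have "M / \<epsilon> \<le> real N" unfolding N_def by linarith
    then show ?thesis using \<epsilon> by (simp add: field_simps)
  qed
  define E where "E n = {z\<in>frontier S. real n * \<epsilon> \<le> \<bar>f z\<bar>}" for n :: nat
  \<comment> \<open>Positive levels force \<open>f\<close> to be nonzero, so \<open>E n\<close> lies
    in the support ball; \<open>E 0\<close> would be the whole frontier.\<close>
  have cE: "compact (E n)" if "n \<ge> 1" for n
  proof -
    have "closed {z. real n * \<epsilon> \<le> \<bar>f z\<bar>}"
      by (intro closed_Collect_le continuous_intros f)
    then have "closed (E n)" unfolding E_def
      by (metis Collect_conj_eq Collect_mem_eq closed_Int frontier_closed)
    moreover have "E n \<subseteq> ball x0 (r/2)"
    proof
      fix z assume "z \<in> E n"
      moreover have "real n * \<epsilon> > 0" using that \<epsilon> by simp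
      ultimately have "f z \<noteq> 0" by (auto simp: E_def)
      then show "z \<in> ball x0 (r/2)" using supp by blast
    qed
    ultimately show ?thesis by (meson bounded_ball bounded_subset compact_eq_bounded_closed)
  qed
  have tE [measurable]: "tube d t (E n) \<in> sets borel" if "n \<in> {1..N}" for n
    using that by (intro borel_compact compact_tube cE) auto
  have Eb: "E n \<in> sets borel" if "n \<in> {1..N}" for n
    using that by (intro borel_compact cE) auto
  let ?L = "layer S (t *\<^sub>R d)"
  let ?A = "?L \<inter> ball x0 (r/2)"
  \<comment> \<open>Layer-cake bound: \<open>f\<close> at \<open>x\<close> is compared with \<open>f\<close> at a boundary point below \<open>x\<close>.\<close>
  have ptw: "ennreal (indicator ?L x * \<bar>f x\<bar>)
      \<le> ennreal (\<epsilon> + K * t) * indicator ?A x + (\<Sum>n\<in>{1..N}. ennreal \<epsilon> * indicator (tube d t (E n)) x)" for x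
  proof (cases "x \<in> ?L \<and> f x \<noteq> 0")
    case True
    then have x: "x \<in> ?A" using supp by blast
    obtain s where s: "0 \<le> s" "s \<le> t" and z: "x - s *\<^sub>R d \<in> frontier S"
      using layer_crosses_frontier[of x S t d] True t by auto
    define z where "z = x - s *\<^sub>R d"
    have "\<bar>f x - f z\<bar> \<le> K * s" using lip[OF s(1), of z] by (simp add: z_def)
    also have "\<dots> \<le> K * t" using s K by (intro mult_left_mono) auto
    finally have "\<bar>f x\<bar> \<le> \<bar>f z\<bar> + K * t" by linarith
    also have "\<bar>f z\<bar> \<le> \<epsilon> + \<epsilon> * real (card {n\<in>{1..N}. real n * \<epsilon> \<le> \<bar>f z\<bar>})"
      using M(1)[of z] N \<epsilon> by (intro floor_layer_sum) auto
    also have "{n\<in>{1..N}. real n * \<epsilon> \<le> \<bar>f z\<bar>} = {n\<in>{1..N}. z \<in> E n}"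
      using z by (auto simp: E_def z_def)
    also have "real (card {n\<in>{1..N}. z \<in> E n}) \<le> real (card {n\<in>{1..N}. x \<in> tube d t (E n)})"
    proof (intro of_nat_mono card_mono)
      have "x = z + s *\<^sub>R d" by (simp add: z_def)
      then show "{n\<in>{1..N}. z \<in> E n} \<subseteq> {n\<in>{1..N}. x \<in> tube d t (E n)}"
        using tubeI[of z _ s t d] s by auto
    qed simp
    also have "\<dots> = (\<Sum>n\<in>{1..N}. indicator (tube d t (E n)) x)" by (rule card_eq_sum_indicator) simp
    finally have "\<bar>f x\<bar> \<le> (\<epsilon> + K * t) + (\<Sum>n\<in>{1..N}. \<epsilon> * indicator (tube d t (E n)) x)"
      using \<epsilon> by (simp add: sum_distrib_left)
    then have "ennreal \<bar>f x\<bar> \<le> ennreal ((\<epsilon> + K * t) + (\<Sum>n\<in>{1..N}. \<epsilon> * indicator (tube d t (E n)) x))"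
      by (rule ennreal_leI)
    also have "\<dots> = ennreal (\<epsilon> + K * t) + ennreal (\<Sum>n\<in>{1..N}. \<epsilon> * indicator (tube d t (E n)) x)"
      using \<epsilon> K t by (intro ennreal_plus sum_nonneg) auto
    also have "ennreal (\<Sum>n\<in>{1..N}. \<epsilon> * indicator (tube d t (E n)) x) = (\<Sum>n\<in>{1..N}. ennreal \<epsilon> * indicator (tube d t (E n)) x)"
      using \<epsilon> by (intro sum_ennreal_indicator) simp
    finally show ?thesis using x True by simp
  next
    case False
    then show ?thesis by (auto simp: indicator_def)
  qed
  have "(\<integral>\<^sup>+x. ennreal (indicator ?L x * \<bar>f x\<bar>) \<partial>lborel)
      \<le> (\<integral>\<^sup>+x. ennreal (\<epsilon> + K * t) * indicator ?A x + (\<Sum>n\<in>{1..N}. ennreal \<epsilon> * indicator (tube d t (E n)) x) \<partial>lborel)"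
    by (intro nn_integral_mono ptw)
  also have "\<dots> = ennreal (\<epsilon> + K * t) * emeasure lborel ?A + (\<Sum>n\<in>{1..N}. ennreal \<epsilon> * emeasure lborel (tube d t (E n)))"
  proof -
    have A: "?A \<in> sets lborel" by simp
    have m: "(\<lambda>x. ennreal \<epsilon> * indicator (tube d t (E n)) x) \<in> borel_measurable lborel" if "n \<in> {1..N}" for n
      using tE[OF that] by (intro borel_measurable_times_ennreal borel_measurable_const borel_measurable_indicator) simp
    have i: "(\<integral>\<^sup>+x. ennreal \<epsilon> * indicator (tube d t (E n)) x \<partial>lborel) = ennreal \<epsilon> * emeasure lborel (tube d t (E n))"
      if "n \<in> {1..N}" for n using tE[OF that] by (intro nn_integral_cmult_indicator) simp
    have s: "(\<integral>\<^sup>+x. (\<Sum>n\<in>{1..N}. ennreal \<epsilon> * indicator (tube d t (E n)) x) \<partial>lborel)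
        = (\<Sum>n\<in>{1..N}. ennreal \<epsilon> * emeasure lborel (tube d t (E n)))"
      by (subst nn_integral_sum[OF m]) (use i in \<open>auto simp only: intro!: sum.cong\<close>)
    have a: "(\<lambda>x. ennreal (\<epsilon> + K * t) * indicator ?A x) \<in> borel_measurable lborel"
      using A by (intro borel_measurable_times_ennreal borel_measurable_const borel_measurable_indicator)
    show ?thesis
      by (subst nn_integral_add[OF a borel_measurable_sum[OF m]])
        (simp_all only: s nn_integral_cmult_indicator[OF A])
  qed
  also have "\<dots> \<le> ennreal (\<epsilon> + K * t) * ennreal (4 / r * measure lborel (ball x0 r) * t)
      + (\<Sum>n\<in>{1..N}. ennreal \<epsilon> * (ennreal (256 / 3 * t) * emeasure (hausdorff_measure 2) (E n)))"
    using d t cE by (intro add_mono mult_left_mono sum_mono measure_layer_le[OF S tr d r]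
        emeasure_tube_le_hausdorff) auto
  also have "ennreal (\<epsilon> + K * t) * ennreal (4 / r * measure lborel (ball x0 r) * t) = ennreal ((\<epsilon> + K * t) * (4 / r * measure lborel (ball x0 r) * t))"
    using \<epsilon> K t r by (intro ennreal_mult[symmetric]) auto
  also have "(\<Sum>n\<in>{1..N}. ennreal \<epsilon> * (ennreal (256 / 3 * t) * emeasure (hausdorff_measure 2) (E n)))
      = ennreal (256 / 3 * t) * (\<Sum>n\<in>{1..N}. ennreal \<epsilon> * emeasure (hausdorff_measure 2) (E n))"
    unfolding sum_distrib_left by (intro sum.cong refl) (simp only: ac_simps)
  also have "(\<Sum>n\<in>{1..N}. ennreal \<epsilon> * emeasure (hausdorff_measure 2) (E n))
      = (\<integral>\<^sup>+z. (\<Sum>n\<in>{1..N}. ennreal \<epsilon> * indicator (E n) z) \<partial>hausdorff_measure 2)"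
  proof -
    have m: "(\<lambda>x. ennreal \<epsilon> * indicator (E n) x) \<in> borel_measurable (hausdorff_measure 2)" if "n \<in> {1..N}" for n
      using Eb[OF that] by (intro borel_measurable_times_ennreal borel_measurable_const borel_measurable_indicator) simp
    have i: "(\<integral>\<^sup>+x. ennreal \<epsilon> * indicator (E n) x \<partial>hausdorff_measure 2) = ennreal \<epsilon> * emeasure (hausdorff_measure 2) (E n)"
      if "n \<in> {1..N}" for n using Eb[OF that] by (intro nn_integral_cmult_indicator) simp
    show ?thesis
      by (subst nn_integral_sum[OF m]) (use i in \<open>auto simp only: intro!: sum.cong\<close>)
  qed
  also have "\<dots> \<le> (\<integral>\<^sup>+z. ennreal (\<epsilon> powr (1 - q)) * (ennreal (\<bar>f z\<bar> powr q) * indicator (frontier S) z) \<partial>hausdorff_measure 2)"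
  proof (intro nn_integral_mono)
    fix z
    show "(\<Sum>n\<in>{1..N}. ennreal \<epsilon> * indicator (E n) z) \<le> ennreal (\<epsilon> powr (1 - q)) * (ennreal (\<bar>f z\<bar> powr q) * indicator (frontier S) z)"
    proof (cases "z \<in> frontier S")
      case False
      then show ?thesis by (simp add: E_def)
    next
      case True
      have "(\<Sum>n\<in>{1..N}. ennreal \<epsilon> * indicator (E n) z) = ennreal (\<Sum>n\<in>{1..N}. \<epsilon> * indicator (E n) z)"
        using \<epsilon> by (intro sum_ennreal_indicator[symmetric]) simp
      also have "\<dots> \<le> ennreal (\<epsilon> powr (1 - q) * \<bar>f z\<bar> powr q)"
      proof (rule ennreal_leI)
        have eq: "(\<Sum>n\<in>{1..N}. \<epsilon> * indicator (E n) z) = \<epsilon> * real (card {n\<in>{1..N}. real n * \<epsilon> \<le> \<bar>f z\<bar>})"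
          using True card_eq_sum_indicator[of "{1..N}" z E] by (simp add: E_def sum_distrib_left)
        \<comment> \<open>If \<open>|f z|\<close> is at least \<open>\<epsilon>\<close>, the
          quotient \<open>|f z| / \<epsilon>\<close> is at least 1 and can be raised to the power
          \<open>q\<close>. Otherwise no level with \<open>n \<ge> 1\<close> is reached and the left
          side is 0.\<close>
        show "(\<Sum>n\<in>{1..N}. \<epsilon> * indicator (E n) z) \<le> \<epsilon> powr (1 - q) * \<bar>f z\<bar> powr q"
        proof (cases "\<epsilon> \<le> \<bar>f z\<bar>")
          case True
          have "\<epsilon> * real (card {n\<in>{1..N}. real n * \<epsilon> \<le> \<bar>f z\<bar>}) \<le> \<bar>f z\<bar>"
            using M(1)[of z] N \<epsilon> by (intro floor_layer_sum) auto
          also have "\<bar>f z\<bar> = \<epsilon> * (\<bar>f z\<bar> / \<epsilon>) powr 1" using \<epsilon> by simp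
          also have "\<dots> \<le> \<epsilon> * (\<bar>f z\<bar> / \<epsilon>) powr q"
            using True \<epsilon> q by (intro mult_left_mono powr_mono) auto
          also have "\<dots> = \<epsilon> powr (1 - q) * \<bar>f z\<bar> powr q"
            using \<epsilon> by (simp add: powr_divide powr_diff)
          finally show ?thesis unfolding eq .
        next
          case False
          have "{n\<in>{1..N}. real n * \<epsilon> \<le> \<bar>f z\<bar>} = {}"
          proof -
            have "\<epsilon> \<le> real n * \<epsilon>" if "n \<ge> 1" for n :: nat using that \<epsilon> by simp
            then show ?thesis using False by force
          qed
          then have "card {n\<in>{1..N}. real n * \<epsilon> \<le> \<bar>f z\<bar>} = 0" by (simp only: card.empty)
          then show ?thesis unfolding eq by (simp only:) simp
        qed
      qed
      finally show ?thesis using True by (simp add: ennreal_mult)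
    qed
  qed
  also have "\<dots> = ennreal (\<epsilon> powr (1 - q)) * boundary_Lq q S f"
    by (intro nn_integral_cmult) measurable
  finally show ?thesis by (simp add: add_left_mono mult_left_mono)
qed


section \<open>Flux of a smooth function along one inward direction\<close>

lemma smooth_has_real_derivative_line:
  fixes f :: "'a::euclidean_space \<Rightarrow> real"
  assumes "smooth f"
  shows "((\<lambda>s. f (x + s *\<^sub>R d)) has_real_derivative frechet_derivative f (at (x + s *\<^sub>R d)) d) (at s)"
proof -
  have lin: "linear (frechet_derivative f (at y))" for y
    using has_derivative_linear[OF smooth_has_derivative[OF assms]] .
  have "((\<lambda>s. x + s *\<^sub>R d) has_derivative (\<lambda>h. h *\<^sub>R d)) (at s)"
    by (auto intro!: derivative_eq_intros)
  then have "((\<lambda>s. f (x + s *\<^sub>R d)) has_derivative (\<lambda>h. frechet_derivative f (at (x + s *\<^sub>R d)) (h *\<^sub>R d))) (at s)"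
    using has_derivative_compose[OF _ smooth_has_derivative[OF assms]] by blast
  then show ?thesis unfolding has_field_derivative_def
    by (simp add: linear_cmul[OF lin] mult.commute[of _ "frechet_derivative f (at (x + s *\<^sub>R d)) d"] fun_eq_iff)
qed

lemma frechet_eq_0_off_support:
  fixes f :: "'a::euclidean_space \<Rightarrow> real"
  assumes "closed K" "\<And>x. x \<notin> K \<Longrightarrow> f x = 0" "x \<notin> K"
  shows "frechet_derivative f (at x) = (\<lambda>v. 0)"
proof -
  have "((\<lambda>x. 0) has_derivative (\<lambda>v. 0)) (at x)" by simp
  then have "(f has_derivative (\<lambda>v. 0)) (at x)"
    by (rule has_derivative_transform_within_open[where s="- K"]) (use assms in auto)
  then show ?thesis by (rule frechet_derivative_at[symmetric])
qed

lemma smooth_directional_bound: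
  fixes f :: "'a::euclidean_space \<Rightarrow> real"
  assumes f: "smooth f" and supp: "\<And>x. x \<notin> cball x0 r \<Longrightarrow> f x = 0"
  obtains K where "K \<ge> 0" "\<And>x. \<bar>frechet_derivative f (at x) d\<bar> \<le> K"
    "\<And>x s. 0 \<le> s \<Longrightarrow> \<bar>f (x + s *\<^sub>R d) - f x\<bar> \<le> K * s"
proof -
  let ?g = "\<lambda>x. frechet_derivative f (at x) d"
  have "compact (?g ` cball x0 r)"
    by (intro compact_continuous_image smooth_continuous smooth_frechet f) auto
  then obtain B where B: "\<forall>y\<in>?g ` cball x0 r. norm y \<le> B" using compact_imp_bounded bounded_iff by metis
  define K where "K = max B 0"
  have bd: "\<bar>?g x\<bar> \<le> K" for x
  proof (cases "x \<in> cball x0 r")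
    case True then show ?thesis using B by (force simp: K_def)
  next
    case False
    then have "?g x = 0" using frechet_eq_0_off_support[of "cball x0 r" f x] supp by auto
    then show ?thesis by (simp add: K_def)
  qed
  have "\<bar>f (x + s *\<^sub>R d) - f x\<bar> \<le> K * s" if "0 \<le> s" for x s
  proof (cases "s = 0")
    case False
    then have "\<exists>\<xi>. 0 < \<xi> \<and> \<xi> < s \<and> f (x + s *\<^sub>R d) - f (x + 0 *\<^sub>R d) = (s - 0) * ?g (x + \<xi> *\<^sub>R d)"
      using that by (intro MVT2 smooth_has_real_derivative_line[OF f]) auto
    then obtain \<xi> where "f (x + s *\<^sub>R d) - f x = s * ?g (x + \<xi> *\<^sub>R d)" by auto
    then show ?thesis using bd[of "x + \<xi> *\<^sub>R d"] that
      by (simp add: abs_mult mult.commute[of K] mult_left_mono)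
  qed simp
  then show ?thesis using that[of K] bd by (auto simp: K_def)
qed

text \<open>After division by \<open>t\<close> the Lipschitz error of the layer bound is of order
  \<open>K * t\<close>, and it vanishes as the difference quotients converge to the derivative. The
  result involves \<open>f\<close> only through its boundary values. This is decisive for sequences
  whose gradients converge merely in an integral norm.\<close>

lemma local_flux_bound:
  fixes f :: "real^3 \<Rightarrow> real"
  assumes S: "open S" and tr: "transversal S x0 r d" and d: "norm d \<le> 1" and r: "r > 0"
    and f: "smooth f" and supp: "\<And>x. x \<notin> ball x0 (r/2) \<Longrightarrow> f x = 0"
    and \<epsilon>: "\<epsilon> > 0" and q: "q \<ge> 1"
  shows "ennreal \<bar>\<integral>x. indicator S x * frechet_derivative f (at x) d \<partial>lborel\<bar>
    \<le> ennreal (\<epsilon> * (4 / r * measure lborel (ball x0 r)))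
      + ennreal (256 / 3) * (ennreal (\<epsilon> powr (1 - q)) * boundary_Lq q S f)"
proof -
  have Sb [measurable]: "S \<in> sets borel" using S by simp
  have fc: "continuous_on UNIV f" by (rule smooth_continuous[OF f])
  have fm [measurable]: "f \<in> borel_measurable borel" by (rule borel_measurable_continuous_onI[OF fc])
  have supp': "f x = 0" if "x \<notin> cball x0 (r/2)" for x using supp that by auto
  obtain K where K: "K \<ge> 0" "\<And>x. \<bar>frechet_derivative f (at x) d\<bar> \<le> K"
      "\<And>x s. 0 \<le> s \<Longrightarrow> \<bar>f (x + s *\<^sub>R d) - f x\<bar> \<le> K * s"
    using smooth_directional_bound[OF f supp'] by metis
  define V where "V = 4 / r * measure lborel (ball x0 r)"
  have V: "V \<ge> 0" using r by (simp add: V_def)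
  define J where "J = ennreal (\<epsilon> powr (1 - q)) * boundary_Lq q S f"
  define A where "A t = (\<integral>x. indicator S x * ((f (x + t *\<^sub>R d) - f x) / t) \<partial>lborel)" for t
  have bound: "ennreal \<bar>A t\<bar> \<le> ennreal ((\<epsilon> + K * t) * V) + ennreal (256 / 3) * J" if t: "0 < t" "t < r/4" for t
  proof -
    let ?L = "layer S (t *\<^sub>R d)"
    have Lb: "?L \<in> sets borel" by (rule layer_sets[OF Sb])
    have "A t = (\<integral>x. indicator S x * (f (x + t *\<^sub>R d) - f x) \<partial>lborel) / t"
      unfolding A_def by (subst integral_divide_zero[symmetric]) simp
    also have "\<dots> = - (\<integral>x. indicator ?L x * f x \<partial>lborel) / t"
      by (subst integral_difference_eq_layer[OF S tr d t(1) _ fc supp, where \<rho>="r/2"]) (use t r in auto)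
    finally have At: "\<bar>A t\<bar> * t = \<bar>\<integral>x. indicator ?L x * f x \<partial>lborel\<bar>" using t by (simp add: abs_mult)
    have li: "integrable lborel (\<lambda>x. indicator ?L x * f x)"
      using integrable_mult_indicator[OF _ integrable_lborel_compact_support[of f x0 "r/2"], of ?L] fc supp' Lb by auto
    have "ennreal (\<bar>A t\<bar> * t) \<le> ennreal (\<integral>x. \<bar>indicator ?L x * f x\<bar> \<partial>lborel)"
      unfolding At by (intro ennreal_leI integral_abs_bound)
    also have "\<dots> = (\<integral>\<^sup>+x. ennreal \<bar>indicator ?L x * f x\<bar> \<partial>lborel)"
      using li by (intro nn_integral_eq_integral[symmetric]) auto
    also have "\<dots> = (\<integral>\<^sup>+x. ennreal (indicator ?L x * \<bar>f x\<bar>) \<partial>lborel)" by (simp add: abs_mult)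
    also have "\<dots> \<le> ennreal ((\<epsilon> + K * t) * (4 / r * measure lborel (ball x0 r) * t)) + ennreal (256 / 3 * t) * J"
      unfolding J_def by (rule layer_integral_bound[OF S tr d r t fc supp K(3) K(1) \<epsilon> q])
    also have "\<dots> = ennreal t * (ennreal ((\<epsilon> + K * t) * V) + ennreal (256 / 3) * J)"
    proof -
      have "(\<epsilon> + K * t) * (4 / r * measure lborel (ball x0 r) * t) = t * ((\<epsilon> + K * t) * V)"
        by (simp add: V_def)
      moreover have "ennreal (256 / 3 * t) = ennreal t * ennreal (256 / 3)"
        using t by (subst ennreal_mult[symmetric]) (auto simp: mult.commute)
      moreover have "ennreal (t * ((\<epsilon> + K * t) * V)) = ennreal t * ennreal ((\<epsilon> + K * t) * V)"
        using t \<epsilon> K V by (intro ennreal_mult) auto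
      ultimately show ?thesis by (simp only: distrib_left mult.assoc)
    qed
    also have "ennreal (\<bar>A t\<bar> * t) = ennreal t * ennreal \<bar>A t\<bar>"
      using t by (subst mult.commute, intro ennreal_mult) auto
    finally have "ennreal t * ennreal \<bar>A t\<bar> \<le> ennreal t * (ennreal ((\<epsilon> + K * t) * V) + ennreal (256 / 3) * J)" .
    then show ?thesis using t by (simp add: ennreal_mult_le_mult_iff)
  qed
  define \<tau> where "\<tau> k = r / (8 * real (Suc k))" for k :: nat
  have \<tau>: "0 < \<tau> k" "\<tau> k < r/4" for k
  proof -
    show "0 < \<tau> k" using r by (simp add: \<tau>_def)
    have "\<tau> k \<le> r / 8" unfolding \<tau>_def using r by (intro divide_left_mono) auto
    then show "\<tau> k < r/4" using r by linarith
  qed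
  have \<tau>0: "\<tau> \<longlonglongrightarrow> 0" unfolding \<tau>_def
    using tendsto_mult_left[OF LIMSEQ_inverse_real_of_nat, of "r/8"] by (simp add: field_simps)
  have "(\<lambda>k. A (\<tau> k)) \<longlonglongrightarrow> (\<integral>x. indicator S x * frechet_derivative f (at x) d \<partial>lborel)"
    unfolding A_def
  proof (rule integral_dominated_convergence)
    have "smooth (\<lambda>x. frechet_derivative f (at x) d)" by (rule smooth_frechet[OF f])
    then have "(\<lambda>x. frechet_derivative f (at x) d) \<in> borel_measurable borel"
      by (intro borel_measurable_continuous_onI smooth_continuous)
    then show "(\<lambda>x. indicator S x * frechet_derivative f (at x) d) \<in> borel_measurable lborel"
      by (intro borel_measurable_times borel_measurable_indicator) auto
    show "(\<lambda>x. indicator S x * ((f (x + \<tau> k *\<^sub>R d) - f x) / \<tau> k)) \<in> borel_measurable lborel" for k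
      by measurable
    show "integrable lborel (\<lambda>x. K * indicator (ball x0 r) x)"
      by (intro integrable_mult_right integrable_real_indicator) (auto simp: emeasure_bounded_finite[OF bounded_ball, simplified])
    show "AE x in lborel. (\<lambda>k. indicator S x * ((f (x + \<tau> k *\<^sub>R d) - f x) / \<tau> k)) \<longlonglongrightarrow> indicator S x * frechet_derivative f (at x) d"
    proof (intro AE_I2 tendsto_mult tendsto_const)
      fix x
      have "((\<lambda>h. (f (x + h *\<^sub>R d) - f x) / h) \<longlongrightarrow> frechet_derivative f (at x) d) (at 0)"
        using smooth_has_real_derivative_line[OF f, of x d 0] by (simp add: DERIV_def)
      moreover have "filterlim \<tau> (at 0) sequentially"
        using \<tau>0 \<tau>(1) by (intro filterlim_atI) (auto simp: less_imp_neq[symmetric] intro!: always_eventually dest: less_imp_neq)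
      ultimately show "(\<lambda>k. (f (x + \<tau> k *\<^sub>R d) - f x) / \<tau> k) \<longlonglongrightarrow> frechet_derivative f (at x) d"
        by (rule filterlim_compose)
    qed
    show "AE x in lborel. norm (indicator S x * ((f (x + \<tau> k *\<^sub>R d) - f x) / \<tau> k)) \<le> K * indicator (ball x0 r) x" for k
    proof (intro AE_I2)
      fix x
      have le: "\<bar>(f (x + \<tau> k *\<^sub>R d) - f x) / \<tau> k\<bar> \<le> K"
        using K(3)[of "\<tau> k" x] \<tau>[of k] by (simp add: field_simps)
      have "f (x + \<tau> k *\<^sub>R d) - f x = 0" if "x \<notin> ball x0 r"
      proof -
        have "norm (\<tau> k *\<^sub>R d) \<le> \<tau> k * 1" unfolding norm_scaleR using \<tau>[of k] d by (intro mult_mono) auto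
        then have "dist (x + \<tau> k *\<^sub>R d) x \<le> \<tau> k" by (simp add: dist_norm)
        then have "dist x0 (x + \<tau> k *\<^sub>R d) \<ge> r/2"
          using dist_triangle[of x0 x "x + \<tau> k *\<^sub>R d"] that \<tau>(2)[of k] r by auto
        then show ?thesis using supp[of x] supp[of "x + \<tau> k *\<^sub>R d"] that r by auto
      qed
      then show "norm (indicator S x * ((f (x + \<tau> k *\<^sub>R d) - f x) / \<tau> k)) \<le> K * indicator (ball x0 r) x"
        using le K(1) by (auto simp: indicator_def)
    qed
  qed
  then have lim1: "(\<lambda>k. ennreal \<bar>A (\<tau> k)\<bar>) \<longlonglongrightarrow> ennreal \<bar>\<integral>x. indicator S x * frechet_derivative f (at x) d \<partial>lborel\<bar>"
    by (intro tendsto_ennrealI tendsto_rabs)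
  have lim2: "(\<lambda>k. ennreal ((\<epsilon> + K * \<tau> k) * V) + ennreal (256 / 3) * J) \<longlonglongrightarrow> ennreal ((\<epsilon> + K * 0) * V) + ennreal (256 / 3) * J"
    by (intro tendsto_add tendsto_const tendsto_ennrealI tendsto_intros \<tau>0)
  have "ennreal \<bar>\<integral>x. indicator S x * frechet_derivative f (at x) d \<partial>lborel\<bar> \<le> ennreal ((\<epsilon> + K * 0) * V) + ennreal (256 / 3) * J"
    by (rule LIMSEQ_le[OF lim1 lim2]) (use bound \<tau> in blast)
  then show ?thesis by (simp add: V_def J_def)
qed


section \<open>Weighted convergence criteria and symmetry of second derivatives\<close>

lemma tendsto_0_weighted:
  fixes I :: "nat \<Rightarrow> real" and N :: "nat \<Rightarrow> ennreal"
  assumes bound: "\<And>k \<delta>. \<delta> > 0 \<Longrightarrow> ennreal \<bar>I k\<bar> \<le> ennreal (\<delta> * V) + c \<delta> * N k"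
    and c: "\<And>\<delta>. \<delta> > 0 \<Longrightarrow> c \<delta> < \<infinity>" and V: "V \<ge> 0" and N: "N \<longlonglongrightarrow> 0"
  shows "I \<longlonglongrightarrow> 0"
proof (rule LIMSEQ_I)
  fix e :: real assume e: "e > 0"
  \<comment> \<open>\<open>\<delta>\<close> is fixed before \<open>k\<close>, so \<open>c\<close>
    may blow up as \<open>\<delta>\<close> tends to 0. The summand 1 guards against
    \<open>V = 0\<close>.\<close>
  define \<delta> where "\<delta> = e / (2 * (V + 1))"
  have \<delta>: "\<delta> > 0" using e V by (simp add: \<delta>_def)
  have \<delta>V: "\<delta> * V \<le> e / 2" using e V by (simp add: \<delta>_def field_simps)
  have "(\<lambda>k. c \<delta> * N k) \<longlonglongrightarrow> c \<delta> * 0" using c[OF \<delta>] by (intro ennreal_tendsto_cmult N) simp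
  then have "eventually (\<lambda>k. c \<delta> * N k < ennreal (e/2)) sequentially"
    using e by (intro order_tendstoD) auto
  then obtain n where n: "\<And>k. k \<ge> n \<Longrightarrow> c \<delta> * N k < ennreal (e/2)"
    by (auto simp: eventually_sequentially)
  have "norm (I k - 0) < e" if "k \<ge> n" for k
  proof -
    have "ennreal \<bar>I k\<bar> \<le> ennreal (\<delta> * V) + c \<delta> * N k" by (rule bound[OF \<delta>])
    also have "\<dots> < ennreal (e/2) + ennreal (e/2)"
    proof (rule order_le_less_trans[OF add_right_mono[OF ennreal_leI[OF \<delta>V]]])
      show "ennreal (e/2) + c \<delta> * N k < ennreal (e/2) + ennreal (e/2)"
        using n[OF that] by (simp only: ennreal_add_left_cancel_less) simp
    qed
    also have "\<dots> = ennreal e" using e by (simp add: ennreal_plus[symmetric] del: ennreal_plus)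
    finally show ?thesis using e by (simp add: ennreal_less_iff)
  qed
  then show "\<exists>n. \<forall>k\<ge>n. norm (I k - 0) < e" by blast
qed

text \<open>Two weighted inequalities are combined:
  \<open>2 * |e * g| \<le> e^2 / \<delta> + \<delta> * g^2\<close>, and
  \<open>e^2 \<le> \<delta>^2 + \<delta> powr (2 - q) * |e| powr q\<close>, the latter by comparing
  \<open>|e|\<close> with \<open>\<delta>\<close>. The shape is that required by
  \<open>tendsto_0_weighted\<close>.\<close>

lemma mult_le_weighted_powr:
  fixes e g \<delta> q :: real
  assumes "\<delta> > 0" "q \<ge> 2"
  shows "\<bar>e * g\<bar> \<le> \<delta> * (g\<^sup>2 + 1) + \<delta> powr (1 - q) * \<bar>e\<bar> powr q"
proof -
  have "e\<^sup>2 \<le> \<delta>\<^sup>2 + \<delta> powr (2 - q) * \<bar>e\<bar> powr q"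
  proof (cases "\<bar>e\<bar> \<le> \<delta>")
    case True
    then have "\<bar>e\<bar>\<^sup>2 \<le> \<delta>\<^sup>2" by (intro power_mono) auto
    then show ?thesis by (simp add: add_increasing2)
  next
    case False
    then have "1 \<le> \<bar>e\<bar> / \<delta>" using assms by simp
    then have "(\<bar>e\<bar> / \<delta>) powr 2 \<le> (\<bar>e\<bar> / \<delta>) powr q" using assms by (intro powr_mono)
    then have "\<delta> powr 2 * (\<bar>e\<bar> / \<delta>) powr 2 \<le> \<delta> powr 2 * (\<bar>e\<bar> / \<delta>) powr q" by (intro mult_left_mono) auto
    also have "\<delta> powr 2 * (\<bar>e\<bar> / \<delta>) powr 2 = e\<^sup>2" using assms by (simp add: power_divide)
    also have "\<delta> powr 2 * (\<bar>e\<bar> / \<delta>) powr q = \<delta> powr (2 - q) * \<bar>e\<bar> powr q"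
      using assms by (simp only: powr_divide powr_diff) simp
    finally show ?thesis by (simp add: add_increasing)
  qed
  then have "e\<^sup>2 / \<delta> \<le> (\<delta>\<^sup>2 + \<delta> powr (2 - q) * \<bar>e\<bar> powr q) / \<delta>" using assms by (intro divide_right_mono) auto
  also have "\<dots> = \<delta> + \<delta> powr (1 - q) * \<bar>e\<bar> powr q"
    using assms powr_diff[of \<delta> "2 - q" 1] by (simp add: add_divide_distrib power2_eq_square)
  finally have a: "e\<^sup>2 / \<delta> \<le> \<delta> + \<delta> powr (1 - q) * \<bar>e\<bar> powr q" .
  have "0 \<le> (\<bar>e\<bar> / sqrt \<delta> - sqrt \<delta> * \<bar>g\<bar>)\<^sup>2" by simp
  also have "\<dots> = e\<^sup>2 / \<delta> + \<delta> * g\<^sup>2 - 2 * \<bar>e * g\<bar>"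
    using assms by (simp add: power2_diff power_divide power_mult_distrib abs_mult)
  finally have "2 * \<bar>e * g\<bar> \<le> e\<^sup>2 / \<delta> + \<delta> * g\<^sup>2" by simp
  moreover have "\<bar>e * g\<bar> \<ge> 0" by simp
  ultimately show ?thesis using a by (simp add: algebra_simps)
qed

text \<open>Stands in for Hoelder's inequality together with the inclusion of L^q in L^2 on a finite
  measure space, phrased with q-th powers so that neither roots nor conjugate exponents
  appear.\<close>

lemma tendsto_integral_mult_Lq:
  fixes e :: "nat \<Rightarrow> 'a \<Rightarrow> real"
  assumes M: "finite_measure M" and q: "q \<ge> 2"
    and e: "\<And>k. e k \<in> borel_measurable M" and lim: "(\<lambda>k. \<integral>\<^sup>+x. ennreal (\<bar>e k x\<bar> powr q) \<partial>M) \<longlonglongrightarrow> 0"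
    and g: "g \<in> borel_measurable M" and g2: "integrable M (\<lambda>x. (g x)\<^sup>2)"
    and eg: "\<And>k. integrable M (\<lambda>x. e k x * g x)"
  shows "(\<lambda>k. \<integral>x. e k x * g x \<partial>M) \<longlonglongrightarrow> 0"
proof (rule tendsto_0_weighted[OF _ _ _ lim])
  interpret finite_measure M by fact
  note e [measurable] g [measurable]
  let ?V = "\<integral>x. (g x)\<^sup>2 + 1 \<partial>M"
  have gi: "integrable M (\<lambda>x. (g x)\<^sup>2 + 1)" using g2 by simp
  show "0 \<le> ?V" by (intro Bochner_Integration.integral_nonneg) auto
  show "\<delta> > 0 \<Longrightarrow> ennreal (\<delta> powr (1 - q)) < \<infinity>" for \<delta> by simp
  fix k and \<delta> :: real assume \<delta>: "\<delta> > 0"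
  have "ennreal \<bar>\<integral>x. e k x * g x \<partial>M\<bar> \<le> (\<integral>\<^sup>+x. ennreal \<bar>e k x * g x\<bar> \<partial>M)"
    using integral_norm_bound_ennreal[OF eg[of k]] by simp
  also have "\<dots> \<le> (\<integral>\<^sup>+x. ennreal (\<delta> * ((g x)\<^sup>2 + 1)) + ennreal (\<delta> powr (1 - q)) * ennreal (\<bar>e k x\<bar> powr q) \<partial>M)"
  proof (rule nn_integral_mono)
    fix x
    have "ennreal \<bar>e k x * g x\<bar> \<le> ennreal (\<delta> * ((g x)\<^sup>2 + 1) + \<delta> powr (1 - q) * \<bar>e k x\<bar> powr q)"
      by (intro ennreal_leI mult_le_weighted_powr \<delta> q)
    also have "\<dots> = ennreal (\<delta> * ((g x)\<^sup>2 + 1)) + ennreal (\<delta> powr (1 - q)) * ennreal (\<bar>e k x\<bar> powr q)"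
      using \<delta> by (subst ennreal_plus) (auto simp: ennreal_mult)
    finally show "ennreal \<bar>e k x * g x\<bar> \<le> ennreal (\<delta> * ((g x)\<^sup>2 + 1)) + ennreal (\<delta> powr (1 - q)) * ennreal (\<bar>e k x\<bar> powr q)" .
  qed
  also have "\<dots> = (\<integral>\<^sup>+x. ennreal (\<delta> * ((g x)\<^sup>2 + 1)) \<partial>M) + (\<integral>\<^sup>+x. ennreal (\<delta> powr (1 - q)) * ennreal (\<bar>e k x\<bar> powr q) \<partial>M)"
    by (intro nn_integral_add) measurable
  also have "(\<integral>\<^sup>+x. ennreal (\<delta> powr (1 - q)) * ennreal (\<bar>e k x\<bar> powr q) \<partial>M) = ennreal (\<delta> powr (1 - q)) * (\<integral>\<^sup>+x. ennreal (\<bar>e k x\<bar> powr q) \<partial>M)"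
    by (intro nn_integral_cmult) measurable
  also have "(\<integral>\<^sup>+x. ennreal (\<delta> * ((g x)\<^sup>2 + 1)) \<partial>M) = ennreal (\<integral>x. \<delta> * ((g x)\<^sup>2 + 1) \<partial>M)"
    using gi \<delta> by (intro nn_integral_eq_integral) auto
  also have "(\<integral>x. \<delta> * ((g x)\<^sup>2 + 1) \<partial>M) = \<delta> * ?V" by simp
  finally show "ennreal \<bar>\<integral>x. e k x * g x \<partial>M\<bar> \<le> ennreal (\<delta> * ?V) + ennreal (\<delta> powr (1 - q)) * (\<integral>\<^sup>+x. ennreal (\<bar>e k x\<bar> powr q) \<partial>M)" .
qed

lemma second_difference_mean_value:
  fixes f :: "'a::euclidean_space \<Rightarrow> real"
  assumes f: "smooth f" and s: "s > 0"
  obtains \<xi> \<eta> where "0 < \<xi>" "\<xi> < s" "0 < \<eta>" "\<eta> < s"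
    "f (x + s *\<^sub>R v + s *\<^sub>R w) - f (x + s *\<^sub>R v) - f (x + s *\<^sub>R w) + f x
       = s\<^sup>2 * frechet_derivative (\<lambda>y. frechet_derivative f (at y) v) (at (x + \<xi> *\<^sub>R v + \<eta> *\<^sub>R w)) w"
proof -
  let ?D = "\<lambda>y. frechet_derivative f (at y) v"
  have "((\<lambda>r. f ((x + s *\<^sub>R w) + r *\<^sub>R v) - f (x + r *\<^sub>R v)) has_real_derivative
      (?D ((x + s *\<^sub>R w) + r *\<^sub>R v) - ?D (x + r *\<^sub>R v))) (at r)" for r
    by (intro DERIV_diff smooth_has_real_derivative_line[OF f])
  then obtain \<xi> where \<xi>: "0 < \<xi>" "\<xi> < s"
    "(f ((x + s *\<^sub>R w) + s *\<^sub>R v) - f (x + s *\<^sub>R v)) - (f ((x + s *\<^sub>R w) + 0 *\<^sub>R v) - f (x + 0 *\<^sub>R v))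
      = (s - 0) * (?D ((x + s *\<^sub>R w) + \<xi> *\<^sub>R v) - ?D (x + \<xi> *\<^sub>R v))"
    using MVT2[OF s, of "\<lambda>r. f ((x + s *\<^sub>R w) + r *\<^sub>R v) - f (x + r *\<^sub>R v)" "\<lambda>r. ?D ((x + s *\<^sub>R w) + r *\<^sub>R v) - ?D (x + r *\<^sub>R v)"] by blast
  have "((\<lambda>r. ?D ((x + \<xi> *\<^sub>R v) + r *\<^sub>R w)) has_real_derivative
      frechet_derivative ?D (at ((x + \<xi> *\<^sub>R v) + r *\<^sub>R w)) w) (at r)" for r
    by (intro smooth_has_real_derivative_line smooth_frechet f)
  then obtain \<eta> where \<eta>: "0 < \<eta>" "\<eta> < s"
    "?D ((x + \<xi> *\<^sub>R v) + s *\<^sub>R w) - ?D ((x + \<xi> *\<^sub>R v) + 0 *\<^sub>R w) = (s - 0) * frechet_derivative ?D (at ((x + \<xi> *\<^sub>R v) + \<eta> *\<^sub>R w)) w"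
    using MVT2[OF s, of "\<lambda>r. ?D ((x + \<xi> *\<^sub>R v) + r *\<^sub>R w)" "\<lambda>r. frechet_derivative ?D (at ((x + \<xi> *\<^sub>R v) + r *\<^sub>R w)) w"] by blast
  show ?thesis
  proof (rule that[OF \<xi>(1,2) \<eta>(1,2)])
    show "f (x + s *\<^sub>R v + s *\<^sub>R w) - f (x + s *\<^sub>R v) - f (x + s *\<^sub>R w) + f x
       = s\<^sup>2 * frechet_derivative ?D (at (x + \<xi> *\<^sub>R v + \<eta> *\<^sub>R w)) w"
      using \<xi>(3) \<eta>(3) by (simp add: power2_eq_square ac_simps)
  qed
qed

text \<open>The second difference is symmetric in \<open>v\<close> and \<open>w\<close>. The mean
  value theorem, applied in either order, represents it by either mixed derivative at points tending
  to \<open>x\<close>; continuity then identifies the two.\<close>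

lemma smooth_derivative_commute:
  fixes f :: "'a::euclidean_space \<Rightarrow> real"
  assumes f: "smooth f"
  shows "frechet_derivative (\<lambda>y. frechet_derivative f (at y) v) (at x) w
    = frechet_derivative (\<lambda>y. frechet_derivative f (at y) w) (at x) v"
proof -
  let ?A = "\<lambda>x. frechet_derivative (\<lambda>y. frechet_derivative f (at y) v) (at x) w"
  let ?B = "\<lambda>x. frechet_derivative (\<lambda>y. frechet_derivative f (at y) w) (at x) v"
  define s where "s n = inverse (real (Suc n))" for n
  have s: "s n > 0" for n by (simp add: s_def)
  have s0: "s \<longlonglongrightarrow> 0" unfolding s_def by (rule LIMSEQ_inverse_real_of_nat)
  have "\<exists>\<xi> \<eta> \<xi>' \<eta>'. 0 < \<xi> \<and> \<xi> < s n \<and> 0 < \<eta> \<and> \<eta> < s n \<and> 0 < \<xi>' \<and> \<xi>' < s n \<and> 0 < \<eta>' \<and> \<eta>' < s n \<and>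
      ?A (x + \<xi> *\<^sub>R v + \<eta> *\<^sub>R w) = ?B (x + \<xi>' *\<^sub>R w + \<eta>' *\<^sub>R v)" for n
  proof -
    obtain \<xi> \<eta> where 1: "0 < \<xi>" "\<xi> < s n" "0 < \<eta>" "\<eta> < s n"
      "f (x + s n *\<^sub>R v + s n *\<^sub>R w) - f (x + s n *\<^sub>R v) - f (x + s n *\<^sub>R w) + f x = (s n)\<^sup>2 * ?A (x + \<xi> *\<^sub>R v + \<eta> *\<^sub>R w)"
      using second_difference_mean_value[OF f s, of n x v w] by metis
    obtain \<xi>' \<eta>' where 2: "0 < \<xi>'" "\<xi>' < s n" "0 < \<eta>'" "\<eta>' < s n"
      "f (x + s n *\<^sub>R w + s n *\<^sub>R v) - f (x + s n *\<^sub>R w) - f (x + s n *\<^sub>R v) + f x = (s n)\<^sup>2 * ?B (x + \<xi>' *\<^sub>R w + \<eta>' *\<^sub>R v)"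
      using second_difference_mean_value[OF f s, of n x w v] by metis
    have "f (x + s n *\<^sub>R w + s n *\<^sub>R v) = f (x + s n *\<^sub>R v + s n *\<^sub>R w)" by (simp add: add_ac)
    then have "(s n)\<^sup>2 * ?A (x + \<xi> *\<^sub>R v + \<eta> *\<^sub>R w) = (s n)\<^sup>2 * ?B (x + \<xi>' *\<^sub>R w + \<eta>' *\<^sub>R v)"
      using 1(5) 2(5) by linarith
    then have "?A (x + \<xi> *\<^sub>R v + \<eta> *\<^sub>R w) = ?B (x + \<xi>' *\<^sub>R w + \<eta>' *\<^sub>R v)" using s[of n] by simp
    then show ?thesis using 1 2 by blast
  qed
  then obtain \<xi> \<eta> \<xi>' \<eta>' where b: "\<And>n. 0 < \<xi> n \<and> \<xi> n < s n \<and> 0 < \<eta> n \<and> \<eta> n < s n \<and> 0 < \<xi>' n \<and> \<xi>' n < s n \<and> 0 < \<eta>' n \<and> \<eta>' n < s n"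
    and eq: "\<And>n. ?A (x + \<xi> n *\<^sub>R v + \<eta> n *\<^sub>R w) = ?B (x + \<xi>' n *\<^sub>R w + \<eta>' n *\<^sub>R v)" by metis
  have lim: "t \<longlonglongrightarrow> 0" if "\<And>n. 0 < t n \<and> t n < s n" for t
    by (rule tendsto_sandwich[OF _ _ tendsto_const s0]; rule always_eventually; use that less_imp_le in blast)
  have l: "\<xi> \<longlonglongrightarrow> 0" "\<eta> \<longlonglongrightarrow> 0" "\<xi>' \<longlonglongrightarrow> 0" "\<eta>' \<longlonglongrightarrow> 0" using b by (auto intro!: lim)
  have "(\<lambda>n. x + \<xi> n *\<^sub>R v + \<eta> n *\<^sub>R w) \<longlonglongrightarrow> x + 0 *\<^sub>R v + 0 *\<^sub>R w" by (intro tendsto_intros l)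
  then have l1: "(\<lambda>n. x + \<xi> n *\<^sub>R v + \<eta> n *\<^sub>R w) \<longlonglongrightarrow> x" by simp
  have "(\<lambda>n. x + \<xi>' n *\<^sub>R w + \<eta>' n *\<^sub>R v) \<longlonglongrightarrow> x + 0 *\<^sub>R w + 0 *\<^sub>R v" by (intro tendsto_intros l)
  then have l2: "(\<lambda>n. x + \<xi>' n *\<^sub>R w + \<eta>' n *\<^sub>R v) \<longlonglongrightarrow> x" by simp
  have "isCont ?A x" "isCont ?B x"
    using smooth_continuous[OF smooth_frechet[OF smooth_frechet[OF f]], of UNIV]
    by (auto simp: continuous_on_eq_continuous_at)
  then have "(\<lambda>n. ?A (x + \<xi> n *\<^sub>R v + \<eta> n *\<^sub>R w)) \<longlonglongrightarrow> ?A x" "(\<lambda>n. ?B (x + \<xi>' n *\<^sub>R w + \<eta>' n *\<^sub>R v)) \<longlonglongrightarrow> ?B x"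
    using isCont_tendsto_compose l1 l2 by blast+
  then show ?thesis unfolding eq by (rule LIMSEQ_unique)
qed


section \<open>From inward directions at one point to all directions on the domain\<close>

lemma local_flux_tendsto_0:
  fixes f :: "nat \<Rightarrow> real^3 \<Rightarrow> real"
  assumes S: "open S" and tr: "transversal S x0 r d" and d: "norm d \<le> 1" and r: "r > 0"
    and f: "\<And>k. smooth (f k)" and supp: "\<And>k x. x \<notin> ball x0 (r/2) \<Longrightarrow> f k x = 0"
    and q: "q \<ge> 1" and lim: "(\<lambda>k. boundary_Lq q S (f k)) \<longlonglongrightarrow> 0"
  shows "(\<lambda>k. \<integral>x. indicator S x * frechet_derivative (f k) (at x) d \<partial>lborel) \<longlonglongrightarrow> 0"
proof (rule tendsto_0_weighted[OF _ _ _ lim])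
  show "4 / r * measure lborel (ball x0 r) \<ge> 0" using r by simp
  show "ennreal (256 / 3) * ennreal (\<delta> powr (1 - q)) < \<infinity>" for \<delta> by (simp add: ennreal_mult_less_top)
  fix k and \<delta> :: real assume "\<delta> > 0"
  then show "ennreal \<bar>\<integral>x. indicator S x * frechet_derivative (f k) (at x) d \<partial>lborel\<bar>
      \<le> ennreal (\<delta> * (4 / r * measure lborel (ball x0 r)))
        + ennreal (256 / 3) * ennreal (\<delta> powr (1 - q)) * boundary_Lq q S (f k)"
    unfolding mult.assoc[of "ennreal (256 / 3)"] by (intro local_flux_bound S tr d r f supp q)
qed

text \<open>Derivatives are linear in the direction, so the directions along which the flux tends to
  zero form a subspace. An estimate for inward directions alone is thereby enough.\<close>

lemma local_flux_tendsto_0_span: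
  fixes f :: "nat \<Rightarrow> real^3 \<Rightarrow> real"
  assumes S: "open S" and r: "r > 0"
    and f: "\<And>k. smooth (f k)" and supp: "\<And>k x. x \<notin> ball x0 (r/2) \<Longrightarrow> f k x = 0"
    and q: "q \<ge> 1" and lim: "(\<lambda>k. boundary_Lq q S (f k)) \<longlonglongrightarrow> 0"
    and v: "v \<in> span {d. norm d \<le> 1 \<and> transversal S x0 r d}"
  shows "(\<lambda>k. \<integral>x. indicator S x * frechet_derivative (f k) (at x) v \<partial>lborel) \<longlonglongrightarrow> 0"
proof -
  let ?I = "\<lambda>k v. \<integral>x. indicator S x * frechet_derivative (f k) (at x) v \<partial>lborel"
  have lin: "linear (frechet_derivative (f k) (at y))" for k y
    using has_derivative_linear[OF smooth_has_derivative[OF f]] .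
  have int: "integrable lborel (\<lambda>x. indicator S x * frechet_derivative (f k) (at x) v)" for k v
  proof -
    have "integrable lborel (\<lambda>x. frechet_derivative (f k) (at x) v)"
    proof (rule integrable_lborel_compact_support)
      show "continuous_on UNIV (\<lambda>x. frechet_derivative (f k) (at x) v)"
        by (intro smooth_continuous smooth_frechet f)
      show "frechet_derivative (f k) (at x) v = 0" if "x \<notin> cball x0 (r/2)" for x
        using frechet_eq_0_off_support[of "cball x0 (r/2)" "f k" x] supp that by auto
    qed
    then show ?thesis using integrable_mult_indicator[of S lborel "\<lambda>x. frechet_derivative (f k) (at x) v"] S by simp
  qed
  have add: "?I k (v + w) = ?I k v + ?I k w" for k v w
    by (subst Bochner_Integration.integral_add[symmetric]) (auto simp: int linear_add[OF lin] algebra_simps)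
  have scale: "?I k (c *\<^sub>R v) = c * ?I k v" for k c v
    by (subst integral_mult_right_zero[symmetric]) (simp add: linear_cmul[OF lin] algebra_simps)
  have "subspace {v. (\<lambda>k. ?I k v) \<longlonglongrightarrow> 0}"
    unfolding subspace_def
  proof (intro conjI ballI allI)
    show "0 \<in> {v. (\<lambda>k. ?I k v) \<longlonglongrightarrow> 0}" by (simp add: linear_0[OF lin])
    show "v + w \<in> {v. (\<lambda>k. ?I k v) \<longlonglongrightarrow> 0}" if "v \<in> {v. (\<lambda>k. ?I k v) \<longlonglongrightarrow> 0}" "w \<in> {v. (\<lambda>k. ?I k v) \<longlonglongrightarrow> 0}" for v w
      using tendsto_add[of "\<lambda>k. ?I k v" 0 sequentially "\<lambda>k. ?I k w" 0] that by (simp add: add)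
    show "c *\<^sub>R v \<in> {v. (\<lambda>k. ?I k v) \<longlonglongrightarrow> 0}" if "v \<in> {v. (\<lambda>k. ?I k v) \<longlonglongrightarrow> 0}" for c v
      using tendsto_mult_left[of "\<lambda>k. ?I k v" 0 sequentially c] that by (simp add: scale)
  qed
  moreover have "{d. norm d \<le> 1 \<and> transversal S x0 r d} \<subseteq> {v. (\<lambda>k. ?I k v) \<longlonglongrightarrow> 0}"
    using local_flux_tendsto_0[OF S _ _ r f supp q lim] by blast
  ultimately show ?thesis using span_minimal v by blast
qed

text \<open>Along \<open>d\<close> the height grows at rate \<open>1/2\<close>, while the horizontal
  motion at rate at most \<open>\<epsilon>\<close> raises \<open>g\<close> at rate at most
  \<open>L * \<epsilon> \<le> 1/2\<close>. A point strictly above the graph therefore stays above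
  it.\<close>

lemma transversal_chart:
  fixes g :: "real^2 \<Rightarrow> real"
  assumes T: "orthogonal_transformation T" and g: "L-lipschitz_on UNIV g"
    and chart: "\<Omega> \<inter> ball x0 r = {x \<in> ball x0 r. T x $ 3 > g (vector [T x $ 1, T x $ 2])}"
    and a: "T d $ 3 = 1/2" "\<bar>T d $ 1\<bar> + \<bar>T d $ 2\<bar> \<le> \<epsilon>" "L * \<epsilon> \<le> 1/2"
  shows "transversal \<Omega> x0 r d"
  unfolding transversal_def
proof (intro allI impI)
  fix x t assume x: "x \<in> \<Omega> \<inter> ball x0 r" and t: "0 \<le> (t::real)" and xt: "x + t *\<^sub>R d \<in> ball x0 r"
  have L: "L \<ge> 0" using g by (rule lipschitz_on_nonneg)
  have lin: "linear T" using T by (rule orthogonal_transformation_linear)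
  let ?p = "\<lambda>x. vector [T x $ 1, T x $ 2] :: real^2"
  have Txt: "T (x + t *\<^sub>R d) = T x + t *\<^sub>R T d" by (simp add: linear_add[OF lin] linear_cmul[OF lin])
  have "dist (?p (x + t *\<^sub>R d)) (?p x) = norm (?p (x + t *\<^sub>R d) - ?p x)" by (simp add: dist_norm)
  also have "\<dots> \<le> (\<Sum>i\<in>UNIV. \<bar>(?p (x + t *\<^sub>R d) - ?p x) $ i\<bar>)" by (rule norm_le_l1_cart)
  also have "\<dots> = t * (\<bar>T d $ 1\<bar> + \<bar>T d $ 2\<bar>)"
    using t by (simp add: sum_2 Txt abs_mult algebra_simps)
  also have "\<dots> \<le> t * \<epsilon>" using a t by (intro mult_left_mono)
  finally have pd: "dist (?p (x + t *\<^sub>R d)) (?p x) \<le> t * \<epsilon>" .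
  have "g (?p (x + t *\<^sub>R d)) \<le> g (?p x) + dist (g (?p (x + t *\<^sub>R d))) (g (?p x))" by (simp add: dist_real_def)
  also have "dist (g (?p (x + t *\<^sub>R d))) (g (?p x)) \<le> L * dist (?p (x + t *\<^sub>R d)) (?p x)"
    using lipschitz_onD[OF g] by simp
  also have "\<dots> \<le> L * (t * \<epsilon>)" by (rule mult_left_mono[OF pd L])
  also have "L * (t * \<epsilon>) = t * (L * \<epsilon>)" by simp
  also have "\<dots> \<le> t * (1/2)" using a t by (intro mult_left_mono) auto
  also have "g (?p x) < T x $ 3" using x chart by blast
  finally have "g (?p (x + t *\<^sub>R d)) < T (x + t *\<^sub>R d) $ 3" by (simp add: Txt a)
  then show "x + t *\<^sub>R d \<in> \<Omega>" using chart xt by blast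
qed

lemma transversal_span:
  assumes dom: "bounded_lipschitz_domain \<Omega>" and x0: "x0 \<in> closure \<Omega>"
  obtains r where "r > 0" "span {d. norm d \<le> 1 \<and> transversal \<Omega> x0 r d} = UNIV"
proof (cases "x0 \<in> \<Omega>")
  case True
  then obtain r where r: "r > 0" "ball x0 r \<subseteq> \<Omega>"
    using dom unfolding bounded_lipschitz_domain_def by (meson open_contains_ball)
  have "v \<in> span {d. norm d \<le> 1 \<and> transversal \<Omega> x0 r d}" for v
  proof -
    have "(1 / norm v) *\<^sub>R v \<in> {d. norm d \<le> 1 \<and> transversal \<Omega> x0 r d}"
      using r by (auto simp: transversal_def)
    then have "norm v *\<^sub>R ((1 / norm v) *\<^sub>R v) \<in> span {d. norm d \<le> 1 \<and> transversal \<Omega> x0 r d}"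
      by (intro span_scale span_base)
    then show ?thesis by (cases "v = 0") (auto simp: span_zero)
  qed
  then show ?thesis using that r by blast
next
  case False
  then have "x0 \<in> frontier \<Omega>" using x0 dom
    by (simp add: frontier_def interior_open bounded_lipschitz_domain_def)
  then obtain r and T :: "real^3 \<Rightarrow> real^3" and g L where r: "r > 0" and T: "orthogonal_transformation T" and g: "L-lipschitz_on UNIV (g :: real^2 \<Rightarrow> real)"
    and chart: "\<Omega> \<inter> ball x0 r = {x \<in> ball x0 r. T x $ 3 > g (vector [T x $ 1, T x $ 2])}"
  proof -
    have "\<forall>x0 \<in> frontier \<Omega>. \<exists>r>0. \<exists>T :: real^3 \<Rightarrow> real^3. \<exists>g :: real^2 \<Rightarrow> real. \<exists>L.
       orthogonal_transformation T \<and> L-lipschitz_on UNIV g \<and>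
       \<Omega> \<inter> ball x0 r = {x \<in> ball x0 r. T x $ 3 > g (vector [T x $ 1, T x $ 2])}"
      using dom unfolding bounded_lipschitz_domain_def lipschitz_boundary_def by (elim conjE)
    from bspec[OF this \<open>x0 \<in> frontier \<Omega>\<close>] show ?thesis by (elim exE conjE) (rule that)
  qed
  have L: "L \<ge> 0" using g by (rule lipschitz_on_nonneg)
  \<comment> \<open>In chart coordinates, directions this close to vertical cross the graph of \<open>g\<close> upwards.\<close>
  define \<epsilon> where "\<epsilon> = 1 / (2 * L + 2)"
  have \<epsilon>: "\<epsilon> > 0" "\<epsilon> \<le> 1/2" "L * \<epsilon> \<le> 1/2" using L by (auto simp: \<epsilon>_def field_simps)
  let ?D = "{d. norm d \<le> 1 \<and> transversal \<Omega> x0 r d}"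
  define U where "U = inv T"
  have U: "orthogonal_transformation U" unfolding U_def by (rule orthogonal_transformation_inv[OF T])
  have TU: "T (U a) = a" for a
    unfolding U_def using orthogonal_transformation_surj[OF T] by (simp add: surj_f_inv_f)
  have UT: "U (T a) = a" for a
    unfolding U_def using orthogonal_transformation_inj[OF T] by simp
  have in_D: "U a \<in> ?D" if "a $ 3 = 1/2" "\<bar>a $ 1\<bar> + \<bar>a $ 2\<bar> \<le> \<epsilon>" for a
  proof -
    have "norm (U a) = norm a" using U by (rule orthogonal_transformation_norm)
    also have "\<dots> \<le> (\<Sum>i\<in>UNIV. \<bar>a $ i\<bar>)" by (rule norm_le_l1_cart)
    also have "\<dots> \<le> 1" using that \<epsilon> by (simp add: sum_3)
    finally show ?thesis
      using transversal_chart[OF T g chart, of "U a" \<epsilon>] that \<epsilon> by (simp add: TU)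
  qed
  have ax: "axis j (1::real) \<in> span (T ` ?D)" for j :: 3
  proof -
    have mem: "a \<in> span (T ` ?D)" if "a $ 3 = 1/2" "\<bar>a $ 1\<bar> + \<bar>a $ 2\<bar> \<le> \<epsilon>" for a
      using in_D[OF that] TU[of a] by (metis imageI span_base)
    \<comment> \<open>Height \<open>1/2\<close> leaves room in the unit ball for horizontal
      perturbations of size \<open>\<epsilon>\<close>. Differences of perturbed and unperturbed
      vectors produce the two horizontal axes.\<close>
    let ?a0 = "(1/2) *\<^sub>R axis 3 1 :: real^3"
    have a0: "?a0 \<in> span (T ` ?D)" by (rule mem) (use \<epsilon> in \<open>auto simp: axis_def\<close>)
    have "?a0 + \<epsilon> *\<^sub>R axis i 1 \<in> span (T ` ?D)" if "i = 1 \<or> i = 2" for i :: 3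
      by (rule mem) (use \<epsilon> that in \<open>auto simp: axis_def\<close>)
    then have "(1/\<epsilon>) *\<^sub>R ((?a0 + \<epsilon> *\<^sub>R axis i 1) - ?a0) \<in> span (T ` ?D)" if "i = 1 \<or> i = 2" for i :: 3
      by (rule span_scale[OF span_diff[OF _ a0]]) (use that in auto)
    then have i: "axis i 1 \<in> span (T ` ?D)" if "i = 1 \<or> i = 2" for i :: 3
      using that \<epsilon> by auto
    have "2 *\<^sub>R ?a0 \<in> span (T ` ?D)" using a0 by (rule span_scale)
    then have "axis 3 1 \<in> span (T ` ?D)" by simp
    with i show ?thesis using exhaust_3[of j] by auto
  qed
  have "v \<in> span (T ` ?D)" for v
  proof -
    have "v = (\<Sum>j\<in>UNIV. (v $ j) *\<^sub>R axis j 1)"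
      using basis_expansion[of v] by (simp add: scalar_mult_eq_scaleR)
    also have "\<dots> \<in> span (T ` ?D)" by (intro span_sum span_scale ax)
    finally show ?thesis .
  qed
  moreover have "span (T ` ?D) = T ` span ?D"
    by (rule linear_span_image[OF orthogonal_transformation_linear[OF T]])
  ultimately have *: "T v \<in> T ` span ?D" for v by blast
  have "v \<in> span ?D" for v
  proof -
    obtain w where w: "w \<in> span ?D" "T v = T w" using *[of v] by blast
    have "U (T v) = U (T w)" by (simp only: w(2))
    then have "v = w" by (simp only: UT)
    then show ?thesis using w by simp
  qed
  then show ?thesis using that r by blast
qed

lemma smooth_partition_of_unity:
  fixes C :: "(real^'n) set"
  assumes C: "compact C" and \<rho>: "\<And>x. x \<in> C \<Longrightarrow> \<rho> x > 0"
  obtains I and \<psi> :: "real^'n \<Rightarrow> real^'n \<Rightarrow> real" where "finite I" "I \<subseteq> C" "\<And>i. i \<in> I \<Longrightarrow> smooth (\<psi> i)"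
    "\<And>i x. i \<in> I \<Longrightarrow> x \<notin> ball i (\<rho> i) \<Longrightarrow> \<psi> i x = 0" "\<And>i x. i \<in> I \<Longrightarrow> \<bar>\<psi> i x\<bar> \<le> 1"
    "\<And>x. x \<in> C \<Longrightarrow> (\<Sum>i\<in>I. \<psi> i x) = 1"
proof (cases "C = {}")
  case True
  then show ?thesis using that[of "{}" "\<lambda>i x. 0"] by simp
next
  case False
  have "\<exists>a b. x \<in> box a b \<and> box a b \<subseteq> ball x (\<rho> x)" if "x \<in> C" for x
    using rational_boxes[OF \<rho>[OF that], of x] by metis
  then obtain a b where ab: "\<And>x. x \<in> C \<Longrightarrow> x \<in> box (a x) (b x)" "\<And>x. x \<in> C \<Longrightarrow> box (a x) (b x) \<subseteq> ball x (\<rho> x)"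
    by metis
  obtain I where I: "I \<subseteq> C" "finite I" "C \<subseteq> (\<Union>x\<in>I. box (a x) (b x))"
    by (rule compactE_image[OF C, of C "\<lambda>x. box (a x) (b x)"]) (use ab in auto)
  define \<eta> where "\<eta> i = box_bump 1 (a i) (b i)" for i
  define S where "S x = (\<Sum>i\<in>I. \<eta> i x)" for x
  have \<eta>_nonneg: "\<eta> i x \<ge> 0" for i x by (simp add: \<eta>_def box_bump_nonneg)
  have S_smooth: "smooth S" unfolding S_def \<eta>_def by (intro smooth_sum smooth_box_bump)
  have \<eta>_le: "\<eta> i x \<le> S x" if "i \<in> I" for i x
    unfolding S_def using that I \<eta>_nonneg by (intro member_le_sum) auto
  have S_nonneg: "S x \<ge> 0" for x unfolding S_def by (intro sum_nonneg \<eta>_nonneg)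
  have S_pos: "S x > 0" if x: "x \<in> C" for x
  proof -
    obtain i where i: "i \<in> I" "x \<in> box (a i) (b i)" using I x by auto
    then have "\<eta> i x > 0" by (simp add: \<eta>_def box_bump_pos)
    then show ?thesis using \<eta>_le[OF i(1), of x] by linarith
  qed
  obtain y where y: "y \<in> C" "\<And>x. x \<in> C \<Longrightarrow> S y \<le> S x"
    using continuous_attains_inf[OF C False smooth_continuous[OF S_smooth]] by blast
  \<comment> \<open>A positive smooth function that agrees with \<open>S\<close> on \<open>C\<close>, where \<open>S \<ge> S y\<close>.\<close>
  define R where "R x = S x + bump 0 (S y - S x)" for x
  have R_pos: "R x > 0" for x
  proof (cases "S x > 0")
    case True
    then show ?thesis using bump_nonneg[of 0 "S y - S x"] by (simp add: R_def)
  next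
    case False
    then have "bump 0 (S y - S x) > 0" using S_pos[OF y(1)] by (simp add: bump_pos_iff)
    then show ?thesis using S_nonneg[of x] by (simp add: R_def)
  qed
  have R_smooth: "smooth R" unfolding R_def
    by (intro smooth_add smooth_bump smooth_diff smooth_const S_smooth)
  define \<psi> where "\<psi> i x = \<eta> i x * inverse (R x)" for i x
  show ?thesis
  proof (rule that[OF I(2,1), of \<psi>])
    show "smooth (\<psi> i)" for i
      unfolding \<psi>_def using R_pos
      by (intro smooth_mult smooth_inverse R_smooth) (auto simp: \<eta>_def smooth_box_bump less_imp_neq[symmetric] dest: less_imp_neq)
    show "\<psi> i x = 0" if "i \<in> I" "x \<notin> ball i (\<rho> i)" for i x
    proof -
      have "x \<notin> box (a i) (b i)" using ab(2)[of i] I(1) that by blast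
      then show ?thesis by (simp add: \<psi>_def \<eta>_def box_bump_eq_0)
    qed
    show "\<bar>\<psi> i x\<bar> \<le> 1" if "i \<in> I" for i x
    proof -
      have "\<eta> i x \<le> R x" using \<eta>_le[OF that, of x] bump_nonneg[of 0 "S y - S x"] by (simp add: R_def)
      then show ?thesis using R_pos[of x] \<eta>_nonneg[of i x] by (simp add: \<psi>_def abs_mult field_simps)
    qed
    show "(\<Sum>i\<in>I. \<psi> i x) = 1" if "x \<in> C" for x
    proof -
      have "R x = S x" using y(2)[OF that] by (simp add: R_def bump_eq_0)
      then show ?thesis using S_pos[OF that]
        by (simp add: \<psi>_def S_def sum_distrib_right[symmetric])
    qed
  qed
qed


lemma integral_lebesgue_on_eq_lborel:
  fixes f :: "'a::euclidean_space \<Rightarrow> real"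
  assumes S: "S \<in> sets borel" and f: "f \<in> borel_measurable borel"
  shows "(\<integral>x. f x \<partial>lebesgue_on S) = (\<integral>x. indicator S x * f x \<partial>lborel)"
proof -
  have [measurable]: "(\<lambda>x. indicator S x * f x) \<in> borel_measurable lborel"
    using S f by (intro borel_measurable_times borel_measurable_indicator) auto
  have "(\<integral>x. f x \<partial>lebesgue_on S) = (\<integral>x. indicator S x * f x \<partial>lebesgue)"
    using S by (subst integral_restrict_space) auto
  also have "\<dots> = (\<integral>x. indicator S x * f x \<partial>lborel)" by (intro integral_completion) measurable
  finally show ?thesis .
qed

lemma continuous_integrable_lebesgue_on:
  fixes f :: "'a::euclidean_space \<Rightarrow> 'b::{banach, second_countable_topology}"
  assumes f: "continuous_on UNIV f" and S: "bounded S" "S \<in> sets borel"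
  shows "integrable (lebesgue_on S) f"
proof -
  have "integrable lborel (\<lambda>x. indicator (closure S) x *\<^sub>R f x)"
    using f S by (intro borel_integrable_compact) (auto intro: continuous_on_subset simp: compact_closure)
  then have "integrable lborel (\<lambda>x. indicator S x *\<^sub>R (indicator (closure S) x *\<^sub>R f x))"
    by (rule integrable_mult_indicator[rotated]) (use S in auto)
  moreover have "(\<lambda>x. indicator S x *\<^sub>R (indicator (closure S) x *\<^sub>R f x)) = (\<lambda>x. indicator S x *\<^sub>R f x)"
    using closure_subset[of S] by (auto simp: indicator_def fun_eq_iff)
  ultimately have "integrable lebesgue (\<lambda>x. indicator S x *\<^sub>R f x)"
    by (metis integrable_completion borel_measurable_integrable)
  then show ?thesis using S by (subst integrable_restrict_space) auto
qed

text \<open>Localisation costs nothing, since the local estimates see only boundary values and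
  \<open>|\<psi> i| \<le> 1\<close>; derivatives of the cutoffs never have to be estimated. The
  support radius \<open>r i / 2\<close> is the one that the local lemma demands.\<close>

lemma flux_tendsto_0:
  fixes f :: "nat \<Rightarrow> real^3 \<Rightarrow> real"
  assumes dom: "bounded_lipschitz_domain \<Omega>" and f: "\<And>k. smooth (f k)"
    and q: "q \<ge> 1" and lim: "(\<lambda>k. boundary_Lq q \<Omega> (f k)) \<longlonglongrightarrow> 0"
  shows "(\<lambda>k. \<integral>x. frechet_derivative (f k) (at x) v \<partial>lebesgue_on \<Omega>) \<longlonglongrightarrow> 0"
proof -
  have op: "open \<Omega>" and bd: "bounded \<Omega>" using dom by (auto simp: bounded_lipschitz_domain_def)
  have \<Omega>b: "\<Omega> \<in> sets borel" using op by simp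
  have "\<forall>x\<in>closure \<Omega>. \<exists>r>0. span {d. norm d \<le> 1 \<and> transversal \<Omega> x r d} = UNIV"
    using transversal_span[OF dom] by metis
  then obtain r where r: "\<And>x. x \<in> closure \<Omega> \<Longrightarrow> r x > 0"
    "\<And>x. x \<in> closure \<Omega> \<Longrightarrow> span {d. norm d \<le> 1 \<and> transversal \<Omega> x (r x) d} = UNIV" by metis
  have cc: "compact (closure \<Omega>)" using bd by (simp add: compact_closure)
  obtain I and \<psi> :: "real^3 \<Rightarrow> real^3 \<Rightarrow> real" where I: "finite I" "I \<subseteq> closure \<Omega>" and \<psi>: "\<And>i. i \<in> I \<Longrightarrow> smooth (\<psi> i)"
    "\<And>i x. i \<in> I \<Longrightarrow> x \<notin> ball i (r i / 2) \<Longrightarrow> \<psi> i x = 0" "\<And>i x. i \<in> I \<Longrightarrow> \<bar>\<psi> i x\<bar> \<le> 1"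
    "\<And>x. x \<in> closure \<Omega> \<Longrightarrow> (\<Sum>i\<in>I. \<psi> i x) = 1"
    using smooth_partition_of_unity[OF cc, of "\<lambda>x. r x / 2"] r(1) by (metis half_gt_zero_iff)
  define g where "g i k x = \<psi> i x * f k x" for i k x
  have gs: "smooth (g i k)" if "i \<in> I" for i k
    unfolding g_def by (intro smooth_mult \<psi> f that)
  have gsupp: "g i k x = 0" if "i \<in> I" "x \<notin> ball i (r i / 2)" for i k x
    using \<psi>(2)[OF that] by (simp add: g_def)
  have int: "integrable (lebesgue_on \<Omega>) (\<lambda>x. frechet_derivative (g i k) (at x) v)" if "i \<in> I" for i k
    by (intro continuous_integrable_lebesgue_on smooth_continuous smooth_frechet gs that bd \<Omega>b)
  have piece: "(\<lambda>k. \<integral>x. frechet_derivative (g i k) (at x) v \<partial>lebesgue_on \<Omega>) \<longlonglongrightarrow> 0" if i: "i \<in> I" for i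
  proof -
    have "boundary_Lq q \<Omega> (g i k) \<le> boundary_Lq q \<Omega> (f k)" for k
    proof (intro nn_integral_mono mult_right_mono ennreal_leI powr_mono2)
      show "\<bar>g i k x\<bar> \<le> \<bar>f k x\<bar>" for x
        using mult_right_mono[OF \<psi>(3)[OF i, of x], of "\<bar>f k x\<bar>"] by (simp add: g_def abs_mult)
    qed (use q in auto)
    then have lim': "(\<lambda>k. boundary_Lq q \<Omega> (g i k)) \<longlonglongrightarrow> 0"
      by (intro tendsto_sandwich[OF _ _ tendsto_const lim]) auto
    have "(\<lambda>k. \<integral>x. indicator \<Omega> x * frechet_derivative (g i k) (at x) v \<partial>lborel) \<longlonglongrightarrow> 0"
      by (rule local_flux_tendsto_0_span[OF op _ _ _ q lim', of "r i" i])
        (use r i I gs gsupp in auto)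
    moreover have "(\<integral>x. frechet_derivative (g i k) (at x) v \<partial>lebesgue_on \<Omega>) = (\<integral>x. indicator \<Omega> x * frechet_derivative (g i k) (at x) v \<partial>lborel)" for k
      by (intro integral_lebesgue_on_eq_lborel \<Omega>b borel_measurable_continuous_onI smooth_continuous smooth_frechet gs i)
    ultimately show ?thesis by simp
  qed
  have "(\<integral>x. frechet_derivative (f k) (at x) v \<partial>lebesgue_on \<Omega>) = (\<Sum>i\<in>I. \<integral>x. frechet_derivative (g i k) (at x) v \<partial>lebesgue_on \<Omega>)" for k
  proof -
    have "(\<integral>x. frechet_derivative (f k) (at x) v \<partial>lebesgue_on \<Omega>) = (\<integral>x. (\<Sum>i\<in>I. frechet_derivative (g i k) (at x) v) \<partial>lebesgue_on \<Omega>)"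
    proof (rule Bochner_Integration.integral_cong)
      fix x assume "x \<in> space (lebesgue_on \<Omega>)"
      then have x: "x \<in> \<Omega>" by simp
      have "((\<lambda>y. \<Sum>i\<in>I. g i k y) has_derivative (\<lambda>v. \<Sum>i\<in>I. frechet_derivative (g i k) (at x) v)) (at x)"
        by (intro has_derivative_sum smooth_has_derivative gs)
      then have "(f k has_derivative (\<lambda>v. \<Sum>i\<in>I. frechet_derivative (g i k) (at x) v)) (at x)"
      proof (rule has_derivative_transform_within_open[OF _ op x])
        fix y assume "y \<in> \<Omega>"
        then have "(\<Sum>i\<in>I. \<psi> i y) = 1" using \<psi>(4) closure_subset by blast
        then show "(\<Sum>i\<in>I. g i k y) = f k y" by (simp add: g_def sum_distrib_right[symmetric])
      qed
      then have "(\<lambda>v. \<Sum>i\<in>I. frechet_derivative (g i k) (at x) v) = frechet_derivative (f k) (at x)"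
        by (rule frechet_derivative_at)
      then show "frechet_derivative (f k) (at x) v = (\<Sum>i\<in>I. frechet_derivative (g i k) (at x) v)" by metis
    qed simp
    also have "\<dots> = (\<Sum>i\<in>I. \<integral>x. frechet_derivative (g i k) (at x) v \<partial>lebesgue_on \<Omega>)"
      by (rule Bochner_Integration.integral_sum) (rule int)
    finally show ?thesis .
  qed
  moreover have "(\<lambda>k. \<Sum>i\<in>I. \<integral>x. frechet_derivative (g i k) (at x) v \<partial>lebesgue_on \<Omega>) \<longlonglongrightarrow> (\<Sum>i\<in>I. 0)"
    by (intro tendsto_sum piece)
  ultimately show ?thesis by simp
qed


section \<open>Uniqueness of weak gradients\<close>

text \<open>Since \<open>ennreal\<close> cuts off negative values, the two densities are the
  positive and the negative part of \<open>G\<close>. They agree on open boxes, which are stable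
  under intersection and generate the Borel sets, so the two parts agree almost everywhere and must
  both vanish.\<close>

lemma box_integrals_0_imp_AE_0:
  fixes G :: "'a::euclidean_space \<Rightarrow> real"
  assumes G: "integrable lborel G"
    and z: "\<And>c d. (\<integral>x. indicator (box c d) x * G x \<partial>lborel) = 0"
  shows "AE x in lborel. G x = 0"
proof -
  have Gm [measurable]: "G \<in> borel_measurable borel" using borel_measurable_integrable[OF G] by simp
  let ?M = "density lborel (\<lambda>x. ennreal (G x))" and ?N = "density lborel (\<lambda>x. ennreal (- G x))"
  let ?E = "range (\<lambda>(a, b). box a b::'a set)"
  have fin: "emeasure ?M X \<noteq> \<infinity>" "emeasure ?N X \<noteq> \<infinity>" if "X \<in> sets borel" for X
  proof -
    have "emeasure ?M X \<le> (\<integral>\<^sup>+x. ennreal (norm (G x)) \<partial>lborel)"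
      using that by (subst emeasure_density) (auto intro!: nn_integral_mono ennreal_leI simp: indicator_def)
    moreover have "emeasure ?N X \<le> (\<integral>\<^sup>+x. ennreal (norm (G x)) \<partial>lborel)"
      using that by (subst emeasure_density) (auto intro!: nn_integral_mono ennreal_leI simp: indicator_def)
    moreover have "(\<integral>\<^sup>+x. ennreal (norm (G x)) \<partial>lborel) < \<infinity>" using G by (simp add: integrable_iff_bounded)
    ultimately show "emeasure ?M X \<noteq> \<infinity>" "emeasure ?N X \<noteq> \<infinity>" by (auto simp: top_unique)
  qed
  have "?M = ?N"
  proof (rule measure_eqI_generator_eq)
    show "Int_stable ?E" by (auto simp: Int_stable_def box_Int_box)
    show "?E \<subseteq> Pow UNIV" "sets ?M = sigma_sets UNIV ?E" "sets ?N = sigma_sets UNIV ?E"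
      by (simp_all add: borel_eq_box)
    let ?A = "\<lambda>n::nat. box (- (real n *\<^sub>R One)) (real n *\<^sub>R One) :: 'a set"
    show "range ?A \<subseteq> ?E" "(\<Union>i. ?A i) = UNIV" unfolding UN_box_eq_UNIV by auto
    show "emeasure ?M (?A i) \<noteq> \<infinity>" for i by (rule fin) simp
    fix X assume "X \<in> ?E"
    then obtain c d where X: "X = box c d" by auto
    have i: "integrable lborel (\<lambda>x. indicator X x * G x)"
      using integrable_mult_indicator[of X lborel G] G X by simp
    have "(\<integral>\<^sup>+x. ennreal (indicator X x * G x) \<partial>lborel) = emeasure ?M X"
      unfolding X by (subst emeasure_density) (auto intro!: nn_integral_cong simp: indicator_def)
    moreover have "(\<integral>\<^sup>+x. ennreal (- (indicator X x * G x)) \<partial>lborel) = emeasure ?N X"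
      unfolding X by (subst emeasure_density) (auto intro!: nn_integral_cong simp: indicator_def)
    ultimately have "enn2real (emeasure ?M X) = enn2real (emeasure ?N X)"
      using real_lebesgue_integral_def[OF i] z[of c d] X by simp
    then show "emeasure ?M X = emeasure ?N X"
      using fin[of X] X by (metis borel_open open_box ennreal_enn2real less_top infinity_ennreal_def)
  qed
  then have "AE x in lborel. ennreal (G x) = ennreal (- G x)"
    by (subst (asm) sigma_finite_measure.density_unique_iff[OF lborel.sigma_finite_measure_axioms]) auto
  then show ?thesis
  proof (rule AE_mp, intro AE_I2 impI)
    fix x assume "ennreal (G x) = ennreal (- G x)"
    then show "G x = 0" by (metis abs_if abs_of_nonneg ennreal_eq_0_iff ennreal_inj linorder_not_le neg_le_0_iff_le le_less neg_equal_zero)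
  qed
qed

lemma test_functionsD:
  assumes "\<phi> \<in> test_functions \<Omega>"
  shows "smooth \<phi>" "compact (closure {x. \<phi> x \<noteq> 0})" "closure {x. \<phi> x \<noteq> 0} \<subseteq> \<Omega>"
    "\<And>x. x \<notin> closure {x. \<phi> x \<noteq> 0} \<Longrightarrow> \<phi> x = 0"
  using assms closure_subset[of "{x. \<phi> x \<noteq> 0}"] by (auto simp: test_functions_def)

lemma box_bump_test_function:
  assumes "box c d \<subseteq> cbox a b" "cbox a b \<subseteq> \<Omega>"
  shows "box_bump m c d \<in> test_functions \<Omega>"
proof -
  have "{x. box_bump m c d x \<noteq> 0} \<subseteq> cbox a b" using assms(1) box_bump_eq_0 by blast
  then have "closure {x. box_bump m c d x \<noteq> 0} \<subseteq> cbox a b" by (intro closure_minimal) auto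
  moreover from this have "compact (closure {x. box_bump m c d x \<noteq> 0})"
    by (meson bounded_cbox bounded_subset closed_closure compact_eq_bounded_closed)
  ultimately show ?thesis using assms(2) by (auto simp: test_functions_def smooth_box_bump)
qed

lemma locally_integrable_indicator:
  assumes "locally_integrable \<Omega> g" "compact K" "K \<subseteq> \<Omega>"
  shows "integrable lebesgue (\<lambda>x. indicator K x *\<^sub>R g x)"
proof -
  have "integrable (lebesgue_on K) g" using assms by (auto simp: locally_integrable_def)
  then show ?thesis using assms(2)
    by (subst (asm) integrable_restrict_space) (auto dest: borel_compact)
qed

lemma locally_integrable_mult_test_function:
  fixes g :: "real^3 \<Rightarrow> real"
  assumes g: "locally_integrable \<Omega> g" and \<phi>: "\<phi> \<in> test_functions \<Omega>" and \<Omega>: "open \<Omega>"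
  shows "integrable (lebesgue_on \<Omega>) (\<lambda>x. g x * \<phi> x)"
proof -
  note \<phi>D = test_functionsD[OF \<phi>]
  let ?K = "closure {x. \<phi> x \<noteq> 0}"
  have gi: "integrable lebesgue (\<lambda>x. indicator ?K x *\<^sub>R g x)"
    by (rule locally_integrable_indicator[OF g \<phi>D(2,3)])
  have cont: "continuous_on UNIV \<phi>" by (rule smooth_continuous[OF \<phi>D(1)])
  obtain M where M: "\<And>x. x \<in> ?K \<Longrightarrow> norm (\<phi> x) \<le> M"
    using compact_imp_bounded[OF compact_continuous_image[OF continuous_on_subset[OF cont subset_UNIV] \<phi>D(2)]]
    by (auto simp: bounded_iff)
  have \<phi>m: "\<phi> \<in> borel_measurable lebesgue"
    using borel_measurable_continuous_onI[OF cont] by (intro measurable_completion) simp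
  have "integrable lebesgue (\<lambda>x. (indicator ?K x *\<^sub>R g x) * \<phi> x)"
  proof (rule Bochner_Integration.integrable_bound)
    show "integrable lebesgue (\<lambda>x. M * (indicator ?K x *\<^sub>R g x))" using gi by (rule integrable_mult_right)
    show "(\<lambda>x. (indicator ?K x *\<^sub>R g x) * \<phi> x) \<in> borel_measurable lebesgue"
      by (intro borel_measurable_times borel_measurable_integrable[OF gi] \<phi>m)
    have "norm ((indicator ?K x *\<^sub>R g x) * \<phi> x) \<le> norm (M * (indicator ?K x *\<^sub>R g x))" for x
    proof (cases "x \<in> ?K")
      case True
      have "norm (g x) * norm (\<phi> x) \<le> norm (g x) * M" using M[OF True] by (intro mult_left_mono) auto
      also have "\<dots> \<le> norm (g x) * \<bar>M\<bar>" by (intro mult_left_mono) auto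
      finally show ?thesis using True by (simp add: abs_mult mult.commute)
    qed simp
    then show "AE x in lebesgue. norm ((indicator ?K x *\<^sub>R g x) * \<phi> x) \<le> norm (M * (indicator ?K x *\<^sub>R g x))" by simp
  qed
  moreover have "(\<lambda>x. (indicator ?K x *\<^sub>R g x) * \<phi> x) = (\<lambda>x. indicator \<Omega> x *\<^sub>R (g x * \<phi> x))"
  proof
    fix x
    show "(indicator ?K x *\<^sub>R g x) * \<phi> x = indicator \<Omega> x *\<^sub>R (g x * \<phi> x)"
    proof (cases "x \<in> ?K")
      case True
      then have "x \<in> \<Omega>" using \<phi>D(3) by blast
      then show ?thesis using True by simp
    next
      case False
      then have "\<phi> x = 0" by (rule \<phi>D(4))
      then show ?thesis by simp
    qed
  qed
  ultimately show ?thesis using \<Omega> by (subst integrable_restrict_space) auto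
qed

text \<open>The functions \<open>box_bump m c d\<close> are admissible test functions converging
  boundedly to the indicator of the box, so all integrals of \<open>g\<close> over boxes inside a
  compact box vanish by dominated convergence.\<close>

lemma du_Bois_Reymond:
  fixes g :: "real^3 \<Rightarrow> real"
  assumes \<Omega>: "open \<Omega>" and g: "locally_integrable \<Omega> g"
    and z: "\<And>\<phi>. \<phi> \<in> test_functions \<Omega> \<Longrightarrow> (\<integral>x. g x * \<phi> x \<partial>lebesgue_on \<Omega>) = 0"
  shows "AE x in lebesgue_on \<Omega>. g x = 0"
proof -
  have box: "AE x in lebesgue. x \<in> box a b \<longrightarrow> g x = 0" if ab: "cbox a b \<subseteq> \<Omega>" for a b
  proof -
    have gi: "integrable lebesgue (\<lambda>x. indicator (cbox a b) x *\<^sub>R g x)"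
      by (rule locally_integrable_indicator[OF g compact_cbox ab])
    have bi: "integrable lebesgue (\<lambda>x. indicator (box c d) x * g x)" if "box c d \<subseteq> cbox a b" for c d
    proof -
      have "integrable lebesgue (\<lambda>x. indicator (box c d) x *\<^sub>R (indicator (cbox a b) x *\<^sub>R g x))"
        using gi by (rule integrable_mult_indicator[rotated]) simp
      moreover have "(\<lambda>x. indicator (box c d) x *\<^sub>R (indicator (cbox a b) x *\<^sub>R g x)) = (\<lambda>x. indicator (box c d) x * g x)"
        using that by (auto simp: fun_eq_iff indicator_def)
      ultimately show ?thesis by simp
    qed
    have bz: "(\<integral>x. indicator (box c d) x * g x \<partial>lebesgue) = 0" if cd: "box c d \<subseteq> cbox a b" for c d
    proof -
      have "(\<lambda>m. \<integral>x. box_bump m c d x * (indicator (cbox a b) x *\<^sub>R g x) \<partial>lebesgue)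
          \<longlonglongrightarrow> (\<integral>x. indicator (box c d) x * (indicator (cbox a b) x *\<^sub>R g x) \<partial>lebesgue)"
      proof (rule integral_dominated_convergence)
        show "integrable lebesgue (\<lambda>x. norm (indicator (cbox a b) x *\<^sub>R g x))" using gi by (rule integrable_norm)
        show "(\<lambda>x. indicator (box c d) x * (indicator (cbox a b) x *\<^sub>R g x)) \<in> borel_measurable lebesgue"
          by (intro borel_measurable_times borel_measurable_integrable[OF gi] borel_measurable_indicator) simp
        have "box_bump m c d \<in> borel_measurable lebesgue" for m
          using borel_measurable_continuous_onI[OF smooth_continuous[OF smooth_box_bump]] by (intro measurable_completion) simp
        then show "(\<lambda>x. box_bump m c d x * (indicator (cbox a b) x *\<^sub>R g x)) \<in> borel_measurable lebesgue" for m
          by (intro borel_measurable_times borel_measurable_integrable[OF gi])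
        show "AE x in lebesgue. (\<lambda>m. box_bump m c d x * (indicator (cbox a b) x *\<^sub>R g x)) \<longlonglongrightarrow> indicator (box c d) x * (indicator (cbox a b) x *\<^sub>R g x)"
          by (intro AE_I2 tendsto_mult tendsto_const box_bump_tendsto)
        have "norm (box_bump m c d x * y) \<le> norm y" for m x y
          using box_bump_le_1[of m c d x] box_bump_nonneg[of m c d x] mult_right_mono[of "box_bump m c d x" 1 "norm y"]
          by (simp add: abs_mult)
        then show "AE x in lebesgue. norm (box_bump m c d x * (indicator (cbox a b) x *\<^sub>R g x)) \<le> norm (indicator (cbox a b) x *\<^sub>R g x)" for m
          by simp
      qed
      moreover have "(\<integral>x. box_bump m c d x * (indicator (cbox a b) x *\<^sub>R g x) \<partial>lebesgue) = 0" for m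
      proof -
        have "(\<lambda>x. box_bump m c d x * (indicator (cbox a b) x *\<^sub>R g x)) = (\<lambda>x. indicator \<Omega> x *\<^sub>R (g x * box_bump m c d x))"
        proof
          fix x
          show "box_bump m c d x * (indicator (cbox a b) x *\<^sub>R g x) = indicator \<Omega> x *\<^sub>R (g x * box_bump m c d x)"
            using cd ab box_bump_eq_0[of x c d m] by (cases "x \<in> box c d") (auto simp: indicator_def)
        qed
        then have "(\<integral>x. box_bump m c d x * (indicator (cbox a b) x *\<^sub>R g x) \<partial>lebesgue) = (\<integral>x. g x * box_bump m c d x \<partial>lebesgue_on \<Omega>)"
          using \<Omega> by (subst integral_restrict_space) auto
        also have "\<dots> = 0" by (rule z[OF box_bump_test_function[OF cd ab]])
        finally show ?thesis .
      qed
      ultimately have "(\<integral>x. indicator (box c d) x * (indicator (cbox a b) x *\<^sub>R g x) \<partial>lebesgue) = 0"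
        by (simp add: LIMSEQ_const_iff)
      moreover have "(\<lambda>x. indicator (box c d) x * (indicator (cbox a b) x *\<^sub>R g x)) = (\<lambda>x. indicator (box c d) x * g x)"
        using cd by (auto simp: fun_eq_iff indicator_def)
      ultimately show ?thesis by simp
    qed
    let ?G0 = "\<lambda>x. indicator (box a b) x * g x"
    have G0: "integrable lebesgue ?G0" by (rule bi[OF box_subset_cbox])
    \<comment> \<open>The box criterion concerns Borel functions, whereas \<open>g\<close> is only
      Lebesgue measurable; a Borel representative on the box bridges the two.\<close>
    obtain G where G: "G \<in> borel_measurable lborel" and ae: "AE x in lborel. ?G0 x = G x"
      using completion_ex_borel_measurable_real[OF borel_measurable_integrable[OF G0]] by blast
    have ae': "AE x in lebesgue. ?G0 x = G x" using ae by (rule AE_completion)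
    have G': "G \<in> borel_measurable lebesgue" using G by (rule measurable_completion)
    have Gi: "integrable lborel G"
    proof -
      have "integrable lebesgue G"
        using integrable_cong_AE[OF borel_measurable_integrable[OF G0] G' ae'] G0 by simp
      then show ?thesis using G by (simp add: integrable_completion)
    qed
    have "AE x in lborel. G x = 0"
    proof (rule box_integrals_0_imp_AE_0[OF Gi])
      fix c d
      obtain c' d' where cd': "box a b \<inter> box c d = box c' d'" using box_Int_box[of a b c d] by blast
      have m: "(\<lambda>x. indicator (box c d) x * G x) \<in> borel_measurable lborel"
        using G by (intro borel_measurable_times borel_measurable_indicator) auto
      have "(\<integral>x. indicator (box c d) x * G x \<partial>lborel) = (\<integral>x. indicator (box c d) x * G x \<partial>lebesgue)"
        using m by (rule integral_completion[symmetric])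
      also have "\<dots> = (\<integral>x. indicator (box c' d') x * g x \<partial>lebesgue)"
      proof (rule integral_cong_AE)
        show "(\<lambda>x. indicator (box c d) x * G x) \<in> borel_measurable lebesgue" using m by (rule measurable_completion)
        have "box c' d' \<subseteq> cbox a b" using cd' box_subset_cbox[of a b] by blast
        then show "(\<lambda>x. indicator (box c' d') x * g x) \<in> borel_measurable lebesgue"
          by (intro borel_measurable_integrable bi)
        show "AE x in lebesgue. indicator (box c d) x * G x = indicator (box c' d') x * g x"
          using ae' by (rule AE_mp) (intro AE_I2, auto simp: cd'[symmetric] indicator_def)
      qed
      also have "\<dots> = 0" by (rule bz) (use cd' box_subset_cbox[of a b] in blast)
      finally show "(\<integral>x. indicator (box c d) x * G x \<partial>lborel) = 0" .
    qed
    then have "AE x in lebesgue. G x = 0" by (rule AE_completion)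
    then show ?thesis using ae' by eventually_elim (auto simp: indicator_def)
  qed
  \<comment> \<open>Almost-everywhere statements pass only to countable unions, so
    \<open>\<Omega>\<close> is covered by boxes with closure inside and Lindelof's theorem selects
    countably many.\<close>
  define F where "F = {box a b | a b :: real^3. cbox a b \<subseteq> \<Omega>}"
  have cover: "\<Union>F = \<Omega>"
  proof
    show "\<Union>F \<subseteq> \<Omega>" using box_subset_cbox by (force simp: F_def)
    show "\<Omega> \<subseteq> \<Union>F"
    proof
      fix x assume "x \<in> \<Omega>"
      then obtain e where e: "e > 0" "ball x e \<subseteq> \<Omega>" using \<Omega> by (meson open_contains_ball)
      then obtain a b where ab: "x \<in> box a b" "box a b \<subseteq> ball x (e/2)"
        using rational_boxes[of "e/2" x] by (metis half_gt_zero)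
      then have "cbox a b = closure (box a b)" by (intro closure_box[symmetric]) auto
      also have "\<dots> \<subseteq> cball x (e/2)" using ab(2) by (intro closure_minimal) auto
      also have "\<dots> \<subseteq> \<Omega>" using e by (auto simp: subset_iff)
      finally show "x \<in> \<Union>F" using ab by (auto simp: F_def)
    qed
  qed
  obtain F' where F': "F' \<subseteq> F" "countable F'" "\<Union>F' = \<Union>F"
    using Lindelof[of F] by (auto simp: F_def)
  have "AE x in lebesgue. \<forall>B\<in>F'. x \<in> B \<longrightarrow> g x = 0"
    using F'(1) box by (subst AE_ball_countable[OF F'(2)]) (auto simp: F_def)
  then have "AE x in lebesgue. x \<in> \<Omega> \<longrightarrow> g x = 0"
    by (rule AE_mp) (intro AE_I2, use F'(3) cover in blast)
  then show ?thesis using \<Omega> by (subst AE_restrict_space_iff) auto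
qed


text \<open>The flux result for the whole space and a constant sequence: the frontier is empty and
  every direction is transversal.\<close>

lemma integral_derivative_compact_support:
  fixes f :: "real^3 \<Rightarrow> real"
  assumes f: "smooth f" and supp: "\<And>x. x \<notin> ball 0 R \<Longrightarrow> f x = 0" and R: "R > 0"
  shows "(\<integral>x. frechet_derivative f (at x) v \<partial>lborel) = 0"
proof -
  have "(1 / norm v) *\<^sub>R v \<in> {d. norm d \<le> 1 \<and> transversal UNIV 0 (2 * R) d}"
    by (auto simp: transversal_def)
  then have "norm v *\<^sub>R ((1 / norm v) *\<^sub>R v) \<in> span {d. norm d \<le> 1 \<and> transversal UNIV 0 (2 * R) d}"
    by (intro span_scale span_base)
  then have v: "v \<in> span {d. norm d \<le> 1 \<and> transversal UNIV 0 (2 * R) d}"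
    by (cases "v = 0") (auto simp: span_zero)
  have "(\<lambda>k::nat. \<integral>x. indicator UNIV x * frechet_derivative f (at x) v \<partial>lborel) \<longlonglongrightarrow> 0"
    by (rule local_flux_tendsto_0_span[OF open_UNIV _ f _ _ _ v, where q=1])
      (use R supp in \<open>auto simp: frontier_UNIV\<close>)
  then show ?thesis by (simp add: LIMSEQ_const_iff)
qed

lemma bounded_linear_vec_nth2: "bounded_linear (\<lambda>A::real^'n^'m. A $ i $ j)"
  by (rule bounded_linear_compose[OF bounded_linear_vec_nth bounded_linear_vec_nth])

text \<open>Makes the choice in \<open>weak_gradient\<close> harmless; in particular the chosen
  gradient of the affine map can be computed almost everywhere.\<close>

lemma has_weak_gradient_unique:
  assumes \<Omega>: "open \<Omega>" and G: "has_weak_gradient \<Omega> u G" and G': "has_weak_gradient \<Omega> u G'"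
  shows "AE x in lebesgue_on \<Omega>. G x = G' x"
proof -
  have "AE x in lebesgue_on \<Omega>. G x $ i $ j - G' x $ i $ j = 0" for i j
  proof (rule du_Bois_Reymond[OF \<Omega>])
    have li: "locally_integrable \<Omega> (\<lambda>x. H x $ i $ j)" if "has_weak_gradient \<Omega> u H" for H
      unfolding locally_integrable_def
    proof (intro allI impI)
      fix K assume "compact K \<and> K \<subseteq> \<Omega>"
      then have "integrable (lebesgue_on K) H"
        using that by (simp add: has_weak_gradient_def locally_integrable_def)
      then show "integrable (lebesgue_on K) (\<lambda>x. H x $ i $ j)"
        by (rule integrable_bounded_linear[OF bounded_linear_vec_nth2])
    qed
    show "locally_integrable \<Omega> (\<lambda>x. G x $ i $ j - G' x $ i $ j)"
      unfolding locally_integrable_def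
    proof (intro allI impI)
      fix K assume "compact K \<and> K \<subseteq> \<Omega>"
      then show "integrable (lebesgue_on K) (\<lambda>x. G x $ i $ j - G' x $ i $ j)"
        using li[OF G] li[OF G'] unfolding locally_integrable_def
        by (intro Bochner_Integration.integrable_diff) blast+
    qed
    fix \<phi> assume \<phi>: "\<phi> \<in> test_functions \<Omega>"
    have e: "(\<integral>x. u x $ i * frechet_derivative \<phi> (at x) (axis j 1) \<partial>lebesgue_on \<Omega>) = - (\<integral>x. H x $ i $ j * \<phi> x \<partial>lebesgue_on \<Omega>)"
      if "has_weak_gradient \<Omega> u H" for H
      using that \<phi> unfolding has_weak_gradient_def by blast
    have "(\<integral>x. G x $ i $ j * \<phi> x \<partial>lebesgue_on \<Omega>) = (\<integral>x. G' x $ i $ j * \<phi> x \<partial>lebesgue_on \<Omega>)"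
      using e[OF G] e[OF G'] by simp
    moreover have "(\<integral>x. G x $ i $ j * \<phi> x - G' x $ i $ j * \<phi> x \<partial>lebesgue_on \<Omega>)
        = (\<integral>x. G x $ i $ j * \<phi> x \<partial>lebesgue_on \<Omega>) - (\<integral>x. G' x $ i $ j * \<phi> x \<partial>lebesgue_on \<Omega>)"
      by (intro Bochner_Integration.integral_diff locally_integrable_mult_test_function li \<phi> \<Omega> G G')
    ultimately show "(\<integral>x. (G x $ i $ j - G' x $ i $ j) * \<phi> x \<partial>lebesgue_on \<Omega>) = 0"
      by (simp add: algebra_simps)
  qed
  then have "AE x in lebesgue_on \<Omega>. \<forall>i j. G x $ i $ j - G' x $ i $ j = 0"
    by (intro eventually_all_finite)
  then show ?thesis by eventually_elim (simp add: vec_eq_iff)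
qed

lemma continuous_locally_integrable:
  assumes "continuous_on UNIV f"
  shows "locally_integrable \<Omega> f"
  unfolding locally_integrable_def
  by (intro allI impI continuous_integrable_lebesgue_on[OF assms]) (auto intro: compact_imp_bounded borel_compact)

text \<open>The product of a coordinate with a test function has compact support, so its derivative
  integrates to zero, and the product rule turns this into the defining identity.\<close>

lemma has_weak_gradient_scaleR:
  assumes \<Omega>: "open \<Omega>"
  shows "has_weak_gradient \<Omega> (\<lambda>x. lam *\<^sub>R x) (\<lambda>x. lam *\<^sub>R mat 1)"
  unfolding has_weak_gradient_def
proof (intro conjI ballI allI)
  show "locally_integrable \<Omega> (\<lambda>x. lam *\<^sub>R x)" "locally_integrable \<Omega> (\<lambda>x. lam *\<^sub>R mat 1 :: real^3^3)"
    by (intro continuous_locally_integrable continuous_intros)+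
  fix \<phi> i j assume \<phi>: "\<phi> \<in> test_functions \<Omega>"
  define K where "K = closure {x. \<phi> x \<noteq> 0}"
  have \<phi>D: "smooth \<phi>" "compact K" "K \<subseteq> \<Omega>" "\<And>x. x \<notin> K \<Longrightarrow> \<phi> x = 0"
    using test_functionsD[OF \<phi>] unfolding K_def by blast+
  let ?e = "axis j (1::real) :: real^3"
  let ?D = "\<lambda>x. frechet_derivative \<phi> (at x) ?e"
  have \<Omega>b: "\<Omega> \<in> sets borel" using \<Omega> by simp
  have D0: "?D x = 0" if "x \<notin> K" for x
    by (subst frechet_eq_0_off_support[of K \<phi> x, OF compact_imp_closed[OF \<phi>D(2)] \<phi>D(4) that]) simp_all
  obtain R where R: "R > 0" "K \<subseteq> ball 0 R"
    using bounded_subset_ballD[OF compact_imp_bounded[OF \<phi>D(2)], of 0] by blast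
  have out: "f \<in> borel_measurable borel \<Longrightarrow> (\<And>x. x \<notin> K \<Longrightarrow> f x = 0) \<Longrightarrow>
      (\<integral>x. f x \<partial>lebesgue_on \<Omega>) = (\<integral>x. f x \<partial>lborel)" for f :: "real^3 \<Rightarrow> real"
  proof (subst integral_lebesgue_on_eq_lborel[OF \<Omega>b], assumption, rule Bochner_Integration.integral_cong)
    fix x assume 0: "\<And>x. x \<notin> K \<Longrightarrow> f x = 0"
    show "indicator \<Omega> x * f x = f x" using 0[of x] \<phi>D(3) by (cases "x \<in> \<Omega>") auto
  qed simp
  have c1: "continuous_on UNIV (\<lambda>x. x $ i * ?D x)"
    by (intro continuous_intros smooth_continuous smooth_frechet \<phi>D(1))
  have c2: "continuous_on UNIV (\<lambda>x. \<phi> x * ?e $ i)"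
    by (intro continuous_intros smooth_continuous \<phi>D(1))
  have supp: "x \<in> K \<Longrightarrow> x \<in> cball 0 R" for x using R by (auto simp: subset_iff)
  have i1: "integrable lborel (\<lambda>x. x $ i * ?D x)"
    by (rule integrable_lborel_compact_support[OF c1, of 0 R]) (use D0 supp in auto)
  have i2: "integrable lborel (\<lambda>x. \<phi> x * ?e $ i)"
    by (rule integrable_lborel_compact_support[OF c2, of 0 R]) (use \<phi>D(4) supp in auto)
  have sm: "smooth (\<lambda>x. x $ i * \<phi> x)" by (intro smooth_mult smooth_component \<phi>D(1))
  have "((\<lambda>x. x $ i * \<phi> x) has_derivative (\<lambda>v. x $ i * frechet_derivative \<phi> (at x) v + v $ i * \<phi> x)) (at x)" for x
    by (intro has_derivative_mult smooth_has_derivative \<phi>D(1) bounded_linear_imp_has_derivative bounded_linear_vec_nth)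
  then have "frechet_derivative (\<lambda>x. x $ i * \<phi> x) (at x) ?e = x $ i * ?D x + \<phi> x * ?e $ i" for x
    using frechet_derivative_at by (metis (no_types, lifting) mult.commute)
  moreover have "(\<integral>x. frechet_derivative (\<lambda>x. x $ i * \<phi> x) (at x) ?e \<partial>lborel) = 0"
  proof (rule integral_derivative_compact_support[OF sm _ R(1)])
    fix x :: "real^3" assume "x \<notin> ball 0 R"
    then have "x \<notin> K" using R(2) by blast
    then show "x $ i * \<phi> x = 0" by (simp add: \<phi>D(4))
  qed
  ultimately have "(\<integral>x. x $ i * ?D x \<partial>lborel) + (\<integral>x. \<phi> x * ?e $ i \<partial>lborel) = 0"
    using Bochner_Integration.integral_add[OF i1 i2] by simp
  moreover have "(\<integral>x. x $ i * ?D x \<partial>lebesgue_on \<Omega>) = (\<integral>x. x $ i * ?D x \<partial>lborel)"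
    by (rule out[OF borel_measurable_continuous_onI[OF c1]]) (simp add: D0)
  moreover have "(\<integral>x. \<phi> x * ?e $ i \<partial>lebesgue_on \<Omega>) = (\<integral>x. \<phi> x * ?e $ i \<partial>lborel)"
    by (rule out[OF borel_measurable_continuous_onI[OF c2]]) (simp add: \<phi>D(4))
  ultimately have *: "(\<integral>x. x $ i * ?D x \<partial>lebesgue_on \<Omega>) = - (\<integral>x. \<phi> x * ?e $ i \<partial>lebesgue_on \<Omega>)" by linarith
  have "(\<integral>x. (lam *\<^sub>R x) $ i * ?D x \<partial>lebesgue_on \<Omega>) = lam * (\<integral>x. x $ i * ?D x \<partial>lebesgue_on \<Omega>)"
    by (subst integral_mult_right_zero[symmetric]) (simp add: mult.assoc)
  also have "\<dots> = - (lam * (\<integral>x. \<phi> x * ?e $ i \<partial>lebesgue_on \<Omega>))" unfolding * by simp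
  also have "\<dots> = - (\<integral>x. (lam *\<^sub>R mat 1 :: real^3^3) $ i $ j * \<phi> x \<partial>lebesgue_on \<Omega>)"
    by (subst integral_mult_right_zero[symmetric]) (simp add: mat_def axis_def mult_ac)
  finally show "(\<integral>x. (lam *\<^sub>R x) $ i * ?D x \<partial>lebesgue_on \<Omega>) = - (\<integral>x. (lam *\<^sub>R mat 1 :: real^3^3) $ i $ j * \<phi> x \<partial>lebesgue_on \<Omega>)" .
qed

lemma has_weak_gradient_weak_gradient:
  "has_weak_gradient \<Omega> u G \<Longrightarrow> has_weak_gradient \<Omega> u (weak_gradient \<Omega> u)"
  unfolding weak_gradient_def by (rule someI[where P="has_weak_gradient \<Omega> u"])

lemma weak_gradient_scaleR:
  assumes "open \<Omega>"
  shows "AE x in lebesgue_on \<Omega>. weak_gradient \<Omega> (\<lambda>x. lam *\<^sub>R x) x = lam *\<^sub>R mat 1"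
  by (rule has_weak_gradient_unique[OF assms
        has_weak_gradient_weak_gradient[OF has_weak_gradient_scaleR[OF assms]] has_weak_gradient_scaleR[OF assms]])


section \<open>Determinants and minors\<close>

lemma norm_matrix_mult_orthogonal:
  fixes A R :: "real^'n^'n"
  assumes "orthogonal_matrix R"
  shows "norm (A ** R) = norm A"
proof -
  have "trace (transpose (A ** R) ** (A ** R)) = trace ((A ** R) ** transpose (A ** R))"
    by (rule trace_mul_sym)
  also have "(A ** R) ** transpose (A ** R) = A ** (R ** transpose R) ** transpose A"
    by (simp add: matrix_transpose_mul matrix_mul_assoc)
  also have "R ** transpose R = mat 1" using assms by (simp add: orthogonal_matrix_def)
  also have "trace (A ** mat 1 ** transpose A) = trace (transpose A ** A)"
    by (simp add: trace_mul_sym[of A "transpose A"])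
  finally show ?thesis by (simp add: norm_matrix_eq_sqrt_trace)
qed

lemma det_eq_inner_cross3:
  fixes B :: "real^3^3"
  shows "det B = column 1 B \<bullet> cross3 (column 2 B) (column 3 B)"
  by (simp add: det_3 cross3_def inner_vec_def sum_3 column_def) algebra

lemma norm_cross3_le: "norm (cross3 x y) \<le> norm x * norm y"
proof -
  have "(norm (cross3 x y))\<^sup>2 \<le> (norm x * norm y)\<^sup>2"
    using norm_cross[of x y] by (simp add: power_mult_distrib)
  then show ?thesis by (rule power2_le_imp_le) simp
qed

lemma norm_matrix_3_columns:
  fixes B :: "real^3^3"
  shows "(norm B)\<^sup>2 = (norm (column 1 B))\<^sup>2 + (norm (column 2 B))\<^sup>2 + (norm (column 3 B))\<^sup>2"
  by (simp add: power2_norm_eq_inner inner_vec_def sum_3 column_def)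

lemma det_scaleR_mat_add_sign:
  fixes \<Phi> :: "real^3^3"
  assumes neg: "det \<Phi> < 0" and pos: "det (lam *\<^sub>R mat 1 + \<Phi>) > 0" and lam: "lam > 0"
  obtains x where "norm x = 1" "norm (\<Phi> *v x) \<le> lam"
proof -
  have cont: "continuous_on UNIV (\<lambda>s. det (s *\<^sub>R mat 1 + \<Phi>))"
    by (simp add: det_3 mat_def) (intro continuous_intros)
  obtain s where s: "0 \<le> s" "s \<le> lam" "det (s *\<^sub>R mat 1 + \<Phi>) = 0"
    using IVT'[of "\<lambda>s. det (s *\<^sub>R mat 1 + \<Phi>)" 0 0 lam] neg pos lam continuous_on_subset[OF cont]
    by auto
  then have "\<not> invertible (s *\<^sub>R mat 1 + \<Phi>)" by (simp add: invertible_det_nz)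
  then obtain y where y: "(s *\<^sub>R mat 1 + \<Phi>) *v y = 0" "y \<noteq> 0"
    by (metis invertible_left_inverse matrix_left_invertible_ker)
  have "(s *\<^sub>R mat 1 + \<Phi>) *v y = s *\<^sub>R y + \<Phi> *v y"
    by (simp add: matrix_vector_mult_add_rdistrib scaleR_matrix_vector_assoc[symmetric])
  then have "\<Phi> *v y = - (s *\<^sub>R y)" using y by (simp add: eq_neg_iff_add_eq_0 add.commute)
  then have "norm (\<Phi> *v y) = s * norm y" using s by simp
  moreover have "\<Phi> *v ((1 / norm y) *\<^sub>R y) = (1 / norm y) *\<^sub>R (\<Phi> *v y)"
    by (simp add: matrix_vector_mult_scaleR)
  ultimately have eq: "norm (\<Phi> *v ((1 / norm y) *\<^sub>R y)) = s" using y by simp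
  show ?thesis
  proof (rule that)
    show "norm ((1 / norm y) *\<^sub>R y) = 1" using y(2) by simp
    show "norm (\<Phi> *v ((1 / norm y) *\<^sub>R y)) \<le> lam" unfolding eq by (rule s(2))
  qed
qed

text \<open>In the nontrivial case some unit vector is stretched by at most \<open>lam\<close>. Used
  as the first vector of an orthonormal basis it bounds one column; the product of the other two
  column lengths is at most half the sum of their squares, which is the origin of the factor
  \<open>1/2\<close>.\<close>

lemma det_ge_neg_norm_square:
  fixes \<Phi> :: "real^3^3"
  assumes pos: "det (lam *\<^sub>R mat 1 + \<Phi>) > 0" and lam: "lam > 0"
  shows "det \<Phi> \<ge> - (lam / 2) * (norm \<Phi>)\<^sup>2"
proof (cases "det \<Phi> < 0")
  case False
  have "- (lam / 2) * (norm \<Phi>)\<^sup>2 \<le> 0" using lam by simp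
  then show ?thesis using False by linarith
next
  case True
  obtain x where x: "norm x = 1" "norm (\<Phi> *v x) \<le> lam"
    using det_scaleR_mat_add_sign[OF True pos lam] .
  \<comment> \<open>An orthogonal map sending the first axis to \<open>x\<close> makes
    \<open>\<Phi> *v x\<close> the first column of \<open>B\<close>. It preserves the norm, but the
    determinant only up to sign, hence the absolute values.\<close>
  have n1: "norm (axis 1 1 :: real^3) = 1" by simp
  obtain f :: "real^3 \<Rightarrow> real^3" where f: "orthogonal_transformation f" "f (axis 1 1) = x"
    by (rule orthogonal_transformation_exists_1[OF n1 x(1)])
  define R where "R = matrix f"
  have R: "orthogonal_matrix R" using f(1) by (simp add: R_def orthogonal_transformation_matrix)
  have Rx: "R *v axis 1 1 = x"
    using f by (simp add: R_def matrix_works orthogonal_transformation_linear)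
  define B where "B = \<Phi> ** R"
  have nB: "norm B = norm \<Phi>" unfolding B_def by (rule norm_matrix_mult_orthogonal[OF R])
  have dB: "\<bar>det B\<bar> = \<bar>det \<Phi>\<bar>"
    using det_orthogonal_matrix[OF R] by (auto simp: B_def det_mul)
  have "B *v axis 1 1 = \<Phi> *v x" by (simp add: B_def matrix_vector_mul_assoc[symmetric] Rx)
  then have c1: "norm (column 1 B) \<le> lam" using x by (simp add: matrix_vector_mul_component matrix_vector_mult_basis)
  have "\<bar>det B\<bar> \<le> norm (column 1 B) * norm (cross3 (column 2 B) (column 3 B))"
    unfolding det_eq_inner_cross3 by (rule Cauchy_Schwarz_ineq2)
  also have "\<dots> \<le> lam * (norm (column 2 B) * norm (column 3 B))"
    using c1 lam by (intro mult_mono norm_cross3_le) auto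
  also have "norm (column 2 B) * norm (column 3 B) \<le> (norm B)\<^sup>2 / 2"
  proof -
    have "0 \<le> (norm (column 2 B) - norm (column 3 B))\<^sup>2" by simp
    then have "2 * (norm (column 2 B) * norm (column 3 B)) \<le> (norm (column 2 B))\<^sup>2 + (norm (column 3 B))\<^sup>2"
      by (simp add: power2_diff)
    also have "\<dots> \<le> (norm B)\<^sup>2" unfolding norm_matrix_3_columns by simp
    finally show ?thesis by simp
  qed
  finally have "\<bar>det \<Phi>\<bar> \<le> lam * ((norm \<Phi>)\<^sup>2 / 2)" using lam by (simp add: dB nB mult_left_mono)
  then show ?thesis by (simp add: algebra_simps)
qed

text \<open>The index order is free, so the sign of a cofactor is absorbed by swapping columns and
  each entry of \<open>cof\<close> is a single minor.\<close>

definition minor :: "real^3^3 \<Rightarrow> 3 \<Rightarrow> 3 \<Rightarrow> 3 \<Rightarrow> 3 \<Rightarrow> real" where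
  "minor A a j c l = A $ a $ j * A $ c $ l - A $ a $ l * A $ c $ j"

lemma cof_minor: "\<exists>a k c l. \<forall>A. cof A $ i $ j = minor A a k c l"
proof -
  have m: "\<And>A. cof A $ 1 $ 1 = minor A 2 2 3 3" "\<And>A. cof A $ 1 $ 2 = minor A 2 3 3 1" "\<And>A. cof A $ 1 $ 3 = minor A 2 1 3 2"
    "\<And>A. cof A $ 2 $ 1 = minor A 1 3 3 2" "\<And>A. cof A $ 2 $ 2 = minor A 1 1 3 3" "\<And>A. cof A $ 2 $ 3 = minor A 1 2 3 1"
    "\<And>A. cof A $ 3 $ 1 = minor A 1 2 2 3" "\<And>A. cof A $ 3 $ 2 = minor A 1 3 2 1" "\<And>A. cof A $ 3 $ 3 = minor A 1 1 2 2"
    by (simp_all add: cof_3 minor_def)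
  show ?thesis using exhaust_3[of i] exhaust_3[of j] by (elim disjE; simp only: m; blast)
qed

text \<open>The characteristic polynomial, with the sum of principal minors written as
  \<open>trace (cof \<Phi>)\<close>. It isolates the cubic term from the terms that integrate to
  zero.\<close>

lemma det_scaleR_mat_add:
  fixes \<Phi> :: "real^3^3"
  shows "det (lam *\<^sub>R mat 1 + \<Phi>) = lam ^ 3 + lam\<^sup>2 * trace \<Phi> + lam * trace (cof \<Phi>) + det \<Phi>"
proof -
  have e: "(lam *\<^sub>R mat 1 + \<Phi>) $ i $ j = (if i = j then lam else 0) + \<Phi> $ i $ j" for i j
    by (simp add: mat_def)
  show ?thesis
    unfolding det_3 e trace_def sum_3 cof_3 by simp algebra
qed

text \<open>Reduces to the one-variable tangent inequality on the line through \<open>B\<close> and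
  \<open>C\<close>.\<close>

lemma convex_on_above_tangent:
  fixes Z :: "'a::real_normed_vector \<Rightarrow> real"
  assumes conv: "convex_on UNIV Z" and D: "(Z has_derivative D) (at B)"
  shows "Z C \<ge> Z B + D (C - B)"
proof -
  define \<phi> where "\<phi> t = Z (B + t *\<^sub>R (C - B))" for t :: real
  have "convex_on UNIV \<phi>"
    unfolding convex_on_def
  proof (intro conjI ballI allI impI convex_UNIV)
    fix x y u v :: real assume uv: "0 \<le> u" "0 \<le> v" "u + v = 1"
    have v: "v = 1 - u" using uv by simp
    have "B + (u * x + v * y) *\<^sub>R (C - B) = u *\<^sub>R (B + x *\<^sub>R (C - B)) + v *\<^sub>R (B + y *\<^sub>R (C - B))"
      unfolding v by (simp add: algebra_simps)
    then show "\<phi> (u *\<^sub>R x + v *\<^sub>R y) \<le> u * \<phi> x + v * \<phi> y"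
      using conv uv by (simp add: \<phi>_def convex_on_def)
  qed
  moreover have "(\<phi> has_real_derivative D (C - B)) (at 0)"
  proof -
    have "((\<lambda>t::real. B + t *\<^sub>R (C - B)) has_derivative (\<lambda>t. t *\<^sub>R (C - B))) (at 0)"
      by (auto intro!: derivative_eq_intros)
    moreover have "(Z has_derivative D) (at (B + 0 *\<^sub>R (C - B)))" using D by simp
    ultimately have "(\<phi> has_derivative (\<lambda>t. D (t *\<^sub>R (C - B)))) (at 0)"
      unfolding \<phi>_def by (rule has_derivative_compose)
    moreover have "D (t *\<^sub>R (C - B)) = D (C - B) * t" for t
      using has_derivative_linear[OF D] by (simp add: linear_cmul)
    ultimately show ?thesis by (simp add: has_field_derivative_def)
  qed
  ultimately have "\<phi> 1 - \<phi> 0 \<ge> D (C - B) * (1 - 0)"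
    by (intro convex_on_imp_above_tangent[of UNIV]) auto
  then show ?thesis by (simp add: \<phi>_def)
qed


section \<open>Null Lagrangians\<close>

lemma smooth_vec_nth: "smooth v \<Longrightarrow> smooth (\<lambda>x. v x $ a)"
  by (rule smooth_bounded_linear_comp[OF bounded_linear_vec_nth])

lemma frechet_derivative_vec_nth:
  assumes "smooth v"
  shows "frechet_derivative (\<lambda>x. v x $ a) (at x) h = frechet_derivative v (at x) h $ a"
  by (subst frechet_derivative_at[OF bounded_linear.has_derivative[OF bounded_linear_vec_nth smooth_has_derivative[OF assms]], symmetric]) simp

lemma integrable_mult_L2:
  fixes f g :: "'a \<Rightarrow> real"
  assumes f: "f \<in> borel_measurable M" "integrable M (\<lambda>x. (f x)\<^sup>2)"
    and g: "g \<in> borel_measurable M" "integrable M (\<lambda>x. (g x)\<^sup>2)"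
  shows "integrable M (\<lambda>x. f x * g x)"
proof (rule Bochner_Integration.integrable_bound)
  show "integrable M (\<lambda>x. (f x)\<^sup>2 + (g x)\<^sup>2)" using f g by (intro Bochner_Integration.integrable_add)
  show "(\<lambda>x. f x * g x) \<in> borel_measurable M" using f g by (intro borel_measurable_times)
  have "norm (f x * g x) \<le> norm ((f x)\<^sup>2 + (g x)\<^sup>2)" for x
  proof -
    have "0 \<le> (\<bar>f x\<bar> - \<bar>g x\<bar>)\<^sup>2" by simp
    then have "2 * \<bar>f x * g x\<bar> \<le> (f x)\<^sup>2 + (g x)\<^sup>2" by (simp add: power2_diff abs_mult)
    moreover have "0 \<le> \<bar>f x * g x\<bar>" by simp
    ultimately show ?thesis by simp
  qed
  then show "AE x in M. norm (f x * g x) \<le> norm ((f x)\<^sup>2 + (g x)\<^sup>2)" by simp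
qed

lemma continuous_measurable_lebesgue_on:
  fixes f :: "'a::euclidean_space \<Rightarrow> 'b::euclidean_space"
  assumes "continuous_on UNIV f"
  shows "f \<in> borel_measurable (lebesgue_on S)"
proof -
  have "f \<in> borel_measurable lborel" using borel_measurable_continuous_onI[OF assms] by simp
  then show ?thesis by (intro measurable_restrict_space1 measurable_completion)
qed

lemma abs_vec_nth2_le_norm:
  fixes A :: "real^'n^'m"
  shows "\<bar>A $ i $ j\<bar> \<le> norm A"
  using component_le_norm_cart[of "A $ i" j] Finite_Cartesian_Product.norm_nth_le[of A i] by (rule order_trans)

lemma finite_measure_bounded:
  fixes S :: "'a::euclidean_space set"
  assumes "bounded S" "S \<in> sets borel"
  shows "finite_measure (lebesgue_on S)"
proof
  have "emeasure (lebesgue_on S) (space (lebesgue_on S)) = emeasure lebesgue S"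
    using assms by (subst emeasure_restrict_space) auto
  also have "\<dots> = emeasure lborel S" using assms by simp
  also have "\<dots> < \<infinity>" using emeasure_bounded_finite[OF assms(1)] .
  finally show "emeasure (lebesgue_on S) (space (lebesgue_on S)) \<noteq> \<infinity>" by simp
qed

text \<open>\<open>w k\<close> will be the smooth approximations minus the affine map, and
  \<open>\<Phi>\<close> the limit of their gradients. Convergence is stated through q-th powers to
  match \<open>has_trace\<close>; square integrability of \<open>\<Phi>\<close> is what makes
  products of its entries integrable.\<close>

context
  fixes \<Omega> :: "(real^3) set" and w :: "nat \<Rightarrow> real^3 \<Rightarrow> real^3" and \<Phi> :: "real^3 \<Rightarrow> real^3^3" and q :: real
  assumes dom: "bounded_lipschitz_domain \<Omega>" and q: "q \<ge> 2" and w: "\<And>k. smooth (w k)"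
    and \<Phi>m: "\<Phi> \<in> borel_measurable (lebesgue_on \<Omega>)"
    and \<Phi>2: "integrable (lebesgue_on \<Omega>) (\<lambda>x. (norm (\<Phi> x))\<^sup>2)"
    and conv: "(\<lambda>k. \<integral>\<^sup>+x. ennreal (norm (matrix (frechet_derivative (w k) (at x)) - \<Phi> x) powr q) \<partial>lebesgue_on \<Omega>) \<longlonglongrightarrow> 0"
    and bdry: "(\<lambda>k. \<integral>\<^sup>+x\<in>frontier \<Omega>. ennreal (norm (w k x) powr q) \<partial>hausdorff_measure 2) \<longlonglongrightarrow> 0"
begin

private definition P :: "nat \<Rightarrow> 3 \<Rightarrow> 3 \<Rightarrow> real^3 \<Rightarrow> real" where
  "P k a j x = frechet_derivative (\<lambda>y. w k y $ a) (at x) (axis j 1)"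

private lemma bounded_dom: "bounded \<Omega>" and borel_dom: "\<Omega> \<in> sets borel"
  using dom by (auto simp: bounded_lipschitz_domain_def)

private lemma P_smooth: "smooth (P k a j)"
  unfolding P_def by (intro smooth_frechet smooth_vec_nth w)

private lemma P_eq: "P k a j x = matrix (frechet_derivative (w k) (at x)) $ a $ j"
  unfolding P_def frechet_derivative_vec_nth[OF w] by (simp add: matrix_def)

private lemma P_measurable: "P k a j \<in> borel_measurable (lebesgue_on \<Omega>)"
  by (intro continuous_measurable_lebesgue_on smooth_continuous P_smooth)

private lemma P_L2: "integrable (lebesgue_on \<Omega>) (\<lambda>x. (P k a j x)\<^sup>2)"
  by (intro continuous_integrable_lebesgue_on continuous_intros smooth_continuous P_smooth bounded_dom borel_dom)

private lemma \<Phi>_measurable: "(\<lambda>x. \<Phi> x $ a $ j) \<in> borel_measurable (lebesgue_on \<Omega>)"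
  by (rule measurable_compose[OF \<Phi>m borel_measurable_continuous_onI[OF linear_continuous_on[OF bounded_linear_vec_nth2]]])

private lemma \<Phi>_L2: "integrable (lebesgue_on \<Omega>) (\<lambda>x. (\<Phi> x $ a $ j)\<^sup>2)"
proof (rule Bochner_Integration.integrable_bound[OF \<Phi>2])
  show "(\<lambda>x. (\<Phi> x $ a $ j)\<^sup>2) \<in> borel_measurable (lebesgue_on \<Omega>)" by (intro borel_measurable_power \<Phi>_measurable)
  have "(\<Phi> x $ a $ j)\<^sup>2 \<le> (norm (\<Phi> x))\<^sup>2" for x
    using power_mono[OF abs_vec_nth2_le_norm[of "\<Phi> x" a j], of 2] by simp
  then show "AE x in lebesgue_on \<Omega>. norm ((\<Phi> x $ a $ j)\<^sup>2) \<le> norm ((norm (\<Phi> x))\<^sup>2)" by simp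
qed

text \<open>Weak convergence in L^2 of each entry is the form needed for products: one factor
  converges while the other is held fixed.\<close>

private lemma P_tendsto:
  assumes g: "g \<in> borel_measurable (lebesgue_on \<Omega>)" "integrable (lebesgue_on \<Omega>) (\<lambda>x. (g x)\<^sup>2)"
  shows "(\<lambda>k. \<integral>x. P k a j x * g x \<partial>lebesgue_on \<Omega>) \<longlonglongrightarrow> (\<integral>x. \<Phi> x $ a $ j * g x \<partial>lebesgue_on \<Omega>)"
proof -
  let ?e = "\<lambda>k x. P k a j x - \<Phi> x $ a $ j"
  have Pg: "integrable (lebesgue_on \<Omega>) (\<lambda>x. P k a j x * g x)" for k
    by (intro integrable_mult_L2 P_measurable P_L2 g)
  have \<Phi>g: "integrable (lebesgue_on \<Omega>) (\<lambda>x. \<Phi> x $ a $ j * g x)"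
    by (intro integrable_mult_L2 \<Phi>_measurable \<Phi>_L2 g)
  have eq: "(\<lambda>x. ?e k x * g x) = (\<lambda>x. P k a j x * g x - \<Phi> x $ a $ j * g x)" for k
    by (simp add: algebra_simps)
  have "(\<lambda>k. \<integral>x. ?e k x * g x \<partial>lebesgue_on \<Omega>) \<longlonglongrightarrow> 0"
  proof (rule tendsto_integral_mult_Lq[OF finite_measure_bounded[OF bounded_dom borel_dom] q _ _ g])
    show "?e k \<in> borel_measurable (lebesgue_on \<Omega>)" for k by (intro borel_measurable_diff P_measurable \<Phi>_measurable)
    show "integrable (lebesgue_on \<Omega>) (\<lambda>x. ?e k x * g x)" for k
      unfolding eq by (intro Bochner_Integration.integrable_diff Pg \<Phi>g)
    have "(\<integral>\<^sup>+x. ennreal (\<bar>?e k x\<bar> powr q) \<partial>lebesgue_on \<Omega>)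
        \<le> (\<integral>\<^sup>+x. ennreal (norm (matrix (frechet_derivative (w k) (at x)) - \<Phi> x) powr q) \<partial>lebesgue_on \<Omega>)" for k
    proof (intro nn_integral_mono ennreal_leI powr_mono2)
      show "\<bar>?e k x\<bar> \<le> norm (matrix (frechet_derivative (w k) (at x)) - \<Phi> x)" for x
        using abs_vec_nth2_le_norm[of "matrix (frechet_derivative (w k) (at x)) - \<Phi> x" a j] by (simp add: P_eq)
    qed (use q in auto)
    then show "(\<lambda>k. \<integral>\<^sup>+x. ennreal (\<bar>?e k x\<bar> powr q) \<partial>lebesgue_on \<Omega>) \<longlonglongrightarrow> 0"
      by (intro tendsto_sandwich[OF _ _ tendsto_const conv]) (auto intro!: always_eventually)
  qed
  then have "(\<lambda>k. (\<integral>x. P k a j x * g x \<partial>lebesgue_on \<Omega>) - (\<integral>x. \<Phi> x $ a $ j * g x \<partial>lebesgue_on \<Omega>)) \<longlonglongrightarrow> 0"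
    unfolding eq Bochner_Integration.integral_diff[OF Pg \<Phi>g] .
  then show ?thesis by (rule LIM_zero_cancel)
qed

text \<open>The factor \<open>g\<close> is bounded on the compact frontier, so
  \<open>w k $ a * g\<close> inherits vanishing boundary values in the q-th power sense.\<close>

private lemma flux_mult_tendsto_0:
  assumes g: "smooth g"
  shows "(\<lambda>k. \<integral>x. frechet_derivative (\<lambda>y. w k y $ a * g y) (at x) v \<partial>lebesgue_on \<Omega>) \<longlonglongrightarrow> 0"
proof (rule flux_tendsto_0[OF dom])
  show "smooth (\<lambda>y. w k y $ a * g y)" for k by (intro smooth_mult smooth_vec_nth w g)
  show "q \<ge> 1" using q by simp
  have "compact (frontier \<Omega>)" using bounded_dom by (rule compact_frontier_bounded)
  then obtain B where B: "\<And>x. x \<in> frontier \<Omega> \<Longrightarrow> norm (g x) \<le> B"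
    using compact_imp_bounded[OF compact_continuous_image[OF smooth_continuous[OF g]], of "frontier \<Omega>"]
    by (auto simp: bounded_iff)
  let ?N = "\<lambda>k. \<integral>\<^sup>+x\<in>frontier \<Omega>. ennreal (norm (w k x) powr q) \<partial>hausdorff_measure 2"
  have le: "boundary_Lq q \<Omega> (\<lambda>y. w k y $ a * g y) \<le> ennreal (\<bar>B\<bar> powr q) * ?N k" for k
  proof -
    have [measurable]: "frontier \<Omega> \<in> sets borel" by (intro borel_closed frontier_closed)
    have [measurable]: "w k \<in> borel_measurable borel"
      by (intro borel_measurable_continuous_onI smooth_continuous w)
    have "boundary_Lq q \<Omega> (\<lambda>y. w k y $ a * g y)
        \<le> (\<integral>\<^sup>+x. ennreal (\<bar>B\<bar> powr q) * (ennreal (norm (w k x) powr q) * indicator (frontier \<Omega>) x) \<partial>hausdorff_measure 2)"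
    proof (intro nn_integral_mono)
      fix x
      show "ennreal (\<bar>w k x $ a * g x\<bar> powr q) * indicator (frontier \<Omega>) x
          \<le> ennreal (\<bar>B\<bar> powr q) * (ennreal (norm (w k x) powr q) * indicator (frontier \<Omega>) x)"
      proof (cases "x \<in> frontier \<Omega>")
        case True
        have "\<bar>w k x $ a * g x\<bar> \<le> norm (w k x) * \<bar>B\<bar>"
          unfolding abs_mult using B[OF True] by (intro mult_mono component_le_norm_cart) auto
        then have "\<bar>w k x $ a * g x\<bar> powr q \<le> (norm (w k x) * \<bar>B\<bar>) powr q" using q by (intro powr_mono2) auto
        also have "\<dots> = \<bar>B\<bar> powr q * norm (w k x) powr q" by (simp add: powr_mult)
        finally show ?thesis using True by (simp add: ennreal_mult[symmetric] ennreal_leI)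
      qed simp
    qed
    also have "\<dots> = ennreal (\<bar>B\<bar> powr q) * ?N k" by (intro nn_integral_cmult) measurable
    finally show ?thesis .
  qed
  have lim: "(\<lambda>k. ennreal (\<bar>B\<bar> powr q) * ?N k) \<longlonglongrightarrow> 0"
    using ennreal_tendsto_cmult[OF _ bdry, of "ennreal (\<bar>B\<bar> powr q)"] by simp
  show "(\<lambda>k. boundary_Lq q \<Omega> (\<lambda>y. w k y $ a * g y)) \<longlonglongrightarrow> 0"
    by (rule tendsto_sandwich[OF _ _ tendsto_const lim]) (simp, rule always_eventually, rule allI, rule le)
qed

lemma weak_limit_entry_integral:
  "integrable (lebesgue_on \<Omega>) (\<lambda>x. \<Phi> x $ a $ j)" "(\<integral>x. \<Phi> x $ a $ j \<partial>lebesgue_on \<Omega>) = 0"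
proof -
  have 1: "(\<lambda>x. 1::real) \<in> borel_measurable (lebesgue_on \<Omega>)" "integrable (lebesgue_on \<Omega>) (\<lambda>x. (1::real)\<^sup>2)"
    by (simp, intro continuous_integrable_lebesgue_on continuous_intros bounded_dom borel_dom)
  show "integrable (lebesgue_on \<Omega>) (\<lambda>x. \<Phi> x $ a $ j)"
    using integrable_mult_L2[OF \<Phi>_measurable \<Phi>_L2 1, of a j] by simp
  have "(\<lambda>k. \<integral>x. P k a j x \<partial>lebesgue_on \<Omega>) \<longlonglongrightarrow> 0"
    using flux_mult_tendsto_0[OF smooth_const[of 1], of a "axis j 1"] by (simp add: P_def)
  moreover have "(\<lambda>k. \<integral>x. P k a j x \<partial>lebesgue_on \<Omega>) \<longlonglongrightarrow> (\<integral>x. \<Phi> x $ a $ j \<partial>lebesgue_on \<Omega>)" using P_tendsto[OF 1, of a j] by simp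
  ultimately show "(\<integral>x. \<Phi> x $ a $ j \<partial>lebesgue_on \<Omega>) = 0" by (rule LIMSEQ_unique[symmetric])
qed

text \<open>With \<open>m\<close> fixed, \<open>P m c l\<close> is a smooth multiplier for
  \<open>w k\<close>. In the difference of the two fluxes the second derivatives of
  \<open>w m\<close> cancel by symmetry, leaving the mixed minor; then only the factor with index
  \<open>k\<close> passes to the limit. Replacing \<open>P m\<close> by \<open>\<Phi>\<close> is a
  separate limit.\<close>

private lemma weak_limit_minor_step:
  "(\<integral>x. \<Phi> x $ a $ j * P m c l x \<partial>lebesgue_on \<Omega>) = (\<integral>x. \<Phi> x $ a $ l * P m c j x \<partial>lebesgue_on \<Omega>)"
proof -
  have int: "integrable (lebesgue_on \<Omega>) (\<lambda>x. P k a j x * P m c l x)" for k a j c l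
    by (intro integrable_mult_L2 P_measurable P_L2)
  let ?D = "\<lambda>k j l x. frechet_derivative (\<lambda>y. w k y $ a * P m c l y) (at x) (axis j 1)"
  have D: "?D k j l x = w k x $ a * frechet_derivative (P m c l) (at x) (axis j 1) + P k a j x * P m c l x" for k j l x
    unfolding P_def[of k]
    by (subst frechet_derivative_at[OF has_derivative_mult[OF smooth_has_derivative[OF smooth_vec_nth[OF w]]
          smooth_has_derivative[OF P_smooth]], symmetric]) simp
  have comm: "frechet_derivative (P m c l) (at x) (axis j 1) = frechet_derivative (P m c j) (at x) (axis l 1)" for x
    unfolding P_def[abs_def] by (rule smooth_derivative_commute[OF smooth_vec_nth[OF w]])
  have Di: "integrable (lebesgue_on \<Omega>) (?D k j l)" for k j l
    by (intro continuous_integrable_lebesgue_on smooth_continuous smooth_frechet smooth_mult smooth_vec_nth w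
        P_smooth bounded_dom borel_dom)
  have "(\<integral>x. P k a j x * P m c l x \<partial>lebesgue_on \<Omega>) - (\<integral>x. P k a l x * P m c j x \<partial>lebesgue_on \<Omega>) = (\<integral>x. ?D k j l x \<partial>lebesgue_on \<Omega>) - (\<integral>x. ?D k l j x \<partial>lebesgue_on \<Omega>)" for k
  proof -
    have "(\<integral>x. P k a j x * P m c l x \<partial>lebesgue_on \<Omega>) - (\<integral>x. P k a l x * P m c j x \<partial>lebesgue_on \<Omega>) = (\<integral>x. P k a j x * P m c l x - P k a l x * P m c j x \<partial>lebesgue_on \<Omega>)"
      by (intro Bochner_Integration.integral_diff[symmetric] int)
    also have "\<dots> = (\<integral>x. ?D k j l x - ?D k l j x \<partial>lebesgue_on \<Omega>)" unfolding D comm by simp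
    also have "\<dots> = (\<integral>x. ?D k j l x \<partial>lebesgue_on \<Omega>) - (\<integral>x. ?D k l j x \<partial>lebesgue_on \<Omega>)"
      by (intro Bochner_Integration.integral_diff Di)
    finally show ?thesis .
  qed
  moreover have "(\<lambda>k. (\<integral>x. ?D k j l x \<partial>lebesgue_on \<Omega>) - (\<integral>x. ?D k l j x \<partial>lebesgue_on \<Omega>)) \<longlonglongrightarrow> 0 - 0"
    by (intro tendsto_diff flux_mult_tendsto_0 P_smooth)
  ultimately have "(\<lambda>k. (\<integral>x. P k a j x * P m c l x \<partial>lebesgue_on \<Omega>) - (\<integral>x. P k a l x * P m c j x \<partial>lebesgue_on \<Omega>)) \<longlonglongrightarrow> 0" by simp
  moreover have "(\<lambda>k. (\<integral>x. P k a j x * P m c l x \<partial>lebesgue_on \<Omega>) - (\<integral>x. P k a l x * P m c j x \<partial>lebesgue_on \<Omega>))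
      \<longlonglongrightarrow> (\<integral>x. \<Phi> x $ a $ j * P m c l x \<partial>lebesgue_on \<Omega>) - (\<integral>x. \<Phi> x $ a $ l * P m c j x \<partial>lebesgue_on \<Omega>)"
    by (intro tendsto_diff P_tendsto P_measurable P_L2)
  ultimately have "(\<integral>x. \<Phi> x $ a $ j * P m c l x \<partial>lebesgue_on \<Omega>) - (\<integral>x. \<Phi> x $ a $ l * P m c j x \<partial>lebesgue_on \<Omega>) = 0"
    by (rule LIMSEQ_unique[symmetric])
  then show ?thesis by simp
qed

lemma weak_limit_minor_integral:
  "integrable (lebesgue_on \<Omega>) (\<lambda>x. minor (\<Phi> x) a j c l)" "(\<integral>x. minor (\<Phi> x) a j c l \<partial>lebesgue_on \<Omega>) = 0"
proof -
  have int: "integrable (lebesgue_on \<Omega>) (\<lambda>x. \<Phi> x $ a $ j * \<Phi> x $ c $ l)" for a j c l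
    by (intro integrable_mult_L2 \<Phi>_measurable \<Phi>_L2)
  show "integrable (lebesgue_on \<Omega>) (\<lambda>x. minor (\<Phi> x) a j c l)"
    unfolding minor_def by (intro Bochner_Integration.integrable_diff int)
  have lim: "(\<lambda>m. \<integral>x. \<Phi> x $ a $ j * P m c l x \<partial>lebesgue_on \<Omega>) \<longlonglongrightarrow> (\<integral>x. \<Phi> x $ a $ j * \<Phi> x $ c $ l \<partial>lebesgue_on \<Omega>)" for a j c l
    using P_tendsto[OF \<Phi>_measurable \<Phi>_L2, of c l a j] by (simp add: mult.commute)
  have "(\<integral>x. \<Phi> x $ a $ j * \<Phi> x $ c $ l \<partial>lebesgue_on \<Omega>) = (\<integral>x. \<Phi> x $ a $ l * \<Phi> x $ c $ j \<partial>lebesgue_on \<Omega>)"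
    using lim[of a j c l] lim[of a l c j] unfolding weak_limit_minor_step[of a j _ c l] by (rule LIMSEQ_unique)
  then show "(\<integral>x. minor (\<Phi> x) a j c l \<partial>lebesgue_on \<Omega>) = 0"
    unfolding minor_def by (subst Bochner_Integration.integral_diff[OF int int]) simp
qed

end


section \<open>Energy comparison\<close>

text \<open>Expansion in matrix units turns entrywise statements into a matrix-valued integral, to
  which arbitrary linear maps such as \<open>DZ\<close> or \<open>trace\<close> can be
  applied.\<close>

lemma has_bochner_integral_matrix_0:
  fixes X :: "'a \<Rightarrow> real^'n^'m"
  assumes "\<And>i j. integrable M (\<lambda>x. X x $ i $ j)" "\<And>i j. (\<integral>x. X x $ i $ j \<partial>M) = 0"
  shows "has_bochner_integral M X 0"
proof -
  have eq: "X = (\<lambda>x. \<Sum>i\<in>UNIV. \<Sum>j\<in>UNIV. (X x $ i $ j) *\<^sub>R axis i (axis j 1))"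
  proof
    fix x
    have "X x $ i $ j = (\<Sum>k\<in>UNIV. \<Sum>l\<in>UNIV. (X x $ k $ l) *\<^sub>R axis k (axis l 1)) $ i $ j" for i j
    proof -
      have "(\<Sum>k\<in>UNIV. \<Sum>l\<in>UNIV. (X x $ k $ l) *\<^sub>R axis k (axis l 1)) $ i $ j
          = (\<Sum>k\<in>UNIV. \<Sum>l\<in>UNIV. X x $ k $ l * ((axis k (axis l 1) :: real^'n^'m) $ i $ j))" by simp
      also have "\<dots> = (\<Sum>k\<in>UNIV. \<Sum>l\<in>UNIV. if k = i then (if l = j then X x $ k $ l else 0) else 0)"
        by (intro sum.cong refl) (auto simp: axis_def)
      also have "\<dots> = (\<Sum>k\<in>UNIV. if k = i then (\<Sum>l\<in>UNIV. if l = j then X x $ k $ l else 0) else 0)"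
        by (intro sum.cong refl) auto
      also have "\<dots> = X x $ i $ j" by simp
      finally show ?thesis by simp
    qed
    then show "X x = (\<Sum>i\<in>UNIV. \<Sum>j\<in>UNIV. (X x $ i $ j) *\<^sub>R axis i (axis j 1))"
      unfolding vec_eq_iff by blast
  qed
  have "has_bochner_integral M (\<lambda>x. X x $ i $ j) 0" for i j
    using assms[of i j] by (simp add: has_bochner_integral_iff)
  then have "has_bochner_integral M (\<lambda>x. \<Sum>i\<in>UNIV. \<Sum>j\<in>UNIV. (X x $ i $ j) *\<^sub>R axis i (axis j 1))
      (\<Sum>i\<in>UNIV. \<Sum>j\<in>UNIV. 0 *\<^sub>R axis i (axis j (1::real)))"
    by (intro has_bochner_integral_sum has_bochner_integral_scaleR_left)
  then show ?thesis unfolding eq[symmetric] by simp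
qed

lemma minor_add_diff:
  "minor (A + \<Phi>) a j c l - minor A a j c l
    = A $ a $ j * \<Phi> $ c $ l + A $ c $ l * \<Phi> $ a $ j - A $ a $ l * \<Phi> $ c $ j - A $ c $ j * \<Phi> $ a $ l + minor \<Phi> a j c l"
  by (simp add: minor_def algebra_simps)

text \<open>The linearised energy may be negative at some points. Conversion to
  \<open>ennreal\<close> then replaces it by 0, which can only increase the integral.\<close>

lemma ennreal_integral_le_nn_integral:
  fixes f :: "'a \<Rightarrow> real"
  assumes "integrable M f"
  shows "ennreal (\<integral>x. f x \<partial>M) \<le> (\<integral>\<^sup>+x. ennreal (f x) \<partial>M)"
proof -
  have m: "integrable M (\<lambda>x. max 0 (f x))" using assms by (intro integrable_max) auto
  have "ennreal (\<integral>x. f x \<partial>M) \<le> ennreal (\<integral>x. max 0 (f x) \<partial>M)"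
    by (intro ennreal_leI integral_mono assms m) auto
  also have "\<dots> = (\<integral>\<^sup>+x. ennreal (max 0 (f x)) \<partial>M)"
    by (intro nn_integral_eq_integral[symmetric] m) auto
  also have "\<dots> = (\<integral>\<^sup>+x. ennreal (f x) \<partial>M)" by (intro nn_integral_cong) (auto simp: max_def ennreal_neg)
  finally show ?thesis .
qed

text \<open>Convex terms are replaced by their tangents at \<open>A\<close>, but the quadratic term
  is expanded exactly, so that \<open>\<gamma> * (norm \<Phi>)\<^sup>2\<close> remains available.
  Condition \<open>\<gamma> \<ge> lam * h' / 2\<close> is precisely what lets it absorb
  \<open>h' * det \<Phi>\<close>. The inner bracket collects the terms that will integrate to
  zero.\<close>

lemma stored_energy_lower_bound:
  fixes Z :: "real^3^3 \<Rightarrow> real" and h :: "real \<Rightarrow> ennreal" and F :: "real^3^3"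
  assumes \<gamma>: "\<gamma> > 0" and Z: "\<And>A. Z A \<ge> 0" "convex_on UNIV Z" and DZ: "(Z has_derivative DZ) (at (cof (lam *\<^sub>R mat 1)))"
    and h_finite: "\<And>t. t > 0 \<Longrightarrow> h t \<noteq> \<infinity>"
    and h_convex: "convex_on {0<..} (\<lambda>t. enn2real (h t))"
    and h': "((\<lambda>t. enn2real (h t)) has_real_derivative h') (at (lam ^ 3))" and h'_pos: "h' > 0"
    and \<kappa>: "\<kappa> \<ge> 0" and kappa: "\<And>A F :: real^3^3.
      norm F powr q \<ge> norm A powr q + q * norm A powr (q - 2) * (A \<bullet> (F - A)) + \<kappa> * norm (F - A) powr q"
    and lam: "lam > 0" and cond: "\<gamma> \<ge> lam * h' / 2" and F: "det F > 0"
  defines "A \<equiv> lam *\<^sub>R mat 1 :: real^3^3"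
  shows "ennreal (norm A powr q + \<gamma> * (norm A)\<^sup>2 + Z (cof A) + enn2real (h (lam ^ 3))
      + ((q * norm A powr (q - 2) + 2 * \<gamma>) * (A \<bullet> (F - A)) + DZ (cof F - cof A)
          + h' * (lam\<^sup>2 * trace (F - A) + lam * trace (cof (F - A))))) \<le> stored_energy q \<gamma> Z h F"
proof -
  define \<Phi> where "\<Phi> = F - A"
  have FA: "F = A + \<Phi>" by (simp add: \<Phi>_def)
  have 1: "norm F powr q \<ge> norm A powr q + q * norm A powr (q - 2) * (A \<bullet> \<Phi>)"
  proof -
    have "\<kappa> * norm (F - A) powr q \<ge> 0" using \<kappa> by simp
    then show ?thesis using kappa[of A F] by (simp add: \<Phi>_def)
  qed
  have "(norm F)\<^sup>2 = (norm A)\<^sup>2 + 2 * (A \<bullet> \<Phi>) + (norm \<Phi>)\<^sup>2"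
    unfolding FA power2_norm_eq_inner by (simp add: inner_add_left inner_add_right inner_commute)
  then have 2: "\<gamma> * (norm F)\<^sup>2 = \<gamma> * (norm A)\<^sup>2 + 2 * \<gamma> * (A \<bullet> \<Phi>) + \<gamma> * (norm \<Phi>)\<^sup>2" by (simp add: algebra_simps)
  have 3: "Z (cof F) \<ge> Z (cof A) + DZ (cof F - cof A)"
    unfolding A_def by (rule convex_on_above_tangent[OF Z(2) DZ])
  have 4: "enn2real (h (det F)) - enn2real (h (lam ^ 3)) \<ge> h' * (det F - lam ^ 3)"
    using lam F by (intro convex_on_imp_above_tangent[OF h_convex _ _ _ has_field_derivative_at_within[OF h']])
      (auto simp: interior_open)
  have 5: "det F - lam ^ 3 = lam\<^sup>2 * trace \<Phi> + lam * trace (cof \<Phi>) + det \<Phi>"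
    unfolding FA A_def det_scaleR_mat_add by simp
  have 6: "h' * det \<Phi> + \<gamma> * (norm \<Phi>)\<^sup>2 \<ge> 0"
  proof -
    have "det \<Phi> \<ge> - (lam / 2) * (norm \<Phi>)\<^sup>2"
      using det_ge_neg_norm_square[of lam \<Phi>] F lam by (simp add: FA A_def)
    then have "h' * det \<Phi> \<ge> h' * (- (lam / 2) * (norm \<Phi>)\<^sup>2)" using h'_pos by (intro mult_left_mono) auto
    moreover have "lam * h' / 2 * (norm \<Phi>)\<^sup>2 \<le> \<gamma> * (norm \<Phi>)\<^sup>2" using cond by (intro mult_right_mono) auto
    ultimately show ?thesis by (simp add: algebra_simps)
  qed
  have "norm A powr q + \<gamma> * (norm A)\<^sup>2 + Z (cof A) + enn2real (h (lam ^ 3))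
      + ((q * norm A powr (q - 2) + 2 * \<gamma>) * (A \<bullet> \<Phi>) + DZ (cof F - cof A) + h' * (lam\<^sup>2 * trace \<Phi> + lam * trace (cof \<Phi>)))
      \<le> (norm F powr q + \<gamma> * (norm F)\<^sup>2 + Z (cof F)) + enn2real (h (det F))"
    using 1 2 3 4 6 unfolding 5 by (simp add: algebra_simps)
  then have "ennreal (norm A powr q + \<gamma> * (norm A)\<^sup>2 + Z (cof A) + enn2real (h (lam ^ 3))
      + ((q * norm A powr (q - 2) + 2 * \<gamma>) * (A \<bullet> \<Phi>) + DZ (cof F - cof A) + h' * (lam\<^sup>2 * trace \<Phi> + lam * trace (cof \<Phi>))))
      \<le> ennreal ((norm F powr q + \<gamma> * (norm F)\<^sup>2 + Z (cof F)) + enn2real (h (det F)))"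
    by (rule ennreal_leI)
  also have "\<dots> = ennreal (norm F powr q + \<gamma> * (norm F)\<^sup>2 + Z (cof F)) + ennreal (enn2real (h (det F)))"
    using \<gamma> Z by (intro ennreal_plus) auto
  also have "ennreal (enn2real (h (det F))) = h (det F)"
    using h_finite[OF F] by (simp add: less_top)
  finally show ?thesis by (simp add: stored_energy_def \<Phi>_def)
qed

text \<open>Subtracting the affine map from the sequence that defines the trace yields a sequence
  whose boundary values tend to zero and whose gradients converge to \<open>\<Phi>\<close>.\<close>

lemma sobolev_trace_minor_integrals:
  fixes u :: "real^3 \<Rightarrow> real^3"
  assumes dom: "bounded_lipschitz_domain \<Omega>" and q: "q \<ge> 2"
    and u: "u \<in> W1q q \<Omega>" and tr: "has_trace q \<Omega> u (\<lambda>x. lam *\<^sub>R x)"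
  defines "\<Phi> \<equiv> \<lambda>x. weak_gradient \<Omega> u x - lam *\<^sub>R mat 1"
  shows "integrable (lebesgue_on \<Omega>) (\<lambda>x. \<Phi> x $ a $ j)" "(\<integral>x. \<Phi> x $ a $ j \<partial>lebesgue_on \<Omega>) = 0"
    "integrable (lebesgue_on \<Omega>) (\<lambda>x. minor (\<Phi> x) a j c l)" "(\<integral>x. minor (\<Phi> x) a j c l \<partial>lebesgue_on \<Omega>) = 0"
proof -
  let ?M = "lebesgue_on \<Omega>" and ?A = "lam *\<^sub>R mat 1 :: real^3^3"
  have bd: "bounded \<Omega>" "\<Omega> \<in> sets borel" using dom by (auto simp: bounded_lipschitz_domain_def)
  interpret finite_measure ?M by (rule finite_measure_bounded[OF bd])
  obtain v where v: "\<And>k. smooth (v k)"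
    and conv: "(\<lambda>k. \<integral>\<^sup>+x. ennreal (norm (matrix (frechet_derivative (v k) (at x)) - weak_gradient \<Omega> u x) powr q) \<partial>?M) \<longlonglongrightarrow> 0"
    and bdry: "(\<lambda>k. \<integral>\<^sup>+x\<in>frontier \<Omega>. ennreal (norm (v k x - lam *\<^sub>R x) powr q) \<partial>hausdorff_measure 2) \<longlonglongrightarrow> 0"
    using tr unfolding has_trace_def by blast
  have Gm: "weak_gradient \<Omega> u \<in> borel_measurable ?M" and Gq: "integrable ?M (\<lambda>x. norm (weak_gradient \<Omega> u x) powr q)"
    using u by (auto simp: W1q_def Lq_def)
  define w where "w k x = v k x - lam *\<^sub>R x" for k x
  have lin: "bounded_linear (\<lambda>x::real^3. lam *\<^sub>R x)" by (rule bounded_linear_scaleR_right)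
  have ws: "smooth (w k)" for k unfolding w_def by (intro smooth_diff v smooth_bounded_linear lin)
  have wd: "matrix (frechet_derivative (w k) (at x)) - \<Phi> x = matrix (frechet_derivative (v k) (at x)) - weak_gradient \<Omega> u x" for k x
  proof -
    have "(w k has_derivative (\<lambda>h. frechet_derivative (v k) (at x) h - lam *\<^sub>R h)) (at x)"
      unfolding w_def by (intro has_derivative_diff smooth_has_derivative v bounded_linear_imp_has_derivative lin)
    then have "frechet_derivative (w k) (at x) = (\<lambda>h. frechet_derivative (v k) (at x) h - lam *\<^sub>R h)"
      by (rule frechet_derivative_at[symmetric])
    then have "matrix (frechet_derivative (w k) (at x)) = matrix (frechet_derivative (v k) (at x)) - ?A"
      by (auto simp: matrix_def vec_eq_iff mat_def axis_def)
    then show ?thesis by (simp add: \<Phi>_def)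
  qed
  have \<Phi>m: "\<Phi> \<in> borel_measurable ?M" unfolding \<Phi>_def by (intro borel_measurable_diff Gm borel_measurable_const)
  \<comment> \<open>Since \<open>q \<ge> 2\<close>, squares are dominated through
    \<open>t^2 \<le> 1 + t^q\<close>; the constants are integrable because the domain has finite
    measure.\<close>
  have \<Phi>2: "integrable ?M (\<lambda>x. (norm (\<Phi> x))\<^sup>2)"
  proof (rule Bochner_Integration.integrable_bound)
    show "integrable ?M (\<lambda>x. 2 * (1 + norm (weak_gradient \<Omega> u x) powr q) + 2 * (norm ?A)\<^sup>2)"
      using Gq by auto
    show "(\<lambda>x. (norm (\<Phi> x))\<^sup>2) \<in> borel_measurable ?M" using \<Phi>m by measurable
    have "(norm (\<Phi> x))\<^sup>2 \<le> 2 * (1 + norm (weak_gradient \<Omega> u x) powr q) + 2 * (norm ?A)\<^sup>2" for x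
    proof -
      let ?g = "norm (weak_gradient \<Omega> u x)"
      have "(norm (\<Phi> x))\<^sup>2 \<le> (?g + norm ?A)\<^sup>2" unfolding \<Phi>_def by (intro power_mono norm_triangle_ineq4) auto
      also have "\<dots> \<le> 2 * ?g\<^sup>2 + 2 * (norm ?A)\<^sup>2"
        using zero_le_power2[of "?g - norm ?A"] by (simp add: power2_sum power2_diff)
      also have "?g\<^sup>2 \<le> 1 + ?g powr q"
      proof (cases "?g \<le> 1")
        case True
        then have "?g\<^sup>2 \<le> 1" by (simp add: power_le_one)
        then show ?thesis by (simp add: add_increasing2)
      next
        case False
        then have "?g powr 2 \<le> ?g powr q" using q by (intro powr_mono) auto
        then show ?thesis by simp
      qed
      finally show ?thesis by simp
    qed
    then show "AE x in ?M. norm ((norm (\<Phi> x))\<^sup>2) \<le> norm (2 * (1 + norm (weak_gradient \<Omega> u x) powr q) + 2 * (norm ?A)\<^sup>2)"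
      by (intro AE_I2) (simp add: order_trans[OF _ abs_ge_self])
  qed
  have conv': "(\<lambda>k. \<integral>\<^sup>+x. ennreal (norm (matrix (frechet_derivative (w k) (at x)) - \<Phi> x) powr q) \<partial>?M) \<longlonglongrightarrow> 0"
    unfolding wd by (rule conv)
  have bdry': "(\<lambda>k. \<integral>\<^sup>+x\<in>frontier \<Omega>. ennreal (norm (w k x) powr q) \<partial>hausdorff_measure 2) \<longlonglongrightarrow> 0"
    unfolding w_def by (rule bdry)
  note facts = dom q ws \<Phi>m \<Phi>2 conv' bdry'
  show "integrable ?M (\<lambda>x. \<Phi> x $ a $ j)" "(\<integral>x. \<Phi> x $ a $ j \<partial>?M) = 0"
    "integrable ?M (\<lambda>x. minor (\<Phi> x) a j c l)" "(\<integral>x. minor (\<Phi> x) a j c l \<partial>?M) = 0"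
    by (rule weak_limit_entry_integral[OF facts] weak_limit_minor_integral[OF facts])+
qed


theorem theorem3p4:
  fixes \<Omega> :: "(real^3) set" and q \<gamma> \<kappa> lam :: real
    and Z :: "real^3^3 \<Rightarrow> real" and h :: "real \<Rightarrow> ennreal" and h' :: real
    and u :: "real^3 \<Rightarrow> real^3"
  assumes Omega: "bounded_lipschitz_domain \<Omega>"
    and q: "2 < q" "q < 3"
    and gamma: "\<gamma> > 0"
    and Z: "\<And>A. Z A \<ge> 0" "convex_on UNIV Z" "Ck 1 Z"
    and h_finite: "\<And>t. t > 0 \<Longrightarrow> h t \<noteq> \<infinity>"
    and h_convex: "convex_on {0<..} (\<lambda>t. enn2real (h t))"
    and h_C1: "(\<lambda>t. enn2real (h t)) C1_differentiable_on {0<..}"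
    and h_0: "(h \<longlongrightarrow> \<infinity>) (at_right 0)"
    and h_growth: "Liminf at_top (\<lambda>t. h t / ennreal t) > 0"
    and h_nonpos: "\<And>t. t \<le> 0 \<Longrightarrow> h t = \<infinity>"
    and kappa_bounds: "2 powr (2 - q) \<le> \<kappa>" "\<kappa> \<le> q * 2 powr (1 - q)"
    and kappa: "\<And>A F :: real^3^3.
      norm F powr q \<ge> norm A powr q + q * norm A powr (q - 2) * (A \<bullet> (F - A)) + \<kappa> * norm (F - A) powr q"
    and lambda: "lam > 0"
    and h'_def: "h' = deriv (\<lambda>t. enn2real (h t)) (lam ^ 3)"
    and h'_pos: "h' > 0"
    and cond1: "\<kappa> / (h' * lam powr (3 - q)) \<ge> (q - 2) powr ((q - 2) / 2) * q powr (- q / 2)"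
    and cond2: "\<gamma> / (lam * h') \<ge> 1 / 2"
    and u: "u \<in> admissible q \<Omega> lam"
  shows "energy \<Omega> (stored_energy q \<gamma> Z h) u \<ge> energy \<Omega> (stored_energy q \<gamma> Z h) (\<lambda>x. lam *\<^sub>R x)"
proof -
  let ?M = "lebesgue_on \<Omega>" and ?W = "stored_energy q \<gamma> Z h"
  define A where "A = (lam *\<^sub>R mat 1 :: real^3^3)"
  define G where "G = weak_gradient \<Omega> u"
  define \<Phi> where "\<Phi> x = G x - A" for x
  have op: "open \<Omega>" and bd: "bounded \<Omega>" "\<Omega> \<in> sets borel"
    using Omega by (auto simp: bounded_lipschitz_domain_def)
  interpret finite_measure ?M by (rule finite_measure_bounded[OF bd])
  have uW: "u \<in> W1q q \<Omega>" and tr: "has_trace q \<Omega> u (\<lambda>x. lam *\<^sub>R x)"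
    and det_pos: "AE x in ?M. det (G x) > 0"
    using u by (auto simp: admissible_def G_def)
  have q2: "q \<ge> 2" using q by simp
  note ints = sobolev_trace_minor_integrals[OF Omega q2 uW tr, folded G_def A_def, folded \<Phi>_def]
  define DZ where "DZ = frechet_derivative Z (at (cof A))"
  have DZ: "(Z has_derivative DZ) (at (cof A))"
    using Ck_Suc_has_derivative[of 0 Z "cof A"] Z(3) by (simp add: DZ_def)
  have h': "((\<lambda>t. enn2real (h t)) has_real_derivative h') (at (lam ^ 3))"
  proof -
    obtain D where "\<And>t. t \<in> {0<..} \<Longrightarrow> ((\<lambda>t. enn2real (h t)) has_vector_derivative D t) (at t)"
      using h_C1 unfolding C1_differentiable_on_def by blast
    then have "((\<lambda>t. enn2real (h t)) has_real_derivative D (lam ^ 3)) (at (lam ^ 3))"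
      using lambda by (simp add: has_real_derivative_iff_has_vector_derivative)
    then show ?thesis unfolding h'_def by (simp add: DERIV_imp_deriv)
  qed
  have \<kappa>: "\<kappa> \<ge> 0" using kappa_bounds(1) powr_ge_zero[of 2 "2 - q"] by linarith
  have cond: "\<gamma> \<ge> lam * h' / 2" using cond2 lambda h'_pos by (simp add: field_simps)
  \<comment> \<open>\<open>E\<close> is the real value of the energy density at \<open>A\<close>,
    and \<open>lin\<close> the first-order part, whose integral along \<open>G\<close> will turn out
    to be 0.\<close>
  define E where "E = norm A powr q + \<gamma> * (norm A)\<^sup>2 + Z (cof A) + enn2real (h (lam ^ 3))"
  define lin where "lin F = (q * norm A powr (q - 2) + 2 * \<gamma>) * (A \<bullet> (F - A)) + DZ (cof F - cof A)
      + h' * (lam\<^sup>2 * trace (F - A) + lam * trace (cof (F - A)))" for F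
  have lower: "ennreal (E + lin F) \<le> ?W F" if "det F > 0" for F
    using stored_energy_lower_bound[OF gamma Z(1,2) DZ[unfolded A_def] h_finite h_convex h' h'_pos \<kappa> kappa lambda cond that]
    by (simp add: E_def lin_def A_def)

  have cof_int: "has_bochner_integral ?M (\<lambda>x. cof (\<Phi> x)) 0"
  proof (rule has_bochner_integral_matrix_0)
    fix i j
    obtain a k c l where eq: "\<And>B. cof B $ i $ j = minor B a k c l" using cof_minor[of i j] by blast
    show "integrable ?M (\<lambda>x. cof (\<Phi> x) $ i $ j)" "(\<integral>x. cof (\<Phi> x) $ i $ j \<partial>?M) = 0"
      using ints(3,4)[of a k c l] by (simp_all only: eq)
  qed
  \<comment> \<open>Cofactor entries are quadratic, so their increment at \<open>A\<close> consists
    of terms linear in \<open>\<Phi>\<close> and one minor of \<open>\<Phi>\<close>; each of these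
    has integral zero.\<close>
  have cof_diff_int: "has_bochner_integral ?M (\<lambda>x. cof (G x) - cof A) 0"
  proof (rule has_bochner_integral_matrix_0)
    fix i j
    obtain a k c l where eq: "\<And>B. cof B $ i $ j = minor B a k c l" using cof_minor[of i j] by blast
    have Geq: "(cof (G x) - cof A) $ i $ j = A $ a $ k * \<Phi> x $ c $ l + A $ c $ l * \<Phi> x $ a $ k
        - A $ a $ l * \<Phi> x $ c $ k - A $ c $ k * \<Phi> x $ a $ l + minor (\<Phi> x) a k c l" for x
      using minor_add_diff[of A "\<Phi> x" a k c l] by (simp add: eq \<Phi>_def)
    have "has_bochner_integral ?M (\<lambda>x. \<Phi> x $ a $ j) 0" "has_bochner_integral ?M (\<lambda>x. minor (\<Phi> x) a j c l) 0" for a j c l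
      using ints by (auto simp: has_bochner_integral_iff)
    then have "has_bochner_integral ?M (\<lambda>x. (cof (G x) - cof A) $ i $ j)
        (A $ a $ k * 0 + A $ c $ l * 0 - A $ a $ l * 0 - A $ c $ k * 0 + 0)"
      unfolding Geq by (intro has_bochner_integral_add has_bochner_integral_diff has_bochner_integral_mult_right)
    then show "integrable ?M (\<lambda>x. (cof (G x) - cof A) $ i $ j)" "(\<integral>x. (cof (G x) - cof A) $ i $ j \<partial>?M) = 0"
      by (simp_all add: has_bochner_integral_iff)
  qed
  have \<Phi>_int: "has_bochner_integral ?M \<Phi> 0"
    by (rule has_bochner_integral_matrix_0) (rule ints)+
  have tr_lin: "bounded_linear (trace :: real^3^3 \<Rightarrow> real)"
    unfolding linear_conv_bounded_linear[symmetric] trace_def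
    by (intro linearI) (auto simp: sum.distrib sum_distrib_left)
  have DZ_lin: "bounded_linear DZ" using DZ by (rule has_derivative_bounded_linear)
  have "has_bochner_integral ?M (\<lambda>x. (q * norm A powr (q - 2) + 2 * \<gamma>) * (A \<bullet> \<Phi> x) + DZ (cof (G x) - cof A)
      + h' * (lam\<^sup>2 * trace (\<Phi> x) + lam * trace (cof (\<Phi> x))))
      ((q * norm A powr (q - 2) + 2 * \<gamma>) * (A \<bullet> 0) + DZ 0 + h' * (lam\<^sup>2 * trace (0::real^3^3) + lam * trace (0::real^3^3)))"
    by (intro has_bochner_integral_add has_bochner_integral_mult_right
        has_bochner_integral_bounded_linear[OF bounded_linear_inner_right \<Phi>_int]
        has_bochner_integral_bounded_linear[OF DZ_lin cof_diff_int]
        has_bochner_integral_bounded_linear[OF tr_lin \<Phi>_int] has_bochner_integral_bounded_linear[OF tr_lin cof_int])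
  moreover have "trace (0::real^3^3) = 0" "DZ 0 = 0"
    using bounded_linear.linear[OF DZ_lin] by (simp_all add: trace_def linear_0)
  ultimately have lin_int: "integrable ?M (\<lambda>x. lin (G x))" "(\<integral>x. lin (G x) \<partial>?M) = 0"
    by (simp_all add: has_bochner_integral_iff lin_def \<Phi>_def)

  have det_A: "det A = lam ^ 3"
    using det_scaleR_mat_add[of lam 0] by (simp add: A_def trace_def cof_3 sum_3 det_3)
  have WA: "?W A = ennreal E"
  proof -
    have "h (lam ^ 3) = ennreal (enn2real (h (lam ^ 3)))"
      using h_finite[of "lam ^ 3"] lambda by (simp add: less_top)
    then show ?thesis unfolding stored_energy_def det_A E_def
      using gamma Z(1)[of "cof A"] by (subst ennreal_plus) auto
  qed
  have "energy \<Omega> ?W (\<lambda>x. lam *\<^sub>R x) = (\<integral>\<^sup>+x. ennreal E \<partial>?M)"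
    unfolding energy_def
  proof (rule nn_integral_cong_AE)
    show "AE x in ?M. ?W (weak_gradient \<Omega> (\<lambda>x. lam *\<^sub>R x) x) = ennreal E"
      using weak_gradient_scaleR[OF op, of lam] by eventually_elim (simp add: WA[unfolded A_def])
  qed
  also have "\<dots> = ennreal (\<integral>x. E \<partial>?M)"
    using gamma Z(1)[of "cof A"] by (intro nn_integral_eq_integral) (auto simp: E_def)
  also have "(\<integral>x. E \<partial>?M) = (\<integral>x. E + lin (G x) \<partial>?M)"
    by (subst Bochner_Integration.integral_add[OF _ lin_int(1)]) (auto simp: lin_int(2))
  also have "ennreal \<dots> \<le> (\<integral>\<^sup>+x. ennreal (E + lin (G x)) \<partial>?M)"
    using lin_int(1) by (intro ennreal_integral_le_nn_integral Bochner_Integration.integrable_add) auto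
  \<comment> \<open>The pointwise bound needs a positive determinant, which holds almost everywhere.
    With nonnegative integrals, infinite energy of \<open>u\<close> requires no separate
    case.\<close>
  also have "\<dots> \<le> (\<integral>\<^sup>+x. ?W (G x) \<partial>?M)"
  proof (rule nn_integral_mono_AE)
    show "AE x in ?M. ennreal (E + lin (G x)) \<le> ?W (G x)" using det_pos by eventually_elim (rule lower)
  qed
  also have "\<dots> = energy \<Omega> ?W u" by (simp add: energy_def G_def)
  finally show ?thesis .
qed

end
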